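(* Let $(G,\delta,d)$ be a complete metric scalable group and let $f\colon G\to\mathbb R$ be a Lipschitz map. Then there exists a Borel set $\Omega\subseteq G$ which is $(N_m)_m$-negligible for every filtration $(N_m)_{m\in\mathbb N}$ of $G$ by Carnot subgroups, and such that $f$ is Gâteaux differentiable at every $p\in G\setminus\Omega$.
   Context: A scalable group is a pair $(G,\delta)$ where $G$ is a (Hausdorff) topological group and $\delta\colon\mathbb R\times G\to G$ is continuous, such that $\delta_\lambda:=\delta(\lambda,\cdot)$ is an automorphism of $G$ for every $\lambda\neq0$, $\delta_\lambda\circ\delta_\mu=\delta_{\lambda\mu}$ for all $\lambda,\mu\in\mathbb R$, and $\delta_0\equiv e_G$. A subgroup $H$ is a scalable subgroup if $\delta_\lambda(H)=H$ for all $\lambda\neq0$. A metric scalable group $(G,\delta,d)$ is a scalable group with a left-invariant distance $d$ inducing its topology and satisfying $d(\delta_t p,\delta_t q)=|t|\,d(p,q)$ for all $t\in\mathbb R$, $p,q\in G$. A Carnot group is a simply connected Lie group whose Lie algebra is stratified, $\mathfrak g=V_1\oplus\cdots\oplus V_s$ with $[V_1,V_j]=V_{j+1}$, $[V_1,V_s]=0$; its dilations are the automorphisms whose differentials act as $\lambda^j$ on $V_j$. A scalable group $(N,\delta)$ has a Carnot group structure if there is a Carnot group isomorphic to $N$ as a topological group whose dilations coincide with $\delta$. A filtration by Carnot subgroups of $G$ is a sequence $(N_m)_{m\in\mathbb N}$ of scalable subgroups, each with a Carnot group structure, with $N_m<N_{m+1}$ and $G=\overline{\bigcup_m N_m}$.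 Given such a sequence, a Borel set $\Omega\subseteq G$ is $(N_m)_m$-negligible if $\Omega=\bigcup_{m}\Omega_m$ with $\Omega_m$ Borel and $\operatorname{vol}_{N_m}(N_m\cap g\Omega_m)=0$ for all $m\in\mathbb N$ and all $g\in G$, where $\operatorname{vol}_{N_m}$ is a Haar measure on $N_m$. $\mathbb R$ is regarded as a scalable group with addition and $\delta_\lambda(x)=\lambda x$. A map $f\colon G\to\mathbb R$ is Gâteaux differentiable at $p$ if, as $\lambda\to0$ ($\lambda\neq 0$), the maps $\hat f_{p,\lambda}(u):=\frac{1}{\lambda}\big(f(p\,\delta_\lambda(u))-f(p)\big)$ converge pointwise on $G$ to a continuous group homomorphism $G\to(\mathbb R,+)$. *)

theory Defs
  imports "HOL-Analysis.Analysis"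
begin

text \<open>The group G is a type of class group_add (written additively, NOT assumed
  commutative); its distance d is the metric of the type, which induces its topology.\<close>

definition metric_scalable_group :: "(real \<Rightarrow> 'g::{metric_space,group_add} \<Rightarrow> 'g) \<Rightarrow> bool" where
  "metric_scalable_group \<delta> \<longleftrightarrow>
     continuous_on UNIV (\<lambda>(x::'g, y::'g). x + y) \<and>
     continuous_on UNIV (uminus :: 'g \<Rightarrow> 'g) \<and>
     continuous_on UNIV (\<lambda>(t, x). \<delta> t x) \<and>
     (\<forall>t. t \<noteq> 0 \<longrightarrow> (\<forall>x y. \<delta> t (x + y) = \<delta> t x + \<delta> t y) \<and>
                         (\<exists>h. homeomorphism UNIV UNIV (\<delta> t) h)) \<and>
     (\<forall>t s. \<delta> t \<circ> \<delta> s = \<delta> (t * s)) \<and>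
     (\<forall>x. \<delta> 0 x = 0) \<and>
     (\<forall>p x y::'g. dist (p + x) (p + y) = dist x y) \<and>
     (\<forall>t p q. dist (\<delta> t p) (\<delta> t q) = \<bar>t\<bar> * dist p q)"

definition scalable_subgroup :: "(real \<Rightarrow> 'g::group_add \<Rightarrow> 'g) \<Rightarrow> 'g set \<Rightarrow> bool" where
  "scalable_subgroup \<delta> H \<longleftrightarrow>
     0 \<in> H \<and> (\<forall>x\<in>H. \<forall>y\<in>H. x + y \<in> H) \<and> (\<forall>x\<in>H. - x \<in> H) \<and>
     (\<forall>t. t \<noteq> 0 \<longrightarrow> \<delta> t ` H = H)"

type_synonym vec = "nat \<Rightarrow> real"

definition Rn :: "nat \<Rightarrow> vec set" where
  "Rn n = {x. \<forall>i\<ge>n. x i = 0}"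

definition vadd :: "vec \<Rightarrow> vec \<Rightarrow> vec" where "vadd x y = (\<lambda>i. x i + y i)"
definition vscale :: "real \<Rightarrow> vec \<Rightarrow> vec" where "vscale c x = (\<lambda>i. c * x i)"
definition vzero :: vec where "vzero = (\<lambda>i. 0)"
definition vsum :: "('a \<Rightarrow> vec) \<Rightarrow> 'a set \<Rightarrow> vec" where
  "vsum F A = (\<lambda>i. \<Sum>a\<in>A. F a i)"

definition lin_subspace :: "nat \<Rightarrow> vec set \<Rightarrow> bool" where
  "lin_subspace n V \<longleftrightarrow> V \<subseteq> Rn n \<and> vzero \<in> V \<and>
     (\<forall>x\<in>V. \<forall>y\<in>V. vadd x y \<in> V) \<and> (\<forall>c. \<forall>x\<in>V. vscale c x \<in> V)"

definition lie_algebra_on :: "nat \<Rightarrow> (vec \<Rightarrow> vec \<Rightarrow> vec) \<Rightarrow> bool" where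
  "lie_algebra_on n br \<longleftrightarrow>
     (\<forall>x\<in>Rn n. \<forall>y\<in>Rn n. br x y \<in> Rn n) \<and>
     (\<forall>a b. \<forall>x\<in>Rn n. \<forall>y\<in>Rn n. \<forall>z\<in>Rn n.
         br (vadd (vscale a x) (vscale b y)) z = vadd (vscale a (br x z)) (vscale b (br y z)) \<and>
         br z (vadd (vscale a x) (vscale b y)) = vadd (vscale a (br z x)) (vscale b (br z y))) \<and>
     (\<forall>x\<in>Rn n. br x x = vzero) \<and>
     (\<forall>x\<in>Rn n. \<forall>y\<in>Rn n. \<forall>z\<in>Rn n.
         vadd (vadd (br x (br y z)) (br y (br z x))) (br z (br x y)) = vzero)"

text \<open>[A,B]: the linear span of all brackets [a,b] with a in A, b in B
  (finite sums of brackets suffice, by bilinearity).\<close>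
definition bracket_span :: "(vec \<Rightarrow> vec \<Rightarrow> vec) \<Rightarrow> vec set \<Rightarrow> vec set \<Rightarrow> vec set" where
  "bracket_span br A B =
     {vsum (\<lambda>i. br (a i) (b i)) {..<k} | (k::nat) (a::nat \<Rightarrow> vec) (b::nat \<Rightarrow> vec). \<forall>i<k. a i \<in> A \<and> b i \<in> B}"

definition stratification :: "nat \<Rightarrow> (vec \<Rightarrow> vec \<Rightarrow> vec) \<Rightarrow> nat \<Rightarrow> (nat \<Rightarrow> vec set) \<Rightarrow> bool" where
  "stratification n br s V \<longleftrightarrow>
     1 \<le> s \<and>
     (\<forall>j\<in>{1..s}. lin_subspace n (V j)) \<and>
     (\<forall>x\<in>Rn n. \<exists>!v. (\<forall>j\<in>{1..s}. v j \<in> V j) \<and> (\<forall>j. j \<notin> {1..s} \<longrightarrow> v j = vzero) \<and>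
                      x = vsum v {1..s}) \<and>
     (\<forall>j\<in>{1..<s}. bracket_span br (V 1) (V j) = V (Suc j)) \<and>
     (\<forall>a\<in>V 1. \<forall>b\<in>V s. br a b = vzero)"

fun nested_bracket :: "(vec \<Rightarrow> vec \<Rightarrow> vec) \<Rightarrow> vec \<Rightarrow> vec \<Rightarrow> bool list \<Rightarrow> vec" where
  "nested_bracket br X Y [] = vzero"
| "nested_bracket br X Y [a] = (if a then X else Y)"
| "nested_bracket br X Y (a # b # w) = br (if a then X else Y) (nested_bracket br X Y (b # w))"

definition dynkin_word :: "(nat \<times> nat) list \<Rightarrow> bool list" where
  "dynkin_word rs = concat (map (\<lambda>(r, s). replicate r True @ replicate s False) rs)"

definition dynkin_degree :: "(nat \<times> nat) list \<Rightarrow> nat" where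
  "dynkin_degree rs = sum_list (map (\<lambda>(r, s). r + s) rs)"

definition dynkin_index :: "nat \<Rightarrow> nat \<Rightarrow> (nat \<times> nat) list set" where
  "dynkin_index D k = {rs. length rs = k \<and> (\<forall>(r, s)\<in>set rs. 0 < r + s) \<and> dynkin_degree rs \<le> D}"

definition dynkin_coeff :: "nat \<Rightarrow> (nat \<times> nat) list \<Rightarrow> real" where
  "dynkin_coeff k rs = (-1) ^ (k - 1) /
     (real k * real (dynkin_degree rs) * prod_list (map (\<lambda>(r, s). fact r * fact s) rs))"

text \<open>Baker-Campbell-Hausdorff (Dynkin) product, truncated at total degree D; on a
  Lie algebra that is nilpotent of step at most D this is the exact BCH product.\<close>
definition bch :: "(vec \<Rightarrow> vec \<Rightarrow> vec) \<Rightarrow> nat \<Rightarrow> vec \<Rightarrow> vec \<Rightarrow> vec" where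
  "bch br D X Y = vsum (\<lambda>(k, rs). vscale (dynkin_coeff k rs) (nested_bracket br X Y (dynkin_word rs)))
                      (SIGMA k:{1..D}. dynkin_index D k)"

text \<open>(N, delta restricted to N) has a Carnot group structure: N is isomorphic, as a
  topological group, to a Carnot group (realised in exponential coordinates as R^n with
  a stratified Lie bracket and the BCH product), and the Carnot dilations
  (multiplication by t^j on V_j) correspond to delta_t.\<close>
definition carnot_structure :: "'g::{topological_space,group_add} set \<Rightarrow> (real \<Rightarrow> 'g \<Rightarrow> 'g) \<Rightarrow> bool" where
  "carnot_structure N \<delta> \<longleftrightarrow>
     (\<exists>n br s V \<phi>.
        lie_algebra_on n br \<and> stratification n br s V \<and>
        bij_betw \<phi> (Rn n) N \<and> continuous_on (Rn n) \<phi> \<and> continuous_on N (inv_into (Rn n) \<phi>) \<and>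
        (\<forall>x\<in>Rn n. \<forall>y\<in>Rn n. \<phi> (bch br s x y) = \<phi> x + \<phi> y) \<and>
        (\<forall>t v. (\<forall>j\<in>{1..s}. v j \<in> V j) \<longrightarrow>
             \<phi> (vsum (\<lambda>j. vscale (t ^ j) (v j)) {1..s}) = \<delta> t (\<phi> (vsum v {1..s}))))"

definition carnot_filtration :: "(real \<Rightarrow> 'g::{topological_space,group_add} \<Rightarrow> 'g) \<Rightarrow> (nat \<Rightarrow> 'g set) \<Rightarrow> bool" where
  "carnot_filtration \<delta> N \<longleftrightarrow>
     (\<forall>m. scalable_subgroup \<delta> (N m) \<and> carnot_structure (N m) \<delta>) \<and>
     (\<forall>m. N m \<subseteq> N (Suc m)) \<and>
     closure (\<Union>m. N m) = UNIV"

text \<open>A Haar measure on a (locally compact, second countable) group N: a nonzero,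
  locally finite, left-invariant Borel measure on N.\<close>
definition haar_measure_on :: "'g::{topological_space,group_add} set \<Rightarrow> 'g measure \<Rightarrow> bool" where
  "haar_measure_on N \<mu> \<longleftrightarrow>
     space \<mu> = N \<and> sets \<mu> = sets (restrict_space borel N) \<and>
     (\<forall>x\<in>N. \<forall>A\<in>sets \<mu>. emeasure \<mu> ((\<lambda>y. x + y) ` A) = emeasure \<mu> A) \<and>
     (\<forall>x\<in>N. \<exists>U. openin (top_of_set N) U \<and> x \<in> U \<and> emeasure \<mu> U < \<infinity>) \<and>
     0 < emeasure \<mu> N"

definition negligible_wrt :: "(nat \<Rightarrow> 'g::{topological_space,group_add} set) \<Rightarrow> 'g set \<Rightarrow> bool" where
  "negligible_wrt N \<Omega> \<longleftrightarrow>
     \<Omega> \<in> sets borel \<and>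
     (\<exists>\<Omega>s. (\<forall>m. \<Omega>s m \<in> sets borel) \<and> \<Omega> = (\<Union>m. \<Omega>s m) \<and>
           (\<forall>m g \<mu>. haar_measure_on (N m) \<mu> \<longrightarrow>
               emeasure \<mu> (N m \<inter> (\<lambda>x. g + x) ` \<Omega>s m) = 0))"

definition gateaux_differentiable_at ::
  "(real \<Rightarrow> 'g::{topological_space,group_add} \<Rightarrow> 'g) \<Rightarrow> ('g \<Rightarrow> real) \<Rightarrow> 'g \<Rightarrow> bool" where
  "gateaux_differentiable_at \<delta> f p \<longleftrightarrow>
     (\<exists>L::'g \<Rightarrow> real.
        (\<forall>u. ((\<lambda>t. (f (p + \<delta> t u) - f p) / t) \<longlongrightarrow> L u) (at 0)) \<and>
        continuous_on UNIV L \<and> (\<forall>x y. L (x + y) = L x + L y))"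

end

theory Submission
  imports Defs
begin

text \<open>On a Carnot subgroup \<open>N\<close> the argument follows Pansu. Along a horizontal element \<open>u\<close> the map
  \<open>t \<mapsto> \<delta> t u\<close> is a one-parameter group, so by Fubini and the one-dimensional Rademacher theorem the
  derivative along \<open>u\<close> exists almost everywhere. A Haar measure of \<open>N\<close> is doubling for the distance,
  so porous sets are null; at a point \<open>p\<close> that is not porous for the compact sets on which the
  difference quotients along \<open>u\<close> are uniformly almost constant, the derivative along \<open>u\<close> may be
  computed from the base points \<open>p + \<delta> t w\<close>. The directions with this property form a closed subgroup
  on which the derivative is additive, and by the Baker-Campbell-Hausdorff formula a closed subgroup
  that contains the horizontal layer is all of \<open>N\<close>. On the whole group, existence of the limits and
  their additivity pass to the closure of \<open>\<Union>m. N m\<close> because the difference quotients are uniformly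
  Lipschitz in the direction.\<close>

section \<open>Lipschitz functions on the real line\<close>

text \<open>The exceptional set must not depend on the filtration, so it is the set of all points of
  non-differentiability; a filtration only splits it into pieces and shows that it is Borel. To this
  end differentiability along \<open>N m\<close> is tested on a countable dense subset, where it is
  a countable combination of statements that a limit at 0 exists. Each piece has to be null after
  every left translation; this is achieved by translating \<open>f\<close> instead, since the
  distance is left invariant. The obstacle is noncommutativity. The increment of \<open>f\<close>
  along \<open>\<delta> t (u + v)\<close> telescopes into one along \<open>u\<close> from
  \<open>p\<close> and one along \<open>v\<close> from \<open>p + \<delta> t u\<close>, a base point
  that moves with \<open>t\<close> and about which a derivative at \<open>p\<close> says nothing.
  Porosity repairs this. Asking for one limit from all moved base points makes the good directions
  closed under sums and inverses, which replaces a factorisation of group elements into horizontal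
  ones. Right translations are merely continuous, but a dilation reduces every scale to scale 1, so
  continuity at one point is enough.\<close>

lemma vitali_intervals:
  fixes S U :: "real set"
  assumes "open U" "S \<subseteq> U"
    and ex: "\<And>x d. x \<in> S \<Longrightarrow> 0 < d \<Longrightarrow> \<exists>a b. a < x \<and> x < b \<and> b - a < d \<and> P a b"
  obtains C where "countable C" "\<And>a b. (a, b) \<in> C \<Longrightarrow> a < b \<and> {a<..<b} \<subseteq> U \<and> P a b"
    "disjoint_family_on (\<lambda>(a, b). {a<..<b}) C"
    "negligible (S - (\<Union>(a, b)\<in>C. {a<..<b}))"
proof -
  let ?K = "{(a, b). a < b \<and> {a<..<b} \<subseteq> U \<and> P a b}"
  \<comment> \<open>Intervals are indexed by their endpoints and read as balls around their
    midpoints, so that the covering theorem for balls applies.\<close>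
  have ball: "ball ((fst i + snd i) / 2) ((snd i - fst i) / 2) = (case i of (a, b) \<Rightarrow> {a<..<b})" for i :: "real \<times> real"
    by (cases i) (auto simp: ball_eq_greaterThanLessThan field_simps)
  have "\<exists>i. i \<in> ?K \<and> x \<in> ball ((fst i + snd i) / 2) ((snd i - fst i) / 2) \<and> (snd i - fst i) / 2 < d"
    if x: "x \<in> S" and d: "0 < d" for x d
  proof -
    obtain e where e: "e > 0" "ball x e \<subseteq> U"
      using assms x by (meson openE subsetD)
    obtain a b where ab: "a < x" "x < b" "b - a < min d e" "P a b"
      using ex[OF x, of "min d e"] d e by auto
    have "{a<..<b} \<subseteq> ball x e"
      using ab by (auto simp: ball_eq_greaterThanLessThan)
    then have "(a, b) \<in> ?K" using ab e by auto
    then show ?thesis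
      using ab ball[of "(a, b)"] by (intro exI[of _ "(a, b)"]) auto
  qed
  from Vitali_covering_theorem_balls[of S ?K, OF this]
  obtain C where C: "countable C" "C \<subseteq> ?K"
    "pairwise (\<lambda>i j. disjnt (case i of (a, b) \<Rightarrow> {a<..<b}) (case j of (a, b) \<Rightarrow> {a<..<b})) C"
    "negligible (S - (\<Union>i\<in>C. case i of (a, b) \<Rightarrow> {a<..<b}))"
    unfolding ball by blast
  show ?thesis
    by (rule that[of C]) (use C in \<open>auto simp: pairwise_def disjoint_family_on_def disjnt_def\<close>)
qed

text \<open>Carries a slope bound from single intervals to a whole Vitali family: both measures are
  sums over the family, written as integrals over the counting measure.\<close>

lemma emeasure_countable_UN_mult_le:
  assumes "countable C" "disjoint_family_on X C"
    and "\<And>i. i \<in> C \<Longrightarrow> X i \<in> sets M" "\<And>i. i \<in> C \<Longrightarrow> X i \<in> sets L"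
    and le: "\<And>i. i \<in> C \<Longrightarrow> p * emeasure M (X i) \<le> q * emeasure L (X i)"
  shows "p * emeasure M (\<Union>i\<in>C. X i) \<le> q * emeasure L (\<Union>i\<in>C. X i)"
proof -
  have "p * emeasure M (\<Union>i\<in>C. X i) = (\<integral>\<^sup>+ i. p * emeasure M (X i) \<partial>count_space C)"
    using assms by (subst emeasure_UN_countable) (auto simp: nn_integral_cmult)
  also have "\<dots> \<le> (\<integral>\<^sup>+ i. q * emeasure L (X i) \<partial>count_space C)"
    using le by (intro nn_integral_mono) auto
  also have "\<dots> = q * emeasure L (\<Union>i\<in>C. X i)"
    using assms by (subst emeasure_UN_countable) (auto simp: nn_integral_cmult)
  finally show ?thesis .
qed

text \<open>The Vitali covering is taken twice: once inside a neighbourhood of the set by intervals of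
  slope below \<open>p\<close>, then inside these intervals by intervals of slope above \<open>q\<close>.\<close>

lemma slopes_below_above_null:
  fixes f :: "real \<Rightarrow> real"
  assumes mono: "mono f" and cont: "continuous_on UNIV f" and pq: "0 \<le> p" "p < q"
    and S: "S \<in> sets borel" "bounded S"
    and below: "\<And>x d. x \<in> S \<Longrightarrow> 0 < d \<Longrightarrow> \<exists>a b. a < x \<and> x < b \<and> b - a < d \<and> f b - f a < p * (b - a)"
    and above: "\<And>x d. x \<in> S \<Longrightarrow> 0 < d \<Longrightarrow> \<exists>a b. a < x \<and> x < b \<and> b - a < d \<and> f b - f a > q * (b - a)"
  shows "emeasure lborel S = 0"
proof -
  \<comment> \<open>The Stieltjes measure of \<open>f\<close> gives an interval the increment of
    \<open>f\<close>, so slope bounds become comparisons of two measures; continuity of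
    \<open>f\<close> makes the endpoints null.\<close>
  let ?X = "\<lambda>(a, b). {a<..<b::real}" and ?\<nu> = "interval_measure f"
  have \<nu>: "emeasure ?\<nu> {a<..<b} = ennreal (f b - f a)" if "a < b" for a b
  proof -
    have "emeasure ?\<nu> {b} = 0"
      using emeasure_interval_measure_Icc[of b b f] mono cont by (auto simp: mono_def)
    moreover have "{a<..b} = {a<..<b} \<union> {b}" using that by auto
    moreover have "emeasure ?\<nu> ({a<..<b} \<union> {b}) = emeasure ?\<nu> {a<..<b} + emeasure ?\<nu> {b}"
      by (subst plus_emeasure) auto
    moreover have "emeasure ?\<nu> {a<..b} = f b - f a"
      using that mono cont
      by (intro emeasure_interval_measure_Ioc)
        (auto simp: mono_def continuous_on_eq_continuous_at intro: continuous_at_imp_continuous_at_within)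
    ultimately show ?thesis by simp
  qed
  have fin: "emeasure lborel S < \<infinity>"
    using S(2) by (rule emeasure_bounded_finite)
  have "q * emeasure lborel S \<le> p * emeasure lborel S + e" if e0: "e > 0" for e :: real
  proof -
    obtain U where U: "open U" "S \<subseteq> U" "emeasure lborel U \<le> emeasure lborel S + ennreal (e / (p + 1))"
    proof -
      \<comment> \<open>\<open>p + 1\<close> because \<open>p\<close> may be 0; multiplied by
        \<open>p\<close> the excess is still at most \<open>e\<close>.\<close>
      have "0 < e / (p + 1)" using e0 pq by auto
      from outer_regular_lborel_le[OF S(1) this] obtain T where
        T: "open T" "S \<subseteq> T" "emeasure lborel (T - S) \<le> ennreal (e / (p + 1))" by metis
      have "emeasure lborel T = emeasure lborel (S \<union> (T - S))"
        using T by (simp add: Un_absorb1)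
      also have "\<dots> \<le> emeasure lborel S + emeasure lborel (T - S)"
        using S T by (intro emeasure_subadditive) auto
      finally show ?thesis using T that by (meson add_left_mono order_trans)
    qed
    obtain C1 where C1: "countable C1" 
      "\<And>a b. (a, b) \<in> C1 \<Longrightarrow> a < b \<and> {a<..<b} \<subseteq> U \<and> f b - f a < p * (b - a)"
      "disjoint_family_on ?X C1" "negligible (S - (\<Union>(a, b)\<in>C1. {a<..<b}))"
      by (rule vitali_intervals[OF U(1,2) below]) auto
    define W where "W = (\<Union>i\<in>C1. ?X i)"
    have W: "open W" "W \<subseteq> U" unfolding W_def using C1(2) by (auto intro!: open_UN)
    have "1 * emeasure ?\<nu> W \<le> p * emeasure lborel W"
      unfolding W_def
    proof (rule emeasure_countable_UN_mult_le[OF C1(1,3)])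
      fix i assume "i \<in> C1"
      then show "1 * emeasure ?\<nu> (?X i) \<le> ennreal p * emeasure lborel (?X i)"
        using C1(2)[of "fst i" "snd i"] pq
        by (auto simp: \<nu> split_beta simp flip: ennreal_mult intro!: ennreal_leI)
    qed auto
    then have 1: "emeasure ?\<nu> W \<le> p * emeasure lborel U"
      using W U(1) by (simp add: order_trans[OF _ mult_left_mono[OF emeasure_mono]])
    obtain C2 where C2: "countable C2"
      "\<And>a b. (a, b) \<in> C2 \<Longrightarrow> a < b \<and> {a<..<b} \<subseteq> W \<and> f b - f a > q * (b - a)"
      "disjoint_family_on ?X C2" "negligible (S \<inter> W - (\<Union>(a, b)\<in>C2. {a<..<b}))"
      by (rule vitali_intervals[OF W(1) _ above, of "S \<inter> W"]) auto
    define Z where "Z = (\<Union>i\<in>C2. ?X i)"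
    have Z: "open Z" "Z \<subseteq> W" unfolding Z_def using C2(2) by (auto intro!: open_UN)
    have "q * emeasure lborel Z \<le> 1 * emeasure ?\<nu> Z"
      unfolding Z_def
    proof (rule emeasure_countable_UN_mult_le[OF C2(1,3)])
      fix i assume "i \<in> C2"
      then show "ennreal q * emeasure lborel (?X i) \<le> 1 * emeasure ?\<nu> (?X i)"
        using C2(2)[of "fst i" "snd i"] pq
        by (auto simp: \<nu> split_beta simp flip: ennreal_mult intro!: ennreal_leI)
    qed auto
    also have "\<dots> \<le> emeasure ?\<nu> W"
      using Z W by (simp add: emeasure_mono)
    \<comment> \<open>The chain is
      \<open>q |Z| \<le> \<nu>(Z) \<le> \<nu>(W) \<le> p |W| \<le> p |U|\<close>. Up to a null set
      \<open>S\<close> lies in \<open>Z\<close>, and \<open>U\<close> exceeds \<open>S\<close> by an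
      arbitrarily small measure, so \<open>q |S| \<le> p |S|\<close>.\<close>
    finally have 2: "q * emeasure lborel Z \<le> p * emeasure lborel U" using 1 by simp
    have "negligible (S - Z)"
      by (rule negligible_subset[OF negligible_Un[OF C1(4) C2(4)]]) (auto simp: W_def Z_def)
    then have "S - Z \<in> null_sets lborel"
      using S Z by (simp add: negligible_iff_null_sets null_sets_completion_iff)
    then have "emeasure lborel S \<le> emeasure lborel Z"
      using emeasure_mono[of S "Z \<union> (S - Z)" lborel] emeasure_Un_null_set[of Z lborel "S - Z"] S Z by auto
    then have "q * emeasure lborel S \<le> p * emeasure lborel U"
      using 2 by (meson mult_left_mono order_trans zero_le)
    also have "\<dots> \<le> p * (emeasure lborel S + ennreal (e / (p + 1)))"
      using U by (intro mult_left_mono) auto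
    also have "\<dots> = p * emeasure lborel S + ennreal (p * (e / (p + 1)))"
      using pq e0 by (subst ennreal_mult) (auto simp: distrib_left)
    also have "\<dots> \<le> p * emeasure lborel S + e"
      using pq e0 by (intro add_left_mono ennreal_leI) (auto simp: field_simps)
    finally show ?thesis .
  qed
  then have "q * emeasure lborel S \<le> p * emeasure lborel S"
    by (rule ennreal_le_epsilon)
  then have "q * measure lborel S \<le> p * measure lborel S"
    using pq fin by (simp add: emeasure_eq_ennreal_measure flip: ennreal_mult)
  then have "measure lborel S = 0"
    using pq by (smt (verit) measure_nonneg mult_right_mono mult_strict_right_mono)
  then show ?thesis
    using fin by (simp add: emeasure_eq_ennreal_measure)
qed

text \<open>Adding \<open>C * x\<close> makes the function nondecreasing with quotients in
  \<open>[0, 2 * C]\<close>, so the lower and upper derivatives are finite. Where they differ, two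
  rationals \<open>p < q\<close> separate them and the point lies in one of the countably many null
  sets \<open>E p q k\<close>.\<close>

lemma lipschitz_differentiable_AE:
  fixes g :: "real \<Rightarrow> real"
  assumes "C-lipschitz_on UNIV g"
  shows "AE x in lborel. \<exists>l. ((\<lambda>s. (g (x + s) - g x) / s) \<longlongrightarrow> l) (at 0)"
proof -
  have C: "0 \<le> C" "\<And>x y. \<bar>g x - g y\<bar> \<le> C * \<bar>x - y\<bar>"
    using assms by (auto simp: lipschitz_on_def dist_real_def)
  define f where "f x = g x + C * x" for x
  have mono: "mono f"
  proof
    fix x y :: real assume "x \<le> y"
    then show "f x \<le> f y" using C(2)[of x y] by (auto simp: f_def algebra_simps)
  qed
  have contg: "continuous_on UNIV g" using assms by (rule lipschitz_on_continuous_on)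
  then have cont: "continuous_on UNIV f" unfolding f_def by (intro continuous_intros)
  \<comment> \<open>Unions of open intervals, hence open, which makes \<open>E p q k\<close> Borel
    at once; its window \<open>k\<close> makes it bounded.\<close>
  define lo where "lo p n = (\<Union>(a, b)\<in>{(a, b). b - a < 1 / real (Suc n) \<and> f b - f a < p * (b - a)}. {a<..<b})" for p n
  define up where "up q n = (\<Union>(a, b)\<in>{(a, b). b - a < 1 / real (Suc n) \<and> f b - f a > q * (b - a)}. {a<..<b})" for q n
  define E where "E p q k = {- real k<..<real k} \<inter> (\<Inter>n. lo p n) \<inter> (\<Inter>n. up q n)" for p q :: real and k :: nat
  have open_lo: "open (lo p n)" and open_up: "open (up p n)" for p n
    unfolding lo_def up_def by (auto intro!: open_UN)
  have E: "E p q k \<in> null_sets lborel" if "0 \<le> p" "p < q" for p q k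
  proof -
    have m: "E p q k \<in> sets borel"
      unfolding E_def using open_lo open_up by (intro sets.Int sets.countable_INT) auto
    have n: "\<exists>n. 1 / real (Suc n) < d" if "d > 0" for d
      using nat_approx_posE[OF that] by metis
    have "emeasure lborel (E p q k) = 0"
    proof (rule slopes_below_above_null[OF mono cont that m])
      show "bounded (E p q k)"
        by (rule bounded_subset[of "{- real k<..<real k}"]) (auto simp: E_def)
      show "\<exists>a b. a < x \<and> x < b \<and> b - a < d \<and> f b - f a < p * (b - a)" if x: "x \<in> E p q k" and "0 < d" for x d
      proof -
        obtain n where "1 / real (Suc n) < d" using n[OF \<open>0 < d\<close>] by blast
        moreover have "x \<in> lo p n" using x by (auto simp: E_def)
        ultimately show ?thesis unfolding lo_def by force
      qed
      show "\<exists>a b. a < x \<and> x < b \<and> b - a < d \<and> f b - f a > q * (b - a)" if x: "x \<in> E p q k" and "0 < d" for x d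
      proof -
        obtain n where "1 / real (Suc n) < d" using n[OF \<open>0 < d\<close>] by blast
        moreover have "x \<in> up q n" using x by (auto simp: E_def)
        ultimately show ?thesis unfolding up_def by force
      qed
    qed
    then show ?thesis using m by auto
  qed
  have "(\<Union>(p, q)\<in>{(p, q)\<in>\<rat> \<times> \<rat>. 0 \<le> p \<and> p < q}. \<Union>k. E p q k) \<in> null_sets lborel"
  proof (rule null_sets_UN')
    show "countable {(p, q)\<in>\<rat> \<times> \<rat>. 0 \<le> p \<and> p < (q::real)}"
      by (rule countable_subset[of _ "\<rat> \<times> \<rat>"]) (auto simp: countable_rat)
  qed (use E in auto)
  then show ?thesis
  proof (rule AE_I', safe)
    fix x assume nd: "\<nexists>l. ((\<lambda>s. (g (x + s) - g x) / s) \<longlongrightarrow> l) (at 0)"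
    define Q where "Q s = (f (x + s) - f x) / s" for s
    have Q: "0 \<le> Q s" "Q s \<le> 2 * C" if "s \<noteq> 0" for s
    proof -
      have "\<bar>g (x + s) - g x\<bar> \<le> C * \<bar>s\<bar>" using C(2)[of "x + s" x] by simp
      then show "0 \<le> Q s" "Q s \<le> 2 * C" using that
        by (auto simp: Q_def f_def field_simps abs_if split: if_splits)
    qed
    have ev: "\<forall>\<^sub>F s in at 0. 0 \<le> ereal (Q s)" "\<forall>\<^sub>F s in at 0. ereal (Q s) \<le> ereal (2 * C)"
      using Q by (auto simp: eventually_at_filter)
    let ?l = "Liminf (at 0) (\<lambda>s. ereal (Q s))" and ?u = "Limsup (at 0) (\<lambda>s. ereal (Q s))"
    have lu: "0 \<le> ?l" "?u \<le> ereal (2 * C)" "?l \<le> ?u"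
      using ev by (auto intro: Liminf_bounded Limsup_bounded Liminf_le_Limsup)
    have "?l \<noteq> ?u"
    proof
      assume eq: "?l = ?u"
      then have "((\<lambda>s. ereal (Q s)) \<longlongrightarrow> ?l) (at 0)"
        by (intro Liminf_eq_Limsup) auto
      moreover have "\<bar>?l\<bar> \<noteq> \<infinity>" using lu eq by auto
      ultimately have "(Q \<longlongrightarrow> real_of_ereal ?l) (at 0)"
        by (metis ereal_real' lim_ereal)
      then have "((\<lambda>s. Q s - C) \<longlongrightarrow> real_of_ereal ?l - C) (at 0)"
        by (intro tendsto_intros)
      moreover have "\<forall>\<^sub>F s in at 0. Q s - C = (g (x + s) - g x) / s"
        by (auto simp: eventually_at_filter Q_def f_def field_simps)
      ultimately have "((\<lambda>s. (g (x + s) - g x) / s) \<longlongrightarrow> real_of_ereal ?l - C) (at 0)"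
        by (rule Lim_transform_eventually)
      then show False using nd by blast
    qed
    then have "?l < ?u" using lu by simp
    then obtain p where p: "p \<in> \<rat>" "?l < ereal p" "ereal p < ?u"
      using ereal_dense3 by (metis Rats_of_rat)
    obtain q where q: "q \<in> \<rat>" "ereal p < ereal q" "ereal q < ?u"
      using ereal_dense3[OF p(3)] by (metis Rats_of_rat)
    have "0 \<le> p" "p < q" using p q lu by (auto simp flip: zero_ereal_def dest: order.strict_trans1)
    \<comment> \<open>A difference quotient at \<open>x\<close> is the slope of an interval that
      ends at \<open>x\<close>, but the covering needs \<open>x\<close> inside. The end at
      \<open>x\<close> is pushed slightly outwards, and continuity keeps the strict inequality. It
      is applied to \<open>p * x - f x\<close> and to \<open>f x - q * x\<close>.\<close>
    have widen: "\<exists>a b. a < x \<and> x < b \<and> b - a < d \<and> G b - G a > 0"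
      if "d > 0" "\<exists>\<^sub>F s in at 0. (G (x + s) - G x) / s > 0" "continuous_on UNIV G" for d and G :: "real \<Rightarrow> real"
    proof -
      have "\<forall>\<^sub>F s in at (0::real). \<bar>s\<bar> < d / 2"
        using that(1) by (auto simp: eventually_at dist_real_def intro!: exI[of _ "d / 2"])
      moreover have "\<forall>\<^sub>F s in at (0::real). s \<noteq> 0" by (auto simp: eventually_at_filter)
      ultimately have "\<exists>\<^sub>F s in at 0. (G (x + s) - G x) / s > 0 \<and> \<bar>s\<bar> < d / 2 \<and> s \<noteq> 0"
        using frequently_eventually_frequently[OF that(2) eventually_conj] by blast
      from frequently_ex[OF this] obtain s where s: "(G (x + s) - G x) / s > 0" "\<bar>s\<bar> < d / 2" "s \<noteq> 0"
        by blast
      have "(G \<longlongrightarrow> G x) (at x)"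
        using that(3) by (auto simp: continuous_on_eq_continuous_at isCont_def)
      then have G: "(G \<longlongrightarrow> G x) (at_left x)" "(G \<longlongrightarrow> G x) (at_right x)"
        unfolding filterlim_at_split by auto
      show ?thesis
      proof (cases "s > 0")
        case True
        then have "G x < G (x + s)" using s by (simp add: zero_less_divide_iff)
        then have "\<forall>\<^sub>F a in at_left x. G a < G (x + s)"
          using order_tendstoD(2)[OF G(1)] by blast
        moreover have "\<forall>\<^sub>F a in at_left x. a \<in> {x - d / 2<..<x}"
          using that by (intro eventually_at_left_real) auto
        ultimately have "\<forall>\<^sub>F a in at_left x. G a < G (x + s) \<and> a \<in> {x - d / 2<..<x}"
          by eventually_elim auto
        then obtain a where "G a < G (x + s)" "a \<in> {x - d / 2<..<x}"
          using eventually_happens[of _ "at_left x"] by auto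
        then show ?thesis using s True by (intro exI[of _ a] exI[of _ "x + s"]) auto
      next
        case False
        then have "G x > G (x + s)" using s by (simp add: zero_less_divide_iff)
        then have "\<forall>\<^sub>F a in at_right x. G a > G (x + s)"
          using order_tendstoD(1)[OF G(2)] by blast
        moreover have "\<forall>\<^sub>F a in at_right x. a \<in> {x<..<x + d / 2}"
          using that by (intro eventually_at_right_real) auto
        ultimately have "\<forall>\<^sub>F a in at_right x. G a > G (x + s) \<and> a \<in> {x<..<x + d / 2}"
          by eventually_elim auto
        then obtain a where "G a > G (x + s)" "a \<in> {x<..<x + d / 2}"
          using eventually_happens[of _ "at_right x"] by auto
        then show ?thesis using s False by (intro exI[of _ "x + s"] exI[of _ a]) auto
      qed
    qed
    have nz: "\<forall>\<^sub>F s in at (0::real). s \<noteq> 0" by (auto simp: eventually_at_filter)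
    have "x \<in> lo p n" for n
    proof -
      have "\<exists>\<^sub>F s in at 0. Q s < p"
        using p(2) Liminf_bounded[of "ereal p" "\<lambda>s. ereal (Q s)" "at 0"]
        by (auto simp: frequently_def not_less)
      from frequently_eventually_frequently[OF this nz]
      have "\<exists>\<^sub>F s in at 0. ((p * (x + s) - f (x + s)) - (p * x - f x)) / s > 0"
        by (rule frequently_elim1) (auto simp: Q_def diff_divide_distrib add_divide_distrib algebra_simps)
      moreover have "continuous_on UNIV (\<lambda>x. p * x - f x)" using cont by (intro continuous_intros)
      ultimately have "\<exists>a b. a < x \<and> x < b \<and> b - a < 1 / real (Suc n) \<and> p * b - f b - (p * a - f a) > 0"
        by (intro widen) auto
      then obtain a b where "a < x" "x < b" "b - a < 1 / real (Suc n)" "p * b - f b - (p * a - f a) > 0"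
        by blast
      then have "(a, b) \<in> {(a, b). b - a < 1 / real (Suc n) \<and> f b - f a < p * (b - a)}" "x \<in> {a<..<b}"
        by (auto simp: algebra_simps)
      then show ?thesis unfolding lo_def by blast
    qed
    moreover have "x \<in> up q n" for n
    proof -
      have "\<exists>\<^sub>F s in at 0. Q s > q"
        using q(3) Limsup_bounded[of "\<lambda>s. ereal (Q s)" "ereal q" "at 0"]
        by (auto simp: frequently_def not_less)
      from frequently_eventually_frequently[OF this nz]
      have "\<exists>\<^sub>F s in at 0. ((f (x + s) - q * (x + s)) - (f x - q * x)) / s > 0"
        by (rule frequently_elim1) (auto simp: Q_def diff_divide_distrib add_divide_distrib algebra_simps)
      moreover have "continuous_on UNIV (\<lambda>x. f x - q * x)" using cont by (intro continuous_intros)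
      ultimately have "\<exists>a b. a < x \<and> x < b \<and> b - a < 1 / real (Suc n) \<and> f b - q * b - (f a - q * a) > 0"
        by (intro widen) auto
      then obtain a b where "a < x" "x < b" "b - a < 1 / real (Suc n)" "f b - q * b - (f a - q * a) > 0"
        by blast
      then have "(a, b) \<in> {(a, b). b - a < 1 / real (Suc n) \<and> f b - f a > q * (b - a)}" "x \<in> {a<..<b}"
        by (auto simp: algebra_simps)
      then show ?thesis unfolding up_def by blast
    qed
    moreover obtain k :: nat where "\<bar>x\<bar> < real k" using reals_Archimedean2 by blast
    ultimately have "x \<in> E p q k" by (auto simp: E_def)
    then show "x \<in> (\<Union>(p, q)\<in>{(p, q)\<in>\<rat> \<times> \<rat>. 0 \<le> p \<and> p < q}. \<Union>k. E p q k)"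
      using p q \<open>0 \<le> p\<close> \<open>p < q\<close> by blast
  qed
qed

section \<open>Porous sets\<close>

text \<open>Greedy selection: keep a ball of largest radius, drop all balls that meet it, and
  recurse. A dropped ball has no larger radius, so it lies in the threefold enlargement of the ball
  that it met.\<close>

lemma finite_Vitali_covering:
  fixes a :: "'i \<Rightarrow> 'a::metric_space"
  assumes "finite I" "\<And>i. i \<in> I \<Longrightarrow> 0 < r i"
  shows "\<exists>J\<subseteq>I. disjoint_family_on (\<lambda>i. ball (a i) (r i)) J \<and>
    (\<Union>i\<in>I. ball (a i) (r i)) \<subseteq> (\<Union>j\<in>J. ball (a j) (3 * r j))"
  using assms
proof (induction rule: finite_psubset_induct)
  case (psubset I)
  show ?case
  proof (cases "I = {}")
    case False
    obtain i where i: "i \<in> I" "\<And>j. j \<in> I \<Longrightarrow> r j \<le> r i"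
      using Max_in[of "r ` I"] Max_ge[of "r ` I"] False psubset.hyps by (metis (no_types) finite_imageI image_iff image_is_empty)
    define I' where "I' = {j \<in> I. ball (a j) (r j) \<inter> ball (a i) (r i) = {}}"
    have "a i \<in> ball (a i) (r i)" using i psubset.prems[of i] by auto
    then have "i \<notin> I'" unfolding I'_def by blast
    moreover have "I' \<subseteq> I" by (auto simp: I'_def)
    ultimately have "I' \<subset> I" using i by blast
    then obtain J where J: "J \<subseteq> I'" "disjoint_family_on (\<lambda>i. ball (a i) (r i)) J"
      "(\<Union>i\<in>I'. ball (a i) (r i)) \<subseteq> (\<Union>j\<in>J. ball (a j) (3 * r j))"
      using psubset.IH[of I'] psubset.prems by blast
    show ?thesis
    proof (intro exI[of _ "insert i J"] conjI)
      show "insert i J \<subseteq> I" using J i by (auto simp: I'_def)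
      show "disjoint_family_on (\<lambda>i. ball (a i) (r i)) (insert i J)"
        using J(1,2) unfolding disjoint_family_on_def I'_def by blast
      have "ball (a j) (r j) \<subseteq> ball (a i) (3 * r i)" if j: "j \<in> I" "j \<notin> I'" for j
      proof
        fix x assume x: "x \<in> ball (a j) (r j)"
        obtain y where "y \<in> ball (a j) (r j)" "y \<in> ball (a i) (r i)"
          using j unfolding I'_def by blast
        then show "x \<in> ball (a i) (3 * r i)"
          using x i(2)[OF j(1)] dist_triangle[of "a i" x y] dist_triangle[of y x "a j"]
          by (auto simp: dist_commute)
      qed
      then show "(\<Union>i\<in>I. ball (a i) (r i)) \<subseteq> (\<Union>j\<in>insert i J. ball (a j) (3 * r j))"
        using J(3) by blast
    qed
  qed (auto simp: disjoint_family_on_def)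
qed

text \<open>A finite Vitali subfamily of balls around the points of the set has disjoint holes, all
  contained in a small neighbourhood of \<open>E\<close> but outside \<open>E\<close>; by doubling the holes
  control the measure of the set.\<close>

lemma porous_points_null:
  fixes \<mu> :: "'a::metric_space measure"
  assumes sp: "space \<mu> = N" and se: "sets \<mu> = sets (restrict_space borel N)"
    and fin: "\<And>x r. x \<in> N \<Longrightarrow> emeasure \<mu> (ball x r \<inter> N) < \<infinity>"
    and dbl: "\<And>A b. 0 < A \<Longrightarrow> 0 < b \<Longrightarrow> \<exists>M::real. \<forall>x\<in>N. \<forall>y\<in>N. \<forall>t>0.
      emeasure \<mu> (ball x (A * t) \<inter> N) \<le> ennreal M * emeasure \<mu> (ball y (b * t) \<inter> N)"
    and cpt: "\<And>x r. x \<in> N \<Longrightarrow> compact (cball x r \<inter> N)"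
    and E: "compact E" "E \<subseteq> N" and R: "0 < R" and b: "0 < b"
  shows "\<exists>Z\<in>null_sets \<mu>. {p \<in> E. \<forall>d>0. \<exists>t>0. t < d \<and>
    (\<exists>x\<in>N. dist p x \<le> R * t \<and> ball x (b * t) \<inter> E = {})} \<subseteq> Z"
proof (cases "E = {}")
  case True
  then show ?thesis by auto
next
  case False
  have meas: "A \<inter> N \<in> sets \<mu>" if "A \<in> sets borel" for A
    using that unfolding se by (auto simp: sets_restrict_space)
  have closed_meas: "A \<in> sets \<mu>" if "closed A" "A \<subseteq> N" for A
    using meas[of A] that by (simp add: Int_absorb2)
  \<comment> \<open>The scales range over a compact interval away from 0. Limits of such holes are
    again such holes, so \<open>Q k l\<close> is compact: measurable, and covered by finitely many
    balls.\<close>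
  define Q where "Q k l = {p \<in> E. \<exists>t\<in>{1 / real (Suc l)..1 / real (Suc k)}.
    \<exists>x\<in>N. dist p x \<le> R * t \<and> ball x (b * t) \<inter> E = {}}" for k l
  \<comment> \<open>The hole of a point of \<open>Q k l\<close> reaches at most
    \<open>(R + b) * t\<close> from it, so it stays in \<open>U k\<close>; the factor
    \<open>3 * (R + b)\<close> below is the Vitali enlargement of this reach.\<close>
  define U where "U k = (\<Union>e\<in>E. ball e ((R + b) / real (Suc k))) \<inter> N" for k
  obtain M where M: "\<And>x y t. x \<in> N \<Longrightarrow> y \<in> N \<Longrightarrow> 0 < t \<Longrightarrow>
      emeasure \<mu> (ball x (3 * (R + b) * t) \<inter> N) \<le> ennreal M * emeasure \<mu> (ball y (b * t) \<inter> N)"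
    using dbl[of "3 * (R + b)" b] R b by (metis add_pos_pos mult_pos_pos zero_less_numeral)
  have U: "U k \<in> sets \<mu>" for k unfolding U_def by (intro meas borel_open) auto
  have Eset: "E \<in> sets \<mu>" using E by (auto intro: closed_meas compact_imp_closed)
  have Qc: "compact (Q k l)" for k l
  proof -
    obtain e where e: "e \<in> E" using False by auto
    obtain D where D: "\<And>y. y \<in> E \<Longrightarrow> dist e y \<le> D"
      using compact_imp_bounded[OF E(1)] bounded_any_center[of E e] by (auto simp: dist_commute)
    let ?T = "{1 / real (Suc l)..1 / real (Suc k)}"
    let ?X = "cball e (D + R * (1 / real (Suc k))) \<inter> N"
    have K: "compact (E \<times> ?T \<times> ?X)"
      using e E by (intro compact_Times cpt compact_Icc E(1)) auto
    have "\<exists>p\<in>Q k l. \<exists>r. strict_mono r \<and> (f \<circ> r) \<longlonglongrightarrow> p" if f: "\<forall>n. f n \<in> Q k l" for f :: "nat \<Rightarrow> 'a"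
    proof -
      have "\<forall>n. \<exists>t x. t \<in> ?T \<and> x \<in> N \<and> dist (f n) x \<le> R * t \<and> ball x (b * t) \<inter> E = {}"
        using f unfolding Q_def by blast
      then obtain t x where tx: "\<And>n. t n \<in> ?T" "\<And>n. x n \<in> N" "\<And>n. dist (f n) (x n) \<le> R * t n"
          "\<And>n. ball (x n) (b * t n) \<inter> E = {}"
        by metis
      have fE: "f n \<in> E" for n using f by (auto simp: Q_def)
      have "(f n, t n, x n) \<in> E \<times> ?T \<times> ?X" for n
      proof -
        have "dist e (x n) \<le> D + R * t n"
          using dist_triangle[of e "x n" "f n"] D[OF fE[of n]] tx(3)[of n] by auto
        also have "\<dots> \<le> D + R * (1 / real (Suc k))"
          using tx(1)[of n] R by (intro add_left_mono mult_left_mono) auto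
        finally show ?thesis using tx(1,2) fE by auto
      qed
      with K obtain q r where q: "q \<in> E \<times> ?T \<times> ?X" "strict_mono (r::nat \<Rightarrow> nat)"
          "((\<lambda>n. (f n, t n, x n)) \<circ> r) \<longlonglongrightarrow> q"
        unfolding compact_eq_seq_compact_metric seq_compact_def by meson
      obtain p s y where [simp]: "q = (p, s, y)" by (cases q)
      have lims: "(\<lambda>n. f (r n)) \<longlonglongrightarrow> p" "(\<lambda>n. t (r n)) \<longlonglongrightarrow> s" "(\<lambda>n. x (r n)) \<longlonglongrightarrow> y"
        using tendsto_fst[OF q(3)] tendsto_fst[OF tendsto_snd[OF q(3)]] tendsto_snd[OF tendsto_snd[OF q(3)]]
        by (simp_all add: o_def)
      have "dist p y \<le> R * s"
      proof (rule LIMSEQ_le)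
        show "(\<lambda>n. dist (f (r n)) (x (r n))) \<longlonglongrightarrow> dist p y" "(\<lambda>n. R * t (r n)) \<longlonglongrightarrow> R * s"
          using lims by (auto intro: tendsto_intros)
      qed (use tx(3) in auto)
      moreover have "ball y (b * s) \<inter> E = {}"
      proof (rule ccontr)
        assume "ball y (b * s) \<inter> E \<noteq> {}"
        then obtain z where z: "z \<in> E" "0 < b * s - dist y z" by auto
        have "(\<lambda>n. b * t (r n) - dist (x (r n)) z) \<longlonglongrightarrow> b * s - dist y z"
          by (intro tendsto_intros lims)
        then have "\<forall>\<^sub>F n in sequentially. 0 < b * t (r n) - dist (x (r n)) z"
          using z(2) order_tendstoD(1) by blast
        then obtain n where "0 < b * t (r n) - dist (x (r n)) z"
          by (auto simp: eventually_sequentially)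
        then show False using tx(4)[of "r n"] z(1) by auto
      qed
      ultimately have "p \<in> Q k l" using q(1) unfolding Q_def by auto
      then show ?thesis using q(2) lims(1) by (auto simp: o_def)
    qed
    then show ?thesis
      unfolding compact_eq_seq_compact_metric seq_compact_def by blast
  qed
  have Q: "Q k l \<in> sets \<mu>" for k l
    using Qc E by (intro closed_meas compact_imp_closed) (auto simp: Q_def)
  have Qle: "emeasure \<mu> (Q k l) \<le> ennreal M * emeasure \<mu> (U k - E)" for k l
  proof -
    have "\<exists>t x. 0 < t \<and> t \<le> 1 / real (Suc k) \<and> x \<in> N \<and> dist p x \<le> R * t \<and> ball x (b * t) \<inter> E = {}"
      if p: "p \<in> Q k l" for p
    proof -
      obtain t x where t: "t \<in> {1 / real (Suc l)..1 / real (Suc k)}" "x \<in> N" "dist p x \<le> R * t" "ball x (b * t) \<inter> E = {}"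
        using p unfolding Q_def by blast
      have "0 < 1 / real (Suc l)" by simp
      then have "0 < t" using t(1) by (meson atLeastAtMost_iff less_le_trans)
      then show ?thesis using t by auto
    qed
    then obtain t x where tx: "\<And>p. p \<in> Q k l \<Longrightarrow> 0 < t p \<and> t p \<le> 1 / real (Suc k) \<and> x p \<in> N \<and>
        dist p (x p) \<le> R * t p \<and> ball (x p) (b * t p) \<inter> E = {}"
      by metis
    define r where "r p = (R + b) * t p" for p
    have r: "0 < r p" if "p \<in> Q k l" for p using tx[OF that] R b by (simp add: r_def)
    have cov: "Q k l \<subseteq> (\<Union>p\<in>Q k l. ball p (r p))" using r by auto
    obtain I where I: "I \<subseteq> Q k l" "finite I" "Q k l \<subseteq> (\<Union>p\<in>I. ball p (r p))"
      by (rule compactE_image[OF Qc open_ball cov])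
    obtain J where J: "J \<subseteq> I" "disjoint_family_on (\<lambda>p. ball p (r p)) J"
      "(\<Union>p\<in>I. ball p (r p)) \<subseteq> (\<Union>p\<in>J. ball p (3 * r p))"
      using finite_Vitali_covering[of I r "\<lambda>p. p"] I r by blast
    have JQ: "p \<in> Q k l" if "p \<in> J" for p using that J I by auto
    have fJ: "finite J" using J I finite_subset by blast
    have "emeasure \<mu> (Q k l) \<le> emeasure \<mu> (\<Union>p\<in>J. ball p (3 * r p) \<inter> N)"
    proof (intro emeasure_mono sets.finite_UN)
      have "Q k l \<subseteq> N" using E by (auto simp: Q_def)
      then show "Q k l \<subseteq> (\<Union>p\<in>J. ball p (3 * r p) \<inter> N)" using subset_trans[OF I(3) J(3)] by blast
    qed (use fJ in \<open>auto intro!: meas\<close>)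
    also have "\<dots> \<le> (\<Sum>p\<in>J. emeasure \<mu> (ball p (3 * r p) \<inter> N))"
      by (rule emeasure_subadditive_finite[OF fJ]) (auto intro!: meas)
    also have "\<dots> \<le> (\<Sum>p\<in>J. ennreal M * emeasure \<mu> (ball (x p) (b * t p) \<inter> N))"
    proof (rule sum_mono)
      fix p assume "p \<in> J"
      then have p: "p \<in> Q k l" by (rule JQ)
      then show "emeasure \<mu> (ball p (3 * r p) \<inter> N) \<le> ennreal M * emeasure \<mu> (ball (x p) (b * t p) \<inter> N)"
        using M[of p "x p" "t p"] tx[OF p] E unfolding r_def mult.assoc[symmetric] by (auto simp: Q_def)
    qed
    also have "\<dots> = ennreal M * emeasure \<mu> (\<Union>p\<in>J. ball (x p) (b * t p) \<inter> N)"
    proof -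
      have sub: "ball (x p) (b * t p) \<subseteq> ball p (r p)" if "p \<in> Q k l" for p
      proof
        fix z assume "z \<in> ball (x p) (b * t p)"
        then show "z \<in> ball p (r p)"
          using tx[OF that] dist_triangle[of p z "x p"] by (auto simp: r_def algebra_simps)
      qed
      have "disjoint_family_on (\<lambda>p. ball (x p) (b * t p) \<inter> N) J"
        using J(2) sub JQ unfolding disjoint_family_on_def by blast
      then show ?thesis
        using fJ by (subst sum_emeasure[symmetric]) (auto simp: sum_distrib_left intro!: meas)
    qed
    also have "\<dots> \<le> ennreal M * emeasure \<mu> (U k - E)"
    proof (intro mult_left_mono emeasure_mono)
      show "(\<Union>p\<in>J. ball (x p) (b * t p) \<inter> N) \<subseteq> U k - E"
      proof
        fix z assume "z \<in> (\<Union>p\<in>J. ball (x p) (b * t p) \<inter> N)"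
        then obtain p where p: "p \<in> J" "dist (x p) z < b * t p" "z \<in> N" by auto
        have Q: "p \<in> Q k l" using p JQ by auto
        have "dist p z < (R + b) * t p"
          using tx[OF Q] p dist_triangle[of p z "x p"] by (simp add: algebra_simps)
        also have "\<dots> \<le> (R + b) / real (Suc k)"
          using tx[OF Q] R b mult_left_mono[of "t p" "1 / real (Suc k)" "R + b"] by simp
        finally show "z \<in> U k - E"
          using tx[OF Q] p Q by (auto simp: U_def Q_def)
      qed
    qed (use U Eset in auto)
    finally show ?thesis .
  qed
  \<comment> \<open>\<open>E\<close> is closed, so its neighbourhoods shrink to it; continuity from
    above applies because \<open>U k - E\<close> is bounded and hence of finite measure.\<close>
  have lim: "(\<lambda>k. emeasure \<mu> (U k - E)) \<longlonglongrightarrow> 0"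
  proof -
    have "(\<lambda>k. emeasure \<mu> (U k - E)) \<longlonglongrightarrow> emeasure \<mu> (\<Inter>k. U k - E)"
    proof (rule Lim_emeasure_decseq)
      show "range (\<lambda>k. U k - E) \<subseteq> sets \<mu>" using U Eset by auto
      have "U k \<subseteq> U j" if "j \<le> k" for j k
        unfolding U_def using that R b
        by (intro Int_mono UN_mono subset_ball divide_left_mono) auto
      then show "decseq (\<lambda>k. U k - E)" unfolding decseq_def by blast
      fix k
      obtain e where e: "e \<in> E" using False by auto
      obtain D where D: "\<And>y. y \<in> E \<Longrightarrow> dist e y \<le> D"
        using compact_imp_bounded[OF E(1)] bounded_any_center[of E e] by (auto simp: dist_commute)
      have "U k - E \<subseteq> ball e (D + (R + b) / real (Suc k)) \<inter> N"
      proof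
        fix z assume "z \<in> U k - E"
        then obtain y where "y \<in> E" "dist y z < (R + b) / real (Suc k)" "z \<in> N"
          by (auto simp: U_def)
        then show "z \<in> ball e (D + (R + b) / real (Suc k)) \<inter> N"
          using D[of y] dist_triangle[of e z y] by auto
      qed
      then have "emeasure \<mu> (U k - E) \<le> emeasure \<mu> (ball e (D + (R + b) / real (Suc k)) \<inter> N)"
        by (intro emeasure_mono meas) auto
      then show "emeasure \<mu> (U k - E) \<noteq> \<infinity>"
        using fin[of e] e E by (metis le_less_trans less_irrefl subsetD top_greatest infinity_ennreal_def)
    qed
    also have "(\<Inter>k. U k - E) = {}"
    proof (rule ccontr)
      assume "(\<Inter>k. U k - E) \<noteq> {}"
      then obtain z where z: "\<And>k. z \<in> U k" "z \<notin> E" by auto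
      obtain d where d: "d > 0" "ball z d \<inter> E = {}"
        using compact_imp_closed[OF E(1)] z(2) by (metis closed_def openE disjoint_eq_subset_Compl ComplI)
      have "0 < d / (R + b)" using d R b by simp
      then obtain k where "1 / real (Suc k) < d / (R + b)" using nat_approx_posE by metis
      then have "(R + b) / real (Suc k) < d"
        using R b by (simp add: field_simps)
      moreover obtain y where "y \<in> E" "dist y z < (R + b) / real (Suc k)"
        using z(1)[of k] by (auto simp: U_def)
      ultimately have "y \<in> ball z d \<inter> E" by (auto simp: dist_commute)
      then show False using d by simp
    qed
    finally show ?thesis by simp
  qed
  \<comment> \<open>For each \<open>k\<close> a porous point has a hole of some scale below
    \<open>1 / real (Suc k)\<close>, and this scale exceeds \<open>1 / real (Suc l)\<close> for some
    \<open>l\<close>.\<close>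
  define Z where "Z = (\<Inter>k. \<Union>l. Q k l)"
  have Zs: "Z \<in> sets \<mu>" unfolding Z_def using Q by (intro sets.countable_INT) auto
  have "emeasure \<mu> Z \<le> ennreal M * emeasure \<mu> (U k - E)" for k
  proof -
    have "incseq (Q k)"
    proof (rule incseq_SucI, unfold Q_def, safe)
      fix l p t x assume "t \<in> {1 / real (Suc l)..1 / real (Suc k)}" "x \<in> N" "dist p x \<le> R * t" "ball x (b * t) \<inter> E = {}"
      moreover from this have "t \<in> {1 / real (Suc (Suc l))..1 / real (Suc k)}"
        by (auto intro: order_trans[rotated] simp: frac_le)
      ultimately show "\<exists>t\<in>{1 / real (Suc (Suc l))..1 / real (Suc k)}. \<exists>x\<in>N. dist p x \<le> R * t \<and> ball x (b * t) \<inter> E = {}"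
        by blast
    qed
    then have "emeasure \<mu> (\<Union>l. Q k l) = (SUP l. emeasure \<mu> (Q k l))"
      using Q by (intro SUP_emeasure_incseq[symmetric]) auto
    also have "\<dots> \<le> ennreal M * emeasure \<mu> (U k - E)"
      by (intro SUP_least Qle)
    finally have "emeasure \<mu> (\<Union>l. Q k l) \<le> ennreal M * emeasure \<mu> (U k - E)" .
    moreover have "emeasure \<mu> Z \<le> emeasure \<mu> (\<Union>l. Q k l)"
      using Q by (intro emeasure_mono) (auto simp: Z_def)
    ultimately show ?thesis by simp
  qed
  moreover have "(\<lambda>k. ennreal M * emeasure \<mu> (U k - E)) \<longlonglongrightarrow> ennreal M * 0"
    using lim by (intro ennreal_tendsto_cmult) auto
  ultimately have "emeasure \<mu> Z \<le> ennreal M * 0"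
    by (intro LIMSEQ_le_const) auto
  then have "Z \<in> null_sets \<mu>" using Zs by auto
  moreover have "{p \<in> E. \<forall>d>0. \<exists>t>0. t < d \<and>
    (\<exists>x\<in>N. dist p x \<le> R * t \<and> ball x (b * t) \<inter> E = {})} \<subseteq> Z"
  proof (safe, unfold Z_def, safe)
    fix p k assume p: "p \<in> E" "\<forall>d>0. \<exists>t>0. t < d \<and> (\<exists>x\<in>N. dist p x \<le> R * t \<and> ball x (b * t) \<inter> E = {})"
    have "1 / real (Suc k) > 0" by simp
    with p(2) obtain t x where t: "0 < t" "t < 1 / real (Suc k)" "x \<in> N" "dist p x \<le> R * t" "ball x (b * t) \<inter> E = {}"
      by meson
    obtain l where "1 / real (Suc l) < t" using nat_approx_posE[OF t(1)] by metis
    then have "p \<in> Q k l" using t p(1) unfolding Q_def by auto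
    then show "p \<in> (\<Union>l. Q k l)" by blast
  qed
  ultimately show ?thesis by blast
qed

section \<open>Haar measures on proper scalable subgroups\<close>

lemma mem_uminus_image: "x \<in> uminus ` B \<longleftrightarrow> - x \<in> (B :: 'a::group_add set)"
  by (metis image_iff minus_minus)

text \<open>The types need not be second countable, so continuity on a product does not by itself
  give measurability for the product sigma-algebra. Separability of the two factors does: preimages
  of open sets are countable unions of rectangles with centres in the dense sets and rational
  radii.\<close>

lemma measurable_separable_pair:
  fixes f :: "'a::metric_space \<times> 'b::metric_space \<Rightarrow> 'c::topological_space"
  assumes DX: "countable DX" "X \<subseteq> closure DX" and DY: "countable DY" "Y \<subseteq> closure DY"
    and f: "continuous_on (X \<times> Y) f" "\<And>x y. x \<in> X \<Longrightarrow> y \<in> Y \<Longrightarrow> f (x, y) \<in> N"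
  shows "f \<in> measurable (restrict_space borel X \<Otimes>\<^sub>M restrict_space borel Y) (restrict_space borel N)"
proof (rule measurable_restrict_space2)
  let ?P = "restrict_space borel X \<Otimes>\<^sub>M restrict_space borel Y"
  have sp: "space ?P = X \<times> Y" by (auto simp: space_pair_measure space_restrict_space)
  show "f \<in> space ?P \<rightarrow> N" using f(2) unfolding sp by auto
  show "f \<in> borel_measurable ?P"
  proof (rule borel_measurableI)
    fix S :: "'c set" assume S: "open S"
    let ?R = "\<lambda>(a, b, r). (ball a r \<inter> X) \<times> (ball b r \<inter> Y)"
    let ?I = "{i \<in> DX \<times> DY \<times> \<rat>. ?R i \<subseteq> f -` S}"
    have "f -` S \<inter> space ?P = (\<Union>i\<in>?I. ?R i)"
    proof
      show "(\<Union>i\<in>?I. ?R i) \<subseteq> f -` S \<inter> space ?P" unfolding sp by auto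
      show "f -` S \<inter> space ?P \<subseteq> (\<Union>i\<in>?I. ?R i)"
      proof
        fix z assume "z \<in> f -` S \<inter> space ?P"
        then obtain x y where z: "z = (x, y)" "x \<in> X" "y \<in> Y" "f (x, y) \<in> S" unfolding sp by auto
        obtain T where T: "open T" "T \<inter> (X \<times> Y) = f -` S \<inter> (X \<times> Y)"
          using f(1) S unfolding continuous_on_open_invariant by blast
        then have "(x, y) \<in> T" using z by blast
        then obtain e where e: "e > 0" "ball (x, y) e \<subseteq> T" using T(1) by (meson openE)
        \<comment> \<open>Each coordinate of a point of the rectangle is within
          \<open>2 * r < e / 2\<close> of \<open>x\<close> or \<open>y\<close>.\<close>
        obtain r where r: "r \<in> \<rat>" "0 < r" "r < e / 4" 
          using Rats_dense_in_real[of 0 "e / 4"] e(1) by auto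
        obtain a where a: "a \<in> DX" "dist a x < r" using DX(2) z(2) r(2) by (meson closure_approachable subsetD)
        obtain b where b: "b \<in> DY" "dist b y < r" using DY(2) z(3) r(2) by (meson closure_approachable subsetD)
        have "?R (a, b, r) \<subseteq> f -` S"
        proof
          fix w assume "w \<in> ?R (a, b, r)"
          then obtain x' y' where w: "w = (x', y')" "dist a x' < r" "x' \<in> X" "dist b y' < r" "y' \<in> Y" by auto
          have "dist (x, y) (x', y') \<le> dist x x' + dist y y'"
            unfolding dist_Pair_Pair by (rule sqrt_sum_squares_le_sum) auto
          also have "\<dots> < e"
            using dist_triangle[of x x' a] dist_triangle[of y y' b] w a b r by (simp add: dist_commute)
          finally have "(x', y') \<in> T" using e by auto
          then show "w \<in> f -` S" using T w by blast
        qed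
        then show "z \<in> (\<Union>i\<in>?I. ?R i)" using a b r z by (intro UN_I[of "(a, b, r)"]) auto
      qed
    qed
    moreover have "(\<Union>i\<in>?I. ?R i) \<in> sets ?P"
    proof (rule sets.countable_UN')
      show "countable ?I"
        by (rule countable_subset[of _ "DX \<times> DY \<times> \<rat>"]) (auto simp: DX DY countable_rat)
      show "(\<lambda>i. ?R i) ` ?I \<subseteq> sets ?P"
      proof -
        have "ball c s \<inter> X \<in> sets (restrict_space borel X)" for c s
          unfolding sets_restrict_space by (rule image_eqI[of _ _ "ball c s"]) auto
        moreover have "ball c s \<inter> Y \<in> sets (restrict_space borel Y)" for c s
          unfolding sets_restrict_space by (rule image_eqI[of _ _ "ball c s"]) auto
        ultimately show ?thesis by (auto intro!: pair_measureI)
      qed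
    qed
    ultimately show "f -` S \<inter> space ?P \<in> sets ?P" by simp
  qed
qed

locale scalable_group =
  fixes \<delta> :: "real \<Rightarrow> 'g::{metric_space,group_add} \<Rightarrow> 'g"
  assumes msg: "metric_scalable_group \<delta>"
begin

lemma dil_dil [simp]: "\<delta> t (\<delta> s x) = \<delta> (t * s) x"
  and dil_0 [simp]: "\<delta> 0 x = 0"
  and dist_add_left [simp]: "dist (p + x) (p + y) = dist x y"
  and dist_dil: "dist (\<delta> t p) (\<delta> t q) = \<bar>t\<bar> * dist p q"
  using msg unfolding metric_scalable_group_def by (auto simp: o_def fun_eq_iff)

lemma dil_zero [simp]: "\<delta> t 0 = 0"
  using dil_dil[of t 0] by simp

lemma dil_add: "\<delta> t (x + y) = \<delta> t x + \<delta> t y"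
  using msg unfolding metric_scalable_group_def by (cases "t = 0") auto

text \<open>\<open>\<delta> 1\<close> is idempotent and injective, hence the identity.\<close>

lemma dil_1 [simp]: "\<delta> 1 x = x"
proof -
  have "\<exists>h. homeomorphism UNIV UNIV (\<delta> 1) h"
    using msg unfolding metric_scalable_group_def by simp
  then obtain h where "homeomorphism UNIV UNIV (\<delta> 1) h" ..
  then have "h (\<delta> 1 y) = y" for y by (simp add: homeomorphism_def)
  then show ?thesis by (metis dil_dil mult_1)
qed

lemma continuous_on_add [continuous_intros]:
  "continuous_on S f \<Longrightarrow> continuous_on S g \<Longrightarrow> continuous_on S (\<lambda>x. f x + (g x :: 'g))"
  using continuous_on_compose2[of UNIV "\<lambda>(x::'g, y). x + y" S "\<lambda>x. (f x, g x)"] msg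
  unfolding metric_scalable_group_def by (auto intro: continuous_on_Pair)

lemma continuous_on_minus [continuous_intros]:
  "continuous_on S f \<Longrightarrow> continuous_on S (\<lambda>x. - (f x :: 'g))"
  using continuous_on_compose2[of UNIV "uminus :: 'g \<Rightarrow> 'g" S f] msg
  unfolding metric_scalable_group_def by auto

lemma continuous_on_dil [continuous_intros]:
  "continuous_on S f \<Longrightarrow> continuous_on S g \<Longrightarrow> continuous_on S (\<lambda>x. \<delta> (f x) (g x))"
  using continuous_on_compose2[of UNIV "\<lambda>(t, x). \<delta> t x" S "\<lambda>x. (f x, g x)"] msg
  unfolding metric_scalable_group_def by (auto intro: continuous_on_Pair)

lemma dist_eq_dist_0: "dist x y = dist 0 (- x + y :: 'g)"
  using dist_add_left[of x 0 "- x + y"] by (simp add: add.assoc[symmetric])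

lemma dist_dil_0: "dist 0 (\<delta> t x) = \<bar>t\<bar> * dist 0 x"
  using dist_dil[of t 0 x] by simp

end

text \<open>Compactness of balls stands in for the Lie group structure in the measure theory:
  closedness, separability and, with the dilations, doubling follow from it. Balls around 0 suffice
  since left translations are isometries.\<close>

locale proper_subgroup = scalable_group +
  fixes N :: "'g::{metric_space,group_add} set"
  assumes scalable: "scalable_subgroup \<delta> N"
    and compact_cball_0: "compact (cball 0 r \<inter> N)"
begin

lemma zero_mem [simp]: "0 \<in> N"
  and add_mem [simp]: "x \<in> N \<Longrightarrow> y \<in> N \<Longrightarrow> x + y \<in> N"
  and minus_mem [simp]: "x \<in> N \<Longrightarrow> - x \<in> N"
  using scalable unfolding scalable_subgroup_def by auto

lemma dil_mem [simp]: "x \<in> N \<Longrightarrow> \<delta> t x \<in> N"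
  using scalable unfolding scalable_subgroup_def by (cases "t = 0") auto

lemma add_mem_iff [simp]: "x \<in> N \<Longrightarrow> x + y \<in> N \<longleftrightarrow> y \<in> N"
  using add_mem[of "- x" "x + y"] by (auto simp: add.assoc[symmetric])

lemma ball_translate: "x \<in> N \<Longrightarrow> ball (x + z) r \<inter> N = (+) x ` (ball z r \<inter> N)"
proof safe
  fix y assume "x \<in> N" "y \<in> ball (x + z) r" "y \<in> N"
  moreover have "dist (x + z) y = dist z (- x + y)"
    using dist_add_left[of "-x" "x + z" y] by (simp add: add.assoc[symmetric])
  ultimately show "y \<in> (+) x ` (ball z r \<inter> N)"
    by (intro image_eqI[of _ _ "- x + y"]) (auto simp: add.assoc[symmetric])
qed auto

lemma compact_cball: "x \<in> N \<Longrightarrow> compact (cball x r \<inter> N)"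
proof -
  assume x: "x \<in> N"
  have "cball x r \<inter> N = (+) x ` (cball 0 r \<inter> N)"
  proof safe
    fix y assume "y \<in> cball x r" "y \<in> N"
    then show "y \<in> (+) x ` (cball 0 r \<inter> N)" using x
      by (intro image_eqI[of _ _ "- x + y"]) (auto simp: add.assoc[symmetric] dist_eq_dist_0[of x])
  next
    fix y :: 'g assume "y \<in> cball 0 r" then show "x + y \<in> cball x r"
      using dist_add_left[of x 0 y] by auto
  qed (use x in auto)
  then show ?thesis
    by (auto intro!: compact_continuous_image compact_cball_0 continuous_intros)
qed

lemma closed_N: "closed N"
proof (subst closed_sequential_limits, safe)
  fix X l assume X: "\<forall>n. X n \<in> N" "X \<longlonglongrightarrow> l"
  have "bounded (range X)" using X(2) by (rule convergent_imp_bounded)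
  then obtain r where "\<And>n. dist 0 (X n) \<le> r" by (auto simp: bounded_any_center[of _ 0])
  then have "\<And>n. X n \<in> cball 0 r \<inter> N" using X by auto
  then have "l \<in> cball 0 r \<inter> N"
    using compact_imp_closed[OF compact_cball_0] X(2) closed_sequentially by blast
  then show "l \<in> N" by simp
qed

lemma ball_cover:
  assumes "0 < A" "0 < b"
  obtains I where "finite I" "I \<subseteq> N" "cball 0 A \<inter> N \<subseteq> (\<Union>y\<in>I. ball y b)"
proof -
  have cov: "cball 0 A \<inter> N \<subseteq> (\<Union>y\<in>N. ball y b)" using assms by auto
  show ?thesis
    by (rule compactE_image[OF compact_cball_0 open_ball cov]) (use that in auto)
qed

lemma separable:
  obtains D where "countable D" "D \<subseteq> N" "N \<subseteq> closure D"
proof -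
  have "\<exists>I. finite I \<and> I \<subseteq> N \<and> cball 0 (real n + 1) \<inter> N \<subseteq> (\<Union>y\<in>I. ball y (1 / real (Suc n)))" for n
    by (rule ball_cover[of "real n + 1" "1 / real (Suc n)"]) auto
  then obtain I where I: "\<And>n. finite (I n)" "\<And>n. I n \<subseteq> N"
      "\<And>n. cball 0 (real n + 1) \<inter> N \<subseteq> (\<Union>y\<in>I n. ball y (1 / real (Suc n)))" by metis
  have "x \<in> closure (\<Union>n. I n)" if "x \<in> N" for x
    unfolding closure_approachable
  proof safe
    fix e :: real assume "0 < e"
    then obtain k where k: "1 / real (Suc k) < e" using nat_approx_posE by metis
    obtain j where j: "dist 0 x \<le> real j" using real_arch_simple by blast
    define n where "n = max j k"
    have "1 / real (Suc n) \<le> 1 / real (Suc k)" by (simp add: n_def frac_le)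
    moreover have "x \<in> cball 0 (real n + 1) \<inter> N" using that j by (simp add: n_def)
    then obtain y where "y \<in> I n" "dist y x < 1 / real (Suc n)" using I(3)[of n] by (auto simp del: of_nat_Suc)
    ultimately show "\<exists>y\<in>\<Union>n. I n. dist y x < e" using k by (intro bexI[of _ y]) auto
  qed
  then show ?thesis
    using I by (intro that[of "\<Union>n. I n"]) (auto intro: countable_finite)
qed

end

locale haar_subgroup = proper_subgroup +
  fixes \<mu> :: "'g::{metric_space,group_add} measure"
  assumes haar: "haar_measure_on N \<mu>"
begin

lemma space_haar [simp]: "space \<mu> = N"
  and sets_haar [measurable_cong]: "sets \<mu> = sets (restrict_space borel N)"
  and emeasure_translate: "x \<in> N \<Longrightarrow> A \<in> sets \<mu> \<Longrightarrow> emeasure \<mu> ((+) x ` A) = emeasure \<mu> A"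
  and emeasure_N: "emeasure \<mu> N \<noteq> 0"
  using haar unfolding haar_measure_on_def by auto

lemma borel_Int_haar: "A \<in> sets borel \<Longrightarrow> A \<inter> N \<in> sets \<mu>"
  unfolding sets_haar by (auto simp: sets_restrict_space)

text \<open>Local finiteness gives one small ball around 0 of finite measure; a bounded part of
  \<open>N\<close> is covered by finitely many left translates of it.\<close>

lemma emeasure_ball_finite: "emeasure \<mu> (ball x r \<inter> N) < \<infinity>"
proof -
  have "\<exists>r>0. emeasure \<mu> (ball x r \<inter> N) < \<infinity>" if "x \<in> N" for x
  proof -
    obtain U where U: "openin (top_of_set N) U" "x \<in> U" "emeasure \<mu> U < \<infinity>"
      using haar \<open>x \<in> N\<close> unfolding haar_measure_on_def by blast
    then obtain T where T: "open T" "U = N \<inter> T" by (auto simp: openin_open)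
    then obtain r where r: "r > 0" "ball x r \<subseteq> T" using U by (metis Int_iff openE)
    have "emeasure \<mu> (ball x r \<inter> N) \<le> emeasure \<mu> U"
      using r T borel_Int_haar[of T] by (intro emeasure_mono) (auto simp: Int_commute)
    then show ?thesis using U r by (meson le_less_trans)
  qed
  then obtain r0 where r0: "0 < r0" "emeasure \<mu> (ball 0 r0 \<inter> N) < \<infinity>" using zero_mem by blast
  define A where "A = max 1 (dist 0 x + r)"
  obtain I where I: "finite I" "I \<subseteq> N" "cball 0 A \<inter> N \<subseteq> (\<Union>y\<in>I. ball y r0)"
    using ball_cover[of A r0] r0(1) unfolding A_def by (metis less_max_iff_disj zero_less_one)
  have sub: "ball x r \<inter> N \<subseteq> (\<Union>y\<in>I. ball y r0 \<inter> N)"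
  proof
    fix z assume z: "z \<in> ball x r \<inter> N"
    then have "dist 0 z \<le> A" using dist_triangle[of 0 z x] by (auto simp: A_def)
    then have "z \<in> (\<Union>y\<in>I. ball y r0)" using I(3) z by (meson IntD2 IntI mem_cball subsetD)
    then show "z \<in> (\<Union>y\<in>I. ball y r0 \<inter> N)" using z by auto
  qed
  have "emeasure \<mu> (ball x r \<inter> N) \<le> emeasure \<mu> (\<Union>y\<in>I. ball y r0 \<inter> N)"
    by (rule emeasure_mono[OF sub]) (use I in \<open>auto intro!: sets.finite_UN borel_Int_haar\<close>)
  also have "\<dots> \<le> (\<Sum>y\<in>I. emeasure \<mu> (ball y r0 \<inter> N))"
    by (rule emeasure_subadditive_finite[OF I(1)]) (auto intro!: borel_Int_haar)
  also have "\<dots> = (\<Sum>y\<in>I. emeasure \<mu> (ball 0 r0 \<inter> N))"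
  proof (rule sum.cong)
    fix y assume "y \<in> I"
    then have "y \<in> N" using I by auto
    then show "emeasure \<mu> (ball y r0 \<inter> N) = emeasure \<mu> (ball 0 r0 \<inter> N)"
      using ball_translate[of y 0 r0] by (simp add: emeasure_translate borel_Int_haar)
  qed simp
  also have "\<dots> < \<infinity>" using r0 by (simp add: ennreal_mult_less_top of_nat_less_top)
  finally show ?thesis .
qed

text \<open>A ball of radius \<open>A\<close> is covered by finitely many balls of radius
  \<open>b\<close>; dilation transports this cover to every scale \<open>t\<close> with the same
  number of balls, which serves as \<open>M\<close>.\<close>

lemma doubling:
  assumes "0 < A" "0 < b"
  shows "\<exists>M::real. \<forall>x\<in>N. \<forall>y\<in>N. \<forall>t>0.
    emeasure \<mu> (ball x (A * t) \<inter> N) \<le> ennreal M * emeasure \<mu> (ball y (b * t) \<inter> N)"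
proof -
  obtain I where I: "finite I" "I \<subseteq> N" "cball 0 A \<inter> N \<subseteq> (\<Union>y\<in>I. ball y b)"
    using ball_cover[OF assms] by blast
  have "emeasure \<mu> (ball x (A * t) \<inter> N) \<le> ennreal (card I) * emeasure \<mu> (ball y (b * t) \<inter> N)"
    if xy: "x \<in> N" "y \<in> N" "0 < t" for x y t
  proof -
    have ball: "emeasure \<mu> (ball z r \<inter> N) = emeasure \<mu> (ball 0 r \<inter> N)" if "z \<in> N" for z r
      using ball_translate[OF that, of 0 r] that by (simp add: emeasure_translate borel_Int_haar)
    have sub: "ball 0 (A * t) \<inter> N \<subseteq> (\<Union>y\<in>I. ball (\<delta> t y) (b * t) \<inter> N)"
    proof
      fix z assume z: "z \<in> ball 0 (A * t) \<inter> N"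
      define w where "w = \<delta> (1 / t) z"
      have zw: "z = \<delta> t w" using xy by (simp add: w_def)
      have "w \<in> cball 0 A \<inter> N"
      proof
        show "w \<in> N" using z by (simp add: w_def)
        have "t * dist 0 w < A * t" using z xy dist_dil_0[of t w] by (simp add: zw[symmetric])
        then show "w \<in> cball 0 A" using xy by (simp add: mult.commute)
      qed
      then have "w \<in> (\<Union>y\<in>I. ball y b)" using I(3) by (rule subsetD[rotated])
      then obtain y where "y \<in> I" "dist y w < b" by auto
      then have "dist (\<delta> t y) z < b * t" using xy by (simp add: zw dist_dil)
      then show "z \<in> (\<Union>y\<in>I. ball (\<delta> t y) (b * t) \<inter> N)" using \<open>y \<in> I\<close> z by auto
    qed
    have "emeasure \<mu> (ball x (A * t) \<inter> N) = emeasure \<mu> (ball 0 (A * t) \<inter> N)"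
      by (rule ball[OF xy(1)])
    also have "\<dots> \<le> emeasure \<mu> (\<Union>y\<in>I. ball (\<delta> t y) (b * t) \<inter> N)"
      by (rule emeasure_mono[OF sub]) (use I in \<open>auto intro!: sets.finite_UN borel_Int_haar\<close>)
    also have "\<dots> \<le> (\<Sum>y\<in>I. emeasure \<mu> (ball (\<delta> t y) (b * t) \<inter> N))"
      by (rule emeasure_subadditive_finite[OF I(1)]) (auto intro!: borel_Int_haar)
    also have "\<dots> = (\<Sum>z\<in>I. emeasure \<mu> (ball y (b * t) \<inter> N))"
    proof (rule sum.cong)
      fix z assume "z \<in> I"
      then have "\<delta> t z \<in> N" using I by auto
      then show "emeasure \<mu> (ball (\<delta> t z) (b * t) \<inter> N) = emeasure \<mu> (ball y (b * t) \<inter> N)"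
        using ball xy by metis
    qed simp
    finally show ?thesis by (simp add: ennreal_of_nat_eq_real_of_nat)
  qed
  then show ?thesis by blast
qed

sublocale sigma_finite_measure \<mu>
proof
  show "\<exists>A. countable A \<and> A \<subseteq> sets \<mu> \<and> \<Union> A = space \<mu> \<and> (\<forall>a\<in>A. emeasure \<mu> a \<noteq> \<infinity>)"
  proof (intro exI[of _ "range (\<lambda>n::nat. ball 0 n \<inter> N)"] conjI ballI)
    have "\<exists>n::nat. dist 0 x < n" for x :: 'g using reals_Archimedean2 by blast
    then show "\<Union> (range (\<lambda>n::nat. ball 0 n \<inter> N)) = space \<mu>" by auto
    show "emeasure \<mu> a \<noteq> \<infinity>" if "a \<in> range (\<lambda>n::nat. ball 0 n \<inter> N)" for a
      using that emeasure_ball_finite by (auto simp: less_top)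
  qed (auto intro: borel_Int_haar)
qed

lemma measurable_haarI:
  assumes "continuous_on N f" "\<And>x. x \<in> N \<Longrightarrow> f x \<in> N"
  shows "f \<in> measurable \<mu> \<mu>"
proof -
  have "f \<in> measurable (restrict_space borel N) (restrict_space borel N)"
    by (rule measurable_restrict_space2[OF _ borel_measurable_continuous_on_restrict[OF assms(1)]])
      (use assms(2) in \<open>auto simp: space_restrict_space\<close>)
  then show ?thesis by (simp only: measurable_cong_sets[OF sets_haar sets_haar])
qed

lemma uminus_image_sets: "B \<in> sets \<mu> \<Longrightarrow> uminus ` B \<in> sets \<mu>"
proof -
  assume B: "B \<in> sets \<mu>"
  have "uminus \<in> measurable \<mu> \<mu>"
    by (rule measurable_haarI) (auto intro: continuous_on_minus continuous_on_id)
  from measurable_sets[OF this B] have "uminus -` B \<inter> N \<in> sets \<mu>" by simp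
  moreover have "uminus -` B \<inter> N = uminus ` B"
  proof (intro equalityI subsetI)
    fix x assume "x \<in> uminus -` B \<inter> N"
    then show "x \<in> uminus ` B" by (simp add: mem_uminus_image)
  next
    fix x assume "x \<in> uminus ` B"
    then show "x \<in> uminus -` B \<inter> N" using sets.sets_into_space[OF B] by auto
  qed
  ultimately show ?thesis by simp
qed

lemma translate_sets:
  assumes x: "x \<in> N" and A: "A \<in> sets \<mu>"
  shows "(+) x ` A \<in> sets \<mu>"
proof -
  have "(+) (- x) \<in> measurable \<mu> \<mu>"
    by (rule measurable_haarI) (use x in \<open>auto intro: continuous_on_add continuous_on_const continuous_on_id\<close>)
  from measurable_sets[OF this A] have "(+) (- x) -` A \<inter> N \<in> sets \<mu>" by simp
  moreover have "(+) (- x) -` A \<inter> N = (+) x ` A"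
  proof (intro equalityI subsetI)
    fix y :: 'g assume "y \<in> (+) (- x) -` A \<inter> N"
    then show "y \<in> (+) x ` A" by (intro image_eqI[of _ _ "- x + y"]) (auto simp: add.assoc[symmetric])
  next
    fix y :: 'g assume "y \<in> (+) x ` A"
    then show "y \<in> (+) (- x) -` A \<inter> N"
      using sets.sets_into_space[OF A] x by (auto simp: add.assoc[symmetric])
  qed
  ultimately show ?thesis by simp
qed

lemma emeasure_translate_vimage:
  assumes x: "x \<in> N" and A: "A \<in> sets \<mu>"
  shows "(\<integral>\<^sup>+y. indicator A (x + y) \<partial>\<mu>) = emeasure \<mu> A"
proof -
  have "(\<integral>\<^sup>+y. indicator A (x + y) \<partial>\<mu>) = (\<integral>\<^sup>+y. indicator ((+) (- x) ` A) y \<partial>\<mu>)"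
  proof (rule nn_integral_cong)
    fix y
    have "x + y \<in> A \<longleftrightarrow> y \<in> (+) (- x) ` A"
      by (auto simp: add.assoc[symmetric] intro!: image_eqI[of _ _ "x + y"])
    then show "indicator A (x + y) = (indicator ((+) (- x) ` A) y :: ennreal)" by (auto simp: indicator_def)
  qed
  also have "\<dots> = emeasure \<mu> A"
    using x A by (simp add: emeasure_translate translate_sets)
  finally show ?thesis .
qed

lemma null_uminus:
  assumes B: "B \<in> sets \<mu>" and null: "emeasure \<mu> B = 0"
  shows "emeasure \<mu> (uminus ` B) = 0"
proof -
  interpret P: pair_sigma_finite \<mu> \<mu> ..
  obtain D where D: "countable D" "D \<subseteq> N" "N \<subseteq> closure D" by (rule separable)
  let ?B = "uminus ` B"
  have Bs: "?B \<in> sets \<mu>" using B by (rule uminus_image_sets)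
  have m: "(\<lambda>z. - snd z + fst z) \<in> measurable (\<mu> \<Otimes>\<^sub>M \<mu>) \<mu>"
  proof -
    have "(\<lambda>z. - snd z + fst z) \<in> measurable (restrict_space borel N \<Otimes>\<^sub>M restrict_space borel N) (restrict_space borel N)"
    proof (rule measurable_separable_pair[OF D(1,3) D(1,3)])
      show "continuous_on (N \<times> N) (\<lambda>z. - snd z + fst z)"
        by (intro continuous_on_add continuous_on_minus continuous_on_fst continuous_on_snd continuous_on_id)
    qed simp
    then show ?thesis
      by (simp only: measurable_cong_sets[OF sets_pair_measure_cong[OF sets_haar sets_haar] sets_haar])
  qed
  have "(\<lambda>z. indicator ?B (- snd z + fst z) :: ennreal) \<in> borel_measurable (\<mu> \<Otimes>\<^sub>M \<mu>)"
    using measurable_compose[OF m borel_measurable_indicator[OF Bs]] by simp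
  then have "(\<integral>\<^sup>+y. \<integral>\<^sup>+x. indicator ?B (- y + x) \<partial>\<mu> \<partial>\<mu>) = (\<integral>\<^sup>+x. \<integral>\<^sup>+y. indicator ?B (- y + x) \<partial>\<mu> \<partial>\<mu>)"
    using P.Fubini'[of "\<lambda>x y. indicator ?B (- y + x)"] by (simp add: case_prod_beta')
  also have "(\<integral>\<^sup>+x. \<integral>\<^sup>+y. indicator ?B (- y + x) \<partial>\<mu> \<partial>\<mu>) = (\<integral>\<^sup>+x. 0 \<partial>\<mu>)"
  proof (rule nn_integral_cong)
    fix x assume x: "x \<in> space \<mu>"
    have "- y + x \<in> ?B \<longleftrightarrow> - x + y \<in> B" for y
      by (simp add: mem_uminus_image minus_add)
    then have "(\<integral>\<^sup>+y. indicator ?B (- y + x) \<partial>\<mu>) = (\<integral>\<^sup>+y. indicator B (- x + y) \<partial>\<mu>)"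
      by (simp add: indicator_def)
    also have "\<dots> = 0"
      using x B null by (subst emeasure_translate_vimage) auto
    finally show "(\<integral>\<^sup>+y. indicator ?B (- y + x) \<partial>\<mu>) = 0" .
  qed
  also have "(\<integral>\<^sup>+y. \<integral>\<^sup>+x. indicator ?B (- y + x) \<partial>\<mu> \<partial>\<mu>) = (\<integral>\<^sup>+y. emeasure \<mu> ?B \<partial>\<mu>)"
    by (intro nn_integral_cong emeasure_translate_vimage Bs) auto
  finally have "emeasure \<mu> ?B * emeasure \<mu> N = 0" by simp
  then show ?thesis using emeasure_N by simp
qed

text \<open>\<open>\<mu>\<close> is not known to be invariant under right translations; passing to \<open>- B\<close> turns the
  right translations by the curve into left ones.\<close>

lemma null_along_curve:
  fixes h :: "real \<Rightarrow> 'g"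
  assumes h: "continuous_on UNIV h" "\<And>t. h t \<in> N" and B: "B \<in> sets \<mu>"
    and null: "\<And>p. p \<in> N \<Longrightarrow> AE t in lborel. p + h t \<notin> B"
  shows "emeasure \<mu> B = 0"
proof -
  interpret P: pair_sigma_finite lborel \<mu> ..
  obtain D where D: "countable D" "D \<subseteq> N" "N \<subseteq> closure D" by (rule separable)
  let ?B = "uminus ` B"
  have Bs: "?B \<in> sets \<mu>" using B by (rule uminus_image_sets)
  have m: "(\<lambda>z. - h (fst z) + snd z) \<in> measurable (lborel \<Otimes>\<^sub>M \<mu>) \<mu>"
  proof -
    have "(\<lambda>z. - h (fst z) + snd z) \<in> measurable (restrict_space borel UNIV \<Otimes>\<^sub>M restrict_space borel N) (restrict_space borel N)"
    proof (rule measurable_separable_pair[OF _ _ D(1,3)])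
      show "countable (\<rat> :: real set)" by (rule countable_rat)
      show "UNIV \<subseteq> closure (\<rat> :: real set)" by (simp add: Rats_closure_real)
      show "continuous_on (UNIV \<times> N) (\<lambda>z. - h (fst z) + snd z)"
        by (intro continuous_on_add continuous_on_minus continuous_on_compose2[OF h(1)]
            continuous_on_fst continuous_on_snd continuous_on_id) simp
    qed (use h in simp)
    moreover have "sets lborel = sets (restrict_space borel (UNIV :: real set))" by simp
    ultimately show ?thesis
      by (simp only: measurable_cong_sets[OF sets_pair_measure_cong[OF _ sets_haar] sets_haar])
  qed
  \<comment> \<open>The weight on \<open>{0..1}\<close> gives the curve parameter total mass 1, so
    the other order of integration returns exactly the measure of \<open>?B\<close>.\<close>
  have ind: "(\<lambda>z. indicator {0..1} (fst z) * indicator ?B (- h (fst z) + snd z) :: ennreal) \<in> borel_measurable (lborel \<Otimes>\<^sub>M \<mu>)"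
    using measurable_compose[OF m borel_measurable_indicator[OF Bs]] by (auto intro!: borel_measurable_times_ennreal)
  have "(\<integral>\<^sup>+q. \<integral>\<^sup>+t. indicator {0..1} t * indicator ?B (- h t + q) \<partial>lborel \<partial>\<mu>) = (\<integral>\<^sup>+q. 0 \<partial>\<mu>)"
  proof (rule nn_integral_cong)
    fix q assume q: "q \<in> space \<mu>"
    \<comment> \<open>Inversion turns the right factor \<open>h t\<close> into a left one; the
      hypothesis is used for the curve based at \<open>- q\<close>.\<close>
    have eq: "- h t + q \<in> ?B \<longleftrightarrow> - q + h t \<in> B" for t
      by (simp add: mem_uminus_image minus_add)
    have "AE t in lborel. - q + h t \<notin> B" using q by (intro null) auto
    then have "AE t in lborel. indicator {0..1} t * indicator ?B (- h t + q) = (0 :: ennreal)"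
      by eventually_elim (simp add: eq)
    then have "(\<integral>\<^sup>+t. indicator {0..1} t * indicator ?B (- h t + q) \<partial>lborel) = integral\<^sup>N lborel (\<lambda>t::real. 0)"
      by (rule nn_integral_cong_AE)
    then show "(\<integral>\<^sup>+t. indicator {0..1} t * indicator ?B (- h t + q) \<partial>lborel) = 0" by simp
  qed
  then have "0 = (\<integral>\<^sup>+q. \<integral>\<^sup>+t. indicator {0..1} t * indicator ?B (- h t + q) \<partial>lborel \<partial>\<mu>)"
    by simp
  also have "\<dots> = (\<integral>\<^sup>+t. \<integral>\<^sup>+q. indicator {0..1} t * indicator ?B (- h t + q) \<partial>\<mu> \<partial>lborel)"
    using P.Fubini'[of "\<lambda>t q. indicator {0..1} t * indicator ?B (- h t + q)"] ind by (simp add: case_prod_beta')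
  also have "\<dots> = (\<integral>\<^sup>+t. indicator {0..1::real} t * emeasure \<mu> ?B \<partial>lborel)"
  proof (rule nn_integral_cong)
    fix t :: real
    show "(\<integral>\<^sup>+q. indicator {0..1} t * indicator ?B (- h t + q) \<partial>\<mu>) = indicator {0..1} t * emeasure \<mu> ?B"
      using emeasure_translate_vimage[OF minus_mem[OF h(2)] Bs, of t] by (cases "t \<in> {0..1}") auto
  qed
  also have "\<dots> = emeasure \<mu> ?B"
    by (subst nn_integral_multc) auto
  finally have "emeasure \<mu> ?B = 0" by simp
  from null_uminus[OF Bs this] show ?thesis by (simp add: image_image)
qed

end

section \<open>Derivatives in horizontal directions\<close>

text \<open>Cauchy criterion at 0 with rational arguments, which makes the existence of a limit a
  countable condition; continuity away from 0 carries the bound to all nonzero reals.\<close>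

lemma ex_limit_at_0_iff:
  fixes \<phi> :: "real \<Rightarrow> real"
  assumes cont: "continuous_on (- {0}) \<phi>"
  shows "(\<exists>l. (\<phi> \<longlongrightarrow> l) (at 0)) \<longleftrightarrow> (\<forall>n. \<exists>m. \<forall>t\<in>\<rat>. \<forall>s\<in>\<rat>. t \<noteq> 0 \<and> \<bar>t\<bar> < 1 / real (Suc m) \<and> s \<noteq> 0 \<and> \<bar>s\<bar> < 1 / real (Suc m)
    \<longrightarrow> \<bar>\<phi> t - \<phi> s\<bar> \<le> 1 / real (Suc n))" (is "?L \<longleftrightarrow> ?R")
proof
  assume ?L
  then obtain l where l: "(\<phi> \<longlongrightarrow> l) (at 0)" by blast
  show ?R
  proof
    fix n
    define e where "e = 1 / real (Suc n) / 2"
    have "0 < e" by (simp add: e_def)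
    from LIM_D[OF l this] obtain d where d: "d > 0" "\<And>t. t \<noteq> 0 \<Longrightarrow> \<bar>t\<bar> < d \<Longrightarrow> \<bar>\<phi> t - l\<bar> < e"
      by auto
    obtain m where m: "1 / real (Suc m) < d" using nat_approx_posE[OF d(1)] by metis
    have "\<bar>\<phi> t - \<phi> s\<bar> \<le> 1 / real (Suc n)" if "t \<noteq> 0" "\<bar>t\<bar> < 1 / real (Suc m)" "s \<noteq> 0" "\<bar>s\<bar> < 1 / real (Suc m)" for t s
    proof -
      have "\<bar>\<phi> t - l\<bar> < e" "\<bar>\<phi> s - l\<bar> < e"
        using that m by (auto intro!: d(2) simp del: of_nat_Suc)
      moreover have "1 / real (Suc n) = e + e" by (simp only: e_def field_sum_of_halves)
      ultimately show ?thesis by linarith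
    qed
    then show "\<exists>m. \<forall>t\<in>\<rat>. \<forall>s\<in>\<rat>. t \<noteq> 0 \<and> \<bar>t\<bar> < 1 / real (Suc m) \<and> s \<noteq> 0 \<and> \<bar>s\<bar> < 1 / real (Suc m)
      \<longrightarrow> \<bar>\<phi> t - \<phi> s\<bar> \<le> 1 / real (Suc n)" by blast
  qed
next
  assume R: ?R
  have R': "\<exists>m. \<forall>t s. t \<noteq> 0 \<and> \<bar>t\<bar> < 1 / real (Suc m) \<and> s \<noteq> 0 \<and> \<bar>s\<bar> < 1 / real (Suc m)
    \<longrightarrow> \<bar>\<phi> t - \<phi> s\<bar> \<le> 1 / real (Suc n)" for n
  proof -
    obtain m where m: "\<And>t s. t \<in> \<rat> \<Longrightarrow> s \<in> \<rat> \<Longrightarrow> t \<noteq> 0 \<Longrightarrow> \<bar>t\<bar> < 1 / real (Suc m) \<Longrightarrow> s \<noteq> 0 \<Longrightarrow> \<bar>s\<bar> < 1 / real (Suc m)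
      \<Longrightarrow> \<bar>\<phi> t - \<phi> s\<bar> \<le> 1 / real (Suc n)" using R by meson
    have approx: "\<exists>r\<in>\<rat>. r \<noteq> 0 \<and> \<bar>r\<bar> < 1 / real (Suc m) \<and> \<bar>\<phi> r - \<phi> t\<bar> < e"
      if t: "t \<noteq> 0" "\<bar>t\<bar> < 1 / real (Suc m)" and e: "e > 0" for t e
    proof -
      have "isCont \<phi> t" using continuous_on_eq_continuous_at[of "- {0::real}" \<phi>] cont t by (auto simp: open_Compl)
      then obtain d where d: "d > 0" "\<And>r. \<bar>r - t\<bar> < d \<Longrightarrow> \<bar>\<phi> r - \<phi> t\<bar> < e"
        using e unfolding continuous_at_eps_delta dist_real_def by blast
      \<comment> \<open>Within \<open>\<bar>t\<bar>\<close> of \<open>t\<close> the rational is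
        nonzero, and the third bound keeps it inside the window
        \<open>1 / real (Suc m)\<close>.\<close>
      define d' where "d' = min d (min \<bar>t\<bar> (1 / real (Suc m) - \<bar>t\<bar>))"
      have "t - d' < t + d'" using t d by (auto simp: d'_def)
      then obtain r where "r \<in> \<rat>" "t - d' < r" "r < t + d'" using Rats_dense_in_real by blast
      then have "\<bar>r - t\<bar> < d'" by linarith
      moreover have "d' \<le> d" "d' \<le> \<bar>t\<bar>" "d' \<le> 1 / real (Suc m) - \<bar>t\<bar>"
        unfolding d'_def by (simp_all only: min.bounded_iff min.cobounded1 min.coboundedI2 order_refl min.coboundedI1)
      ultimately have "\<bar>r - t\<bar> < d" "\<bar>r - t\<bar> < \<bar>t\<bar>" "\<bar>r - t\<bar> < 1 / real (Suc m) - \<bar>t\<bar>"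
        by linarith+
      moreover from this have "\<bar>r\<bar> < 1 / real (Suc m)" "r \<noteq> 0" by linarith+
      ultimately show ?thesis using \<open>r \<in> \<rat>\<close> d(2)[of r] by blast
    qed
    have "\<bar>\<phi> t - \<phi> s\<bar> \<le> 1 / real (Suc n)"
      if ts: "t \<noteq> 0" "\<bar>t\<bar> < 1 / real (Suc m)" "s \<noteq> 0" "\<bar>s\<bar> < 1 / real (Suc m)" for t s
    proof (rule field_le_epsilon)
      fix e :: real assume "e > 0"
      then have e: "e / 2 > 0" by simp
      obtain t' where t': "t' \<in> \<rat>" "t' \<noteq> 0" "\<bar>t'\<bar> < 1 / real (Suc m)" "\<bar>\<phi> t' - \<phi> t\<bar> < e / 2"
        using approx[OF ts(1,2) e] by blast
      obtain s' where s': "s' \<in> \<rat>" "s' \<noteq> 0" "\<bar>s'\<bar> < 1 / real (Suc m)" "\<bar>\<phi> s' - \<phi> s\<bar> < e / 2"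
        using approx[OF ts(3,4) e] by blast
      show "\<bar>\<phi> t - \<phi> s\<bar> \<le> 1 / real (Suc n) + e"
        using m[OF t'(1) s'(1) t'(2,3) s'(2,3)] t'(4) s'(4) by linarith
    qed
    then show ?thesis by blast
  qed
  \<comment> \<open>The second \<open>Suc\<close> is there because the window of index
    \<open>m\<close> is strict and \<open>k = m\<close> has to fall inside it.\<close>
  define a where "a k = \<phi> (1 / real (Suc (Suc k)))" for k
  have small: "\<bar>1 / real (Suc (Suc k))\<bar> < 1 / real (Suc m)" if "k \<ge> m" for k m
    using that by (auto simp: field_simps)
  have "Cauchy a"
    unfolding Cauchy_altdef dist_real_def
  proof (intro allI impI)
    fix e :: real assume "e > 0"
    then obtain n where n: "1 / real (Suc n) < e" using nat_approx_posE by metis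
    obtain M where "\<And>t s. t \<noteq> 0 \<Longrightarrow> \<bar>t\<bar> < 1 / real (Suc M) \<Longrightarrow> s \<noteq> 0 \<Longrightarrow> \<bar>s\<bar> < 1 / real (Suc M)
      \<Longrightarrow> \<bar>\<phi> t - \<phi> s\<bar> \<le> 1 / real (Suc n)" using R' by meson
    note M = this[of "1 / real (Suc (Suc i))" "1 / real (Suc (Suc j))" for i j]
    have "\<bar>a i - a j\<bar> < e" if "i \<ge> M" "j \<ge> M" for i j
      unfolding a_def using M[of i j] small[OF that(1)] small[OF that(2)] n by force
    then show "\<exists>M. \<forall>i\<ge>M. \<forall>j>i. \<bar>a i - a j\<bar> < e" by (metis order.trans less_imp_le)
  qed
  then obtain l where l: "a \<longlonglongrightarrow> l" using Cauchy_convergent convergent_def by blast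
  have "(\<phi> \<longlongrightarrow> l) (at 0)"
  proof (rule LIM_I)
    fix e :: real assume "e > 0"
    then obtain n where n: "1 / real (Suc n) < e" using nat_approx_posE by metis
    obtain M where M: "\<And>t s. t \<noteq> 0 \<Longrightarrow> \<bar>t\<bar> < 1 / real (Suc M) \<Longrightarrow> s \<noteq> 0 \<Longrightarrow> \<bar>s\<bar> < 1 / real (Suc M)
      \<Longrightarrow> \<bar>\<phi> t - \<phi> s\<bar> \<le> 1 / real (Suc n)" using R' by meson
    have "\<bar>\<phi> t - l\<bar> \<le> 1 / real (Suc n)" if t: "t \<noteq> 0" "\<bar>t\<bar> < 1 / real (Suc M)" for t
    proof (rule LIMSEQ_le_const2)
      show "(\<lambda>k. \<bar>\<phi> t - a k\<bar>) \<longlonglongrightarrow> \<bar>\<phi> t - l\<bar>" by (intro tendsto_intros l)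
      show "\<exists>K. \<forall>k\<ge>K. \<bar>\<phi> t - a k\<bar> \<le> 1 / real (Suc n)"
      proof (intro exI[of _ M] allI impI)
        fix k assume "M \<le> k"
        from small[OF this] show "\<bar>\<phi> t - a k\<bar> \<le> 1 / real (Suc n)"
          unfolding a_def by (intro M[OF t]) auto
      qed
    qed
    then have b: "\<bar>\<phi> t - l\<bar> < e" if "t \<noteq> 0" "\<bar>t\<bar> < 1 / real (Suc M)" for t
      using that n by (meson le_less_trans)
    show "\<exists>s>0. \<forall>x. x \<noteq> 0 \<and> norm (x - 0) < s \<longrightarrow> norm (\<phi> x - l) < e"
    proof (intro exI[of _ "1 / real (Suc M)"] conjI allI impI)
      fix x :: real assume "x \<noteq> 0 \<and> norm (x - 0) < 1 / real (Suc M)"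
      then show "norm (\<phi> x - l) < e" unfolding real_norm_def diff_zero by (intro b) auto
    qed simp
  qed
  then show ?L by blast
qed

lemma ex_limit_at_0_borel:
  fixes \<psi> :: "'a::topological_space \<Rightarrow> real \<Rightarrow> real"
  assumes 1: "\<And>t. t \<noteq> 0 \<Longrightarrow> continuous_on UNIV (\<lambda>p. \<psi> p t)" and 2: "\<And>p. continuous_on (- {0}) (\<psi> p)"
  shows "{p. \<exists>l. (\<psi> p \<longlongrightarrow> l) (at 0)} \<in> sets borel"
proof -
  let ?A = "\<lambda>n t s. {p. \<bar>\<psi> p t - \<psi> p s\<bar> \<le> 1 / real (Suc n)}"
  let ?T = "\<lambda>m. {t \<in> \<rat>. t \<noteq> 0 \<and> \<bar>t\<bar> < 1 / real (Suc m)}"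
  have "{p. \<exists>l. (\<psi> p \<longlongrightarrow> l) (at 0)} = (\<Inter>n. \<Union>m. \<Inter>t\<in>?T m. \<Inter>s\<in>?T m. ?A n t s)"
  proof -
    have "(\<forall>t\<in>?T m. \<forall>s\<in>?T m. Q t s) \<longleftrightarrow> (\<forall>t\<in>\<rat>. \<forall>s\<in>\<rat>. t \<noteq> 0 \<and> \<bar>t\<bar> < 1 / real (Suc m) \<and>
      s \<noteq> 0 \<and> \<bar>s\<bar> < 1 / real (Suc m) \<longrightarrow> Q t s)" for m and Q :: "real \<Rightarrow> real \<Rightarrow> bool"
      by blast
    then show ?thesis
      by (simp only: ex_limit_at_0_iff[OF 2] set_eq_iff mem_Collect_eq INT_iff UN_iff ball_UNIV bex_UNIV)
        simp
  qed
  also have "\<dots> \<in> sets borel"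
  proof -
    have "closed (\<Inter>t\<in>?T m. \<Inter>s\<in>?T m. ?A n t s)" for n m
    proof (intro closed_INT ballI)
      fix t s assume "t \<in> ?T m" "s \<in> ?T m"
      then show "closed (?A n t s)" by (intro closed_Collect_le continuous_intros 1) auto
    qed
    then show ?thesis by (intro sets.countable_INT sets.countable_UN image_subsetI) (auto intro: borel_closed)
  qed
  finally show ?thesis .
qed

context scalable_group begin

text \<open>Along a horizontal element the curve is a copy of the line up to the factor
  \<open>dist 0 u\<close>, so a Lipschitz function restricts to a Lipschitz function of one real
  variable.\<close>

lemma dist_dil_horizontal:
  assumes "\<And>s t. \<delta> (s + t) u = \<delta> s u + \<delta> t u"
  shows "dist (\<delta> s u) (\<delta> t u) = \<bar>s - t\<bar> * dist 0 u"
proof -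
  have "dist (\<delta> s u) (\<delta> t u) = dist (\<delta> s u + 0) (\<delta> s u + \<delta> (t - s) u)"
    using assms[of s "t - s"] by simp
  then show ?thesis by (simp only: dist_add_left dist_dil_0 abs_minus_commute)
qed

lemma difference_quotient_borel:
  assumes F: "continuous_on UNIV (F :: 'g \<Rightarrow> real)"
  shows "{p. \<exists>l. ((\<lambda>t. (F (p + \<delta> t u) - F p) / t) \<longlongrightarrow> l) (at 0)} \<in> sets borel"
proof (rule ex_limit_at_0_borel)
  show "continuous_on UNIV (\<lambda>p. (F (p + \<delta> t u) - F p) / t)" if "t \<noteq> 0" for t
  proof -
    have "continuous_on UNIV (\<lambda>p. p + \<delta> t u)"
      by (rule continuous_on_add[OF continuous_on_id continuous_on_const])
    from continuous_on_compose2[OF F this] show ?thesis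
      using that F by (intro continuous_on_divide continuous_on_diff continuous_on_const) auto
  qed
  show "continuous_on (- {0}) (\<lambda>t. (F (p + \<delta> t u) - F p) / t)" for p
  proof -
    have "continuous_on (- {0}) (\<lambda>t. p + \<delta> t u)"
      by (rule continuous_on_add[OF continuous_on_const continuous_on_dil[OF continuous_on_id continuous_on_const]])
    from continuous_on_compose2[OF F this] show ?thesis
      by (intro continuous_on_divide continuous_on_diff continuous_on_const continuous_on_id) auto
  qed
qed

end

context haar_subgroup begin

text \<open>The one-parameter law identifies the derivative of
  \<open>t \<mapsto> F (p + \<delta> t u)\<close> at time \<open>t\<close> with the derivative of
  \<open>F\<close> along \<open>u\<close> at the point \<open>p + \<delta> t u\<close>. So each such
  curve meets the exceptional set in a null set of times.\<close>

lemma horizontal_derivative_AE: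
  fixes F :: "'g \<Rightarrow> real"
  assumes F: "C-lipschitz_on UNIV F" and u: "u \<in> N" "\<And>s t. \<delta> (s + t) u = \<delta> s u + \<delta> t u"
  shows "\<exists>Z\<in>null_sets \<mu>. \<forall>p\<in>N - Z. \<exists>l. ((\<lambda>t. (F (p + \<delta> t u) - F p) / t) \<longlongrightarrow> l) (at 0)"
proof -
  have Fc: "continuous_on UNIV F" using F by (rule lipschitz_on_continuous_on)
  let ?G = "{p. \<exists>l. ((\<lambda>t. (F (p + \<delta> t u) - F p) / t) \<longlongrightarrow> l) (at 0)}"
  have "- ?G \<in> sets borel" using difference_quotient_borel[OF Fc] by (rule borel_comp)
  then have B: "- ?G \<inter> N \<in> sets \<mu>" by (rule borel_Int_haar)
  have "emeasure \<mu> (- ?G \<inter> N) = 0"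
  proof (rule null_along_curve[OF _ _ B])
    show "continuous_on UNIV (\<lambda>t. \<delta> t u)"
      by (intro continuous_on_dil continuous_on_id continuous_on_const)
    show "\<delta> t u \<in> N" for t using u(1) by simp
    fix p assume "p \<in> N"
    have "(C * dist 0 u)-lipschitz_on UNIV (\<lambda>t. F (p + \<delta> t u))"
    proof (rule lipschitz_onI)
      have C: "C \<ge> 0" using F by (rule lipschitz_on_nonneg)
      then show "0 \<le> C * dist 0 u" by simp
      fix s t :: real
      have "dist (F (p + \<delta> s u)) (F (p + \<delta> t u)) \<le> C * dist (p + \<delta> s u) (p + \<delta> t u)"
        using F by (rule lipschitz_onD) auto
      also have "\<dots> = C * dist 0 u * dist s t"
        using dist_dil_horizontal[OF u(2)] by (simp add: dist_real_def)
      finally show "dist (F (p + \<delta> s u)) (F (p + \<delta> t u)) \<le> C * dist 0 u * dist s t" .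
    qed
    then have "AE t in lborel. \<exists>l. ((\<lambda>s. (F (p + \<delta> (t + s) u) - F (p + \<delta> t u)) / s) \<longlongrightarrow> l) (at 0)"
      by (rule lipschitz_differentiable_AE)
    then have "AE t in lborel. \<exists>l. ((\<lambda>s. (F (p + \<delta> t u + \<delta> s u) - F (p + \<delta> t u)) / s) \<longlongrightarrow> l) (at 0)"
      by (simp only: u(2) add.assoc)
    then show "AE t in lborel. p + \<delta> t u \<notin> - ?G \<inter> N"
      by eventually_elim blast
  qed
  then show ?thesis using B by (intro bexI[of _ "- ?G \<inter> N"]) auto
qed

text \<open>Near a point \<open>p\<close> that is not porous for the set where the difference quotients along \<open>u\<close> are
  uniformly close to a constant, this set meets every small ball around \<open>p + \<delta> t w\<close>; hence the
  derivative along \<open>u\<close> at \<open>p\<close> can be computed with the base point moved to \<open>p + \<delta> t w\<close>.\<close>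

lemma horizontal_derivative_moved_AE:
  fixes F :: "'g \<Rightarrow> real"
  assumes F: "C-lipschitz_on UNIV F" and u: "u \<in> N" "\<And>s t. \<delta> (s + t) u = \<delta> s u + \<delta> t u"
  shows "\<exists>Z\<in>null_sets \<mu>. \<forall>p\<in>N - Z. \<exists>l. \<forall>w\<in>N.
    ((\<lambda>t. (F (p + \<delta> t w + \<delta> t u) - F (p + \<delta> t w)) / t) \<longlongrightarrow> l) (at 0)"
proof -
  have C: "C \<ge> 0" using F by (rule lipschitz_on_nonneg)
  have FL: "\<bar>F x - F y\<bar> \<le> C * dist x y" for x y
    using lipschitz_onD[OF F, of x y] by (simp add: dist_real_def)
  have Fc: "continuous_on UNIV F" using F by (rule lipschitz_on_continuous_on)
  define T where "T m = {t::real. t \<noteq> 0 \<and> \<bar>t\<bar> < 1 / real (Suc m)}" for m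
  \<comment> \<open>Slope \<open>c\<close>, tolerance \<open>1 / real (Suc n)\<close>, range
    \<open>m\<close> of \<open>t\<close> and radius \<open>k\<close>. With \<open>c\<close> rational
    there are countably many such sets, and the restriction to a ball makes them compact, as the
    porosity lemma requires.\<close>
  define E where "E c n m k = {q. \<forall>t\<in>T m. \<bar>F (q + \<delta> t u) - F q - c * t\<bar> \<le> \<bar>t\<bar> / real (Suc n)} \<inter> (cball 0 (real k) \<inter> N)"
    for c n m k
  have E: "compact (E c n m k)" "E c n m k \<subseteq> N" for c n m k
  proof -
    have "closed {q. \<forall>t\<in>T m. \<bar>F (q + \<delta> t u) - F q - c * t\<bar> \<le> \<bar>t\<bar> / real (Suc n)}"
    proof -
      have "closed {q. \<bar>F (q + \<delta> t u) - F q - c * t\<bar> \<le> \<bar>t\<bar> / real (Suc n)}" for t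
      proof -
        have "continuous_on UNIV (\<lambda>p. p + \<delta> t u)"
          by (rule continuous_on_add[OF continuous_on_id continuous_on_const])
        from continuous_on_compose2[OF Fc this] have "continuous_on UNIV (\<lambda>q. \<bar>F (q + \<delta> t u) - F q - c * t\<bar>)"
          by (intro continuous_on_rabs continuous_on_diff Fc continuous_on_const) auto
        then show ?thesis by (rule closed_Collect_le[OF _ continuous_on_const])
      qed
      then have "closed (\<Inter>t\<in>T m. {q. \<bar>F (q + \<delta> t u) - F q - c * t\<bar> \<le> \<bar>t\<bar> / real (Suc n)})" by blast
      then show ?thesis by (simp only: Collect_ball_eq)
    qed
    then show "compact (E c n m k)"
      unfolding E_def by (intro closed_Int_compact compact_cball_0)
    show "E c n m k \<subseteq> N" by (auto simp: E_def)
  qed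
  \<comment> \<open>\<open>j\<close> bounds the size of the displacement \<open>w\<close>,
    \<open>i\<close> the relative size of the hole; integers keep the number of null sets countable
    although \<open>w\<close> is arbitrary.\<close>
  define P where "P c n m k j i = {p \<in> E c n m k. \<forall>d>0. \<exists>t>0. t < d \<and>
    (\<exists>x\<in>N. dist p x \<le> real (Suc j) * t \<and> ball x (1 / real (Suc i) * t) \<inter> E c n m k = {})}" for c n m k j i
  have "\<exists>Z\<in>null_sets \<mu>. P c n m k j i \<subseteq> Z" for c n m k j i
    unfolding P_def
    by (rule porous_points_null[OF space_haar sets_haar emeasure_ball_finite doubling compact_cball E]) auto
  then obtain Z where Z: "\<And>c n m k j i. Z c n m k j i \<in> null_sets \<mu>" "\<And>c n m k j i. P c n m k j i \<subseteq> Z c n m k j i"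
    by metis
  obtain Z0 where Z0: "Z0 \<in> null_sets \<mu>"
    "\<And>p. p \<in> N - Z0 \<Longrightarrow> \<exists>l. ((\<lambda>t. (F (p + \<delta> t u) - F p) / t) \<longlongrightarrow> l) (at 0)"
    using horizontal_derivative_AE[OF F u] by blast
  define Z1 where "Z1 = (\<Union>c\<in>\<rat>. \<Union>n m k j i. Z c n m k j i)"
  have "Z1 \<in> null_sets \<mu>"
    unfolding Z1_def by (intro null_sets_UN' countable_rat null_sets_UN Z(1))
  then have "Z0 \<union> Z1 \<in> null_sets \<mu>" using Z0(1) by (intro null_sets.Un) auto
  moreover have "\<exists>l. \<forall>w\<in>N. ((\<lambda>t. (F (p + \<delta> t w + \<delta> t u) - F (p + \<delta> t w)) / t) \<longlongrightarrow> l) (at 0)"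
    if p: "p \<in> N - (Z0 \<union> Z1)" for p
  proof -
    obtain l where l: "((\<lambda>t. (F (p + \<delta> t u) - F p) / t) \<longlongrightarrow> l) (at 0)" using Z0(2) p by blast
    have "((\<lambda>t. (F (p + \<delta> t w + \<delta> t u) - F (p + \<delta> t w)) / t) \<longlongrightarrow> l) (at 0)" if w: "w \<in> N" for w
    proof (rule LIM_I)
      fix \<epsilon> :: real assume "\<epsilon> > 0"
      \<comment> \<open>The total error will be \<open>2 * e + 2 * C * e\<close>: one
        \<open>e\<close> for the slope at the nearby point, one for \<open>c\<close> against
        \<open>l\<close>, and \<open>C * e\<close> for each of the two changes of point. The
        remaining \<open>2 * e\<close> makes the bound strict.\<close>
      define e where "e = \<epsilon> / (2 * (C + 2))"
      have "\<epsilon> = 2 * (C + 2) * e" using C by (simp add: e_def)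
      moreover have "e > 0" using \<open>\<epsilon> > 0\<close> C by (simp add: e_def)
      ultimately have e: "e > 0" "2 * e + 2 * C * e < \<epsilon>"
        by (auto simp: algebra_simps)
      obtain n where n: "1 / real (Suc n) < e" using nat_approx_posE[OF e(1)] by metis
      define e2 where "e2 = 1 / real (Suc n) / 2"
      have e2: "e2 > 0" "e2 + e2 = 1 / real (Suc n)" by (simp_all only: e2_def field_sum_of_halves) simp
      obtain c where c: "c \<in> \<rat>" "\<bar>c - l\<bar> < e2"
      proof -
        have "l - e2 < l + e2" using e2 by simp
        then obtain c where "c \<in> \<rat>" "l - e2 < c" "c < l + e2" using Rats_dense_in_real by blast
        then show ?thesis using that by (simp add: abs_less_iff)
      qed
      from LIM_D[OF l e2(1)] obtain d where d: "d > 0" "\<And>t. t \<noteq> 0 \<Longrightarrow> \<bar>t\<bar> < d \<Longrightarrow> \<bar>(F (p + \<delta> t u) - F p) / t - l\<bar> < e2"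
        by auto
      obtain m where m: "1 / real (Suc m) < d" using nat_approx_posE[OF d(1)] by metis
      obtain k :: nat where k: "dist 0 p \<le> real k" using real_arch_simple by blast
      have "\<bar>F (p + \<delta> t u) - F p - c * t\<bar> \<le> \<bar>t\<bar> / real (Suc n)" if "t \<in> T m" for t
      proof -
        have t: "t \<noteq> 0" "\<bar>t\<bar> < d" using that m by (auto simp: T_def simp del: of_nat_Suc)
        have "\<bar>(F (p + \<delta> t u) - F p) / t - c\<bar> \<le> 1 / real (Suc n)"
          using d(2)[OF t] c(2) e2(2) by linarith
        moreover have "F (p + \<delta> t u) - F p - c * t = ((F (p + \<delta> t u) - F p) / t - c) * t"
          using t by (simp add: field_simps)
        ultimately show ?thesis
          using mult_right_mono[of "\<bar>(F (p + \<delta> t u) - F p) / t - c\<bar>" "1 / real (Suc n)" "\<bar>t\<bar>"]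
          by (simp add: abs_mult)
      qed
      then have pE: "p \<in> E c n m k" using p k by (auto simp: E_def)
      \<comment> \<open>Right translations need not be Lipschitz. For
        \<open>q = x + \<delta> t z\<close> the distance of \<open>x + \<delta> t u\<close> and
        \<open>q + \<delta> t u\<close> is \<open>\<bar>t\<bar> * dist u (z + u)\<close>, so
        continuity at \<open>z = 0\<close> yields one \<open>\<eta>\<close> for all
        \<open>t\<close>.\<close>
      have "continuous_on UNIV (\<lambda>z. dist u (z + u))"
        by (intro continuous_on_dist continuous_on_const continuous_on_add continuous_on_id)
      then have "isCont (\<lambda>z. dist u (z + u)) 0" by (simp add: continuous_on_eq_continuous_at)
      then obtain \<eta> where \<eta>: "\<eta> > 0" "\<And>z. dist z 0 < \<eta> \<Longrightarrow> dist (dist u (z + u)) (dist u (0 + u)) < e"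
        using e(1) unfolding continuous_at_eps_delta by blast
      have "min \<eta> e > 0" using \<eta> e by simp
      then obtain i where i: "1 / real (Suc i) < min \<eta> e" using nat_approx_posE by metis
      obtain j0 :: nat where "dist 0 w \<le> real j0" using real_arch_simple by blast
      then obtain j where j: "dist 0 w \<le> real (Suc j)" by (intro that[of j0]) simp
      have "x \<in> Z1" if "x \<in> Z c n m k j i" for x
        unfolding Z1_def UN_iff using that
        by (intro bexI[of _ c] bexI[of _ n] bexI[of _ m] bexI[of _ k] bexI[of _ j] bexI[of _ i] c(1) UNIV_I)
      then have "p \<notin> P c n m k j i"
        using p subsetD[OF Z(2), of p c n m k j i] by auto
      then obtain r where r: "r > 0" "\<And>t x. 0 < t \<Longrightarrow> t < r \<Longrightarrow> x \<in> N \<Longrightarrow> dist p x \<le> real (Suc j) * t \<Longrightarrow>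
        ball x (1 / real (Suc i) * t) \<inter> E c n m k \<noteq> {}"
        using pE unfolding P_def mem_Collect_eq by meson
      have "\<bar>(F (p + \<delta> t w + \<delta> t u) - F (p + \<delta> t w)) / t - l\<bar> < \<epsilon>"
        if t: "t \<noteq> 0" "\<bar>t\<bar> < min r (1 / real (Suc m))" for t
      proof -
        define x where "x = p + \<delta> t w"
        have x: "x \<in> N" using p w by (auto simp: x_def)
        have "dist p x = \<bar>t\<bar> * dist 0 w"
          using dist_add_left[of p 0 "\<delta> t w"] by (simp add: x_def dist_dil_0)
        also have "\<dots> \<le> real (Suc j) * \<bar>t\<bar>"
          using j by (simp add: mult.commute mult_left_mono del: of_nat_Suc)
        finally obtain q where q: "q \<in> E c n m k" "dist x q < 1 / real (Suc i) * \<bar>t\<bar>"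
          using r(2)[of "\<bar>t\<bar>" x] t x by (auto simp del: of_nat_Suc)
        define z where "z = \<delta> (1 / t) (- x + q)"
        have qz: "q = x + \<delta> t z" using t by (simp add: z_def add.assoc[symmetric])
        have "\<bar>t\<bar> * dist 0 z < \<bar>t\<bar> * (1 / real (Suc i))"
          using q(2) dist_add_left[of x 0 "\<delta> t z"] dist_dil_0[of t z] by (simp add: qz mult.commute)
        moreover have "0 < \<bar>t\<bar>" using t by simp
        ultimately have z: "dist 0 z < 1 / real (Suc i)" by (simp only: mult_less_cancel_left_pos)
        then have "dist z 0 < \<eta>" using i by (simp add: dist_commute)
        from \<eta>(2)[OF this] have zu: "dist u (z + u) < e" by (simp add: dist_real_def)
        have "dist (x + \<delta> t u) (q + \<delta> t u) = dist (\<delta> t u) (\<delta> t (z + u))"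
          by (simp add: qz add.assoc dil_add)
        then have 1: "dist (x + \<delta> t u) (q + \<delta> t u) \<le> \<bar>t\<bar> * e"
          using zu by (simp add: dist_dil mult_left_mono)
        have 2: "dist q x \<le> \<bar>t\<bar> * e"
        proof -
          have "1 / real (Suc i) * \<bar>t\<bar> \<le> e * \<bar>t\<bar>" using i by (intro mult_right_mono) auto
          then show ?thesis using q(2) by (simp add: dist_commute mult.commute)
        qed
        have 3: "\<bar>F (q + \<delta> t u) - F q - c * t\<bar> \<le> \<bar>t\<bar> * e"
        proof -
          have "\<bar>F (q + \<delta> t u) - F q - c * t\<bar> \<le> \<bar>t\<bar> / real (Suc n)"
            using q(1) t by (auto simp: E_def T_def)
          also have "\<dots> \<le> \<bar>t\<bar> * e" using mult_left_mono[of "1 / real (Suc n)" e "\<bar>t\<bar>"] n by simp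
          finally show ?thesis .
        qed
        have "\<bar>F (x + \<delta> t u) - F (q + \<delta> t u)\<bar> \<le> C * (\<bar>t\<bar> * e)" "\<bar>F q - F x\<bar> \<le> C * (\<bar>t\<bar> * e)"
          using FL[of "x + \<delta> t u" "q + \<delta> t u"] FL[of q x] mult_left_mono[OF 1 C] mult_left_mono[OF 2 C] by linarith+
        moreover have "\<bar>c * t - l * t\<bar> \<le> \<bar>t\<bar> * e"
        proof -
          have "\<bar>c - l\<bar> \<le> e" using c(2) e2 n by linarith
          then show ?thesis using mult_left_mono[of "\<bar>c - l\<bar>" e "\<bar>t\<bar>"]
            by (simp add: abs_mult[symmetric] algebra_simps)
        qed
        ultimately have "\<bar>F (x + \<delta> t u) - F x - l * t\<bar> \<le> \<bar>t\<bar> * e + \<bar>t\<bar> * e + (C * (\<bar>t\<bar> * e) + C * (\<bar>t\<bar> * e))"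
          using 3 by linarith
        also have "\<dots> = \<bar>t\<bar> * (2 * e + 2 * C * e)" by (simp add: algebra_simps)
        also have "\<dots> < \<bar>t\<bar> * \<epsilon>" using e(2) t by simp
        finally have "\<bar>F (x + \<delta> t u) - F x - l * t\<bar> < \<bar>t\<bar> * \<epsilon>" .
        moreover have "F (x + \<delta> t u) - F x - l * t = t * ((F (x + \<delta> t u) - F x) / t - l)"
          using t by (simp add: field_simps)
        ultimately show ?thesis using t by (simp add: abs_mult x_def)
      qed
      then show "\<exists>s>0. \<forall>t. t \<noteq> 0 \<and> norm (t - 0) < s \<longrightarrow>
          norm ((F (p + \<delta> t w + \<delta> t u) - F (p + \<delta> t w)) / t - l) < \<epsilon>"
        using r(1) by (intro exI[of _ "min r (1 / real (Suc m))"]) auto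
    qed
    then show ?thesis by blast
  qed
  ultimately show ?thesis by blast
qed

end

section \<open>Differentiability along a subgroup\<close>

text \<open>The Lipschitz bound is uniform in \<open>t\<close>, so the limits along a sequence in
  \<open>A\<close> are Cauchy and the two limits can be exchanged. The parameter \<open>w\<close> is
  for moved base points; a single \<open>w0\<close> already gives the limit value, which then serves
  every \<open>w\<close>.\<close>

lemma common_limit_closure:
  fixes D :: "'w \<Rightarrow> 'u::metric_space \<Rightarrow> real \<Rightarrow> real"
  assumes lip: "\<And>w u v t. w \<in> W \<Longrightarrow> t \<noteq> 0 \<Longrightarrow> \<bar>D w u t - D w v t\<bar> \<le> C * dist u v"
    and A: "\<And>u. u \<in> A \<Longrightarrow> \<exists>l. \<forall>w\<in>W. (D w u \<longlongrightarrow> l) (at 0)"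
    and u: "u \<in> closure A" and W: "w0 \<in> W" and C: "0 \<le> C"
  shows "\<exists>l. \<forall>w\<in>W. (D w u \<longlongrightarrow> l) (at 0)"
proof -
  obtain x where x: "\<And>n. x n \<in> A" "x \<longlonglongrightarrow> u"
    using u unfolding closure_sequential by blast
  obtain l where l: "\<And>n w. w \<in> W \<Longrightarrow> (D w (x n) \<longlongrightarrow> l n) (at 0)"
    using A[OF x(1)] by metis
  have ll: "\<bar>l n - l m\<bar> \<le> C * dist (x n) (x m)" for n m
  proof (rule tendsto_upperbound)
    show "((\<lambda>t. \<bar>D w0 (x n) t - D w0 (x m) t\<bar>) \<longlongrightarrow> \<bar>l n - l m\<bar>) (at 0)"
      using W by (intro tendsto_intros l)
    show "\<forall>\<^sub>F t in at 0. \<bar>D w0 (x n) t - D w0 (x m) t\<bar> \<le> C * dist (x n) (x m)"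
      using lip[OF W] by (simp add: eventually_at_filter)
  qed simp
  \<comment> \<open>\<open>C + 1\<close> allows division also when \<open>C = 0\<close>.\<close>
  have C1: "0 < C + 1" using C by simp
  have "Cauchy l"
    unfolding Cauchy_altdef dist_real_def
  proof (intro allI impI)
    fix e :: real assume "e > 0"
    then have "0 < e / (C + 1)" using C1 by simp
    then obtain M where M: "\<And>i j. M \<le> i \<Longrightarrow> M \<le> j \<Longrightarrow> dist (x i) (x j) < e / (C + 1)"
      using LIMSEQ_imp_Cauchy[OF x(2)] unfolding Cauchy_def by blast
    have "\<bar>l i - l j\<bar> < e" if "M \<le> i" "M \<le> j" for i j
    proof -
      have "\<bar>l i - l j\<bar> \<le> (C + 1) * dist (x i) (x j)"
        using ll[of i j] zero_le_dist[of "x i" "x j"] by (simp only: distrib_right mult_1)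
      also have "\<dots> < e" using M[OF that] C1 by (simp add: field_simps)
      finally show ?thesis .
    qed
    then show "\<exists>M. \<forall>m\<ge>M. \<forall>n>m. \<bar>l m - l n\<bar> < e" by (metis order.trans less_imp_le)
  qed
  then obtain L where L: "l \<longlonglongrightarrow> L" using Cauchy_convergent convergent_def by blast
  have "(D w u \<longlongrightarrow> L) (at 0)" if w: "w \<in> W" for w
  proof (rule tendstoI)
    fix e :: real assume "e > 0"
    then have e3: "e / 3 > 0" and eC: "e / 3 / (C + 1) > 0" using C1 by auto
    have "\<forall>\<^sub>F n in sequentially. dist (x n) u < e / 3 / (C + 1) \<and> dist (l n) L < e / 3"
      using tendstoD[OF x(2) eC] tendstoD[OF L e3] by (rule eventually_conj)
    then obtain n where n: "dist (x n) u < e / 3 / (C + 1)" "dist (l n) L < e / 3"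
      by (auto simp: eventually_sequentially)
    have "C * dist u (x n) \<le> (C + 1) * dist u (x n)"
      by (simp add: distrib_right)
    also have "\<dots> < e / 3" using n(1) C1 by (simp add: field_simps dist_commute)
    finally have close: "C * dist u (x n) < e / 3" .
    have "\<forall>\<^sub>F t in at 0. t \<noteq> (0::real)" by (simp add: eventually_at_filter)
    then show "\<forall>\<^sub>F t in at 0. dist (D w u t) L < e"
      using tendstoD[OF l[OF w, of n] e3]
    proof eventually_elim
      case (elim t)
      then show ?case
        using lip[OF w elim(1), of u "x n"] close n(2) unfolding dist_real_def by linarith
    qed
  qed
  then show ?thesis by blast
qed

text \<open>Expresses convergence to 0 by the mere existence of limits, a condition already known to
  be Borel. If \<open>g\<close> tends to \<open>c\<close>, multiplying by the sign gives the
  one-sided limits \<open>c\<close> and \<open>- c\<close>, which agree only for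
  \<open>c = 0\<close>.\<close>

lemma tendsto_0_iff_sgn:
  fixes g :: "real \<Rightarrow> real"
  shows "(g \<longlongrightarrow> 0) (at 0) \<longleftrightarrow> (\<exists>l. (g \<longlongrightarrow> l) (at 0)) \<and> (\<exists>l. ((\<lambda>t. g t * sgn t) \<longlongrightarrow> l) (at 0))"
proof safe
  assume g: "(g \<longlongrightarrow> 0) (at 0)"
  then show "\<exists>l. (g \<longlongrightarrow> l) (at 0)" by blast
  have "((\<lambda>t. g t * sgn t) \<longlongrightarrow> 0) (at 0)"
    using g by (rule Lim_null_comparison[OF _ tendsto_rabs_zero, rotated])
      (auto simp: abs_mult sgn_if eventually_at_filter)
  then show "\<exists>l. ((\<lambda>t. g t * sgn t) \<longlongrightarrow> l) (at 0)" by blast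
next
  fix c l assume c: "(g \<longlongrightarrow> c) (at 0)" and l: "((\<lambda>t. g t * sgn t) \<longlongrightarrow> l) (at 0)"
  have cr: "(g \<longlongrightarrow> c) (at_right 0)" "(g \<longlongrightarrow> c) (at_left 0)"
    and lr: "((\<lambda>t. g t * sgn t) \<longlongrightarrow> l) (at_right 0)" "((\<lambda>t. g t * sgn t) \<longlongrightarrow> l) (at_left 0)"
    using c l by (auto simp: filterlim_at_split)
  have "\<forall>\<^sub>F t in at_right (0::real). g t * sgn t = g t" by (auto simp: eventually_at_filter)
  then have "(g \<longlongrightarrow> l) (at_right 0)" by (rule Lim_transform_eventually[OF lr(1)])
  then have "c = l" using cr(1) tendsto_unique trivial_limit_at_right_real by blast
  have "\<forall>\<^sub>F t in at_left (0::real). g t * sgn t = - g t" by (auto simp: eventually_at_filter)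
  then have "((\<lambda>t. - g t) \<longlongrightarrow> l) (at_left 0)" by (rule Lim_transform_eventually[OF lr(2)])
  then have "- c = l" using tendsto_minus[OF cr(2)] tendsto_unique trivial_limit_at_left_real by blast
  then show "(g \<longlongrightarrow> 0) (at 0)" using c \<open>c = l\<close> by simp
qed

context scalable_group begin

definition quot :: "('g \<Rightarrow> real) \<Rightarrow> 'g \<Rightarrow> 'g \<Rightarrow> real \<Rightarrow> real" where
  "quot f p u t = (f (p + \<delta> t u) - f p) / t"

definition defect :: "('g \<Rightarrow> real) \<Rightarrow> 'g \<Rightarrow> 'g \<Rightarrow> 'g \<Rightarrow> real \<Rightarrow> real" where
  "defect f p u v t = quot f p (u + v) t - quot f p u t - quot f p v t"

text \<open>\<open>A\<close> need not be closed under addition, so additivity is demanded of the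
  quotients through \<open>defect\<close> and not of a limit function on \<open>A\<close>. In this
  form the notion makes sense for countable sets and passes to closures.\<close>

definition differentiable_along :: "('g \<Rightarrow> real) \<Rightarrow> 'g \<Rightarrow> 'g set \<Rightarrow> bool" where
  "differentiable_along f p A \<longleftrightarrow> (\<forall>u\<in>A. \<exists>l. (quot f p u \<longlongrightarrow> l) (at 0)) \<and>
     (\<forall>u\<in>A. \<forall>v\<in>A. (defect f p u v \<longlongrightarrow> 0) (at 0))"

lemma differentiable_along_mono:
  "differentiable_along f p B \<Longrightarrow> A \<subseteq> B \<Longrightarrow> differentiable_along f p A"
  unfolding differentiable_along_def by blast

text \<open>The factor \<open>\<bar>t\<bar>\<close> from the dilation cancels against the
  denominator. Base point \<open>x\<close> and value \<open>c\<close> are free so that both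
  \<open>quot\<close> and the quotients at moved base points are instances.\<close>

lemma quotient_lipschitz:
  assumes "C-lipschitz_on UNIV (f :: 'g \<Rightarrow> real)" "t \<noteq> 0"
  shows "\<bar>(f (x + \<delta> t u) - c) / t - (f (x + \<delta> t v) - c) / t\<bar> \<le> C * dist u v"
proof -
  have "(f (x + \<delta> t u) - c) / t - (f (x + \<delta> t v) - c) / t = (f (x + \<delta> t u) - f (x + \<delta> t v)) / t"
    by (simp add: diff_divide_distrib)
  moreover have "\<bar>f (x + \<delta> t u) - f (x + \<delta> t v)\<bar> \<le> C * dist u v * \<bar>t\<bar>"
    using lipschitz_onD[OF assms(1), of "x + \<delta> t u" "x + \<delta> t v"]
    by (simp add: dist_dil dist_real_def mult_ac)
  ultimately show ?thesis using assms(2) by (simp add: abs_divide divide_le_eq)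
qed

lemma quot_lipschitz:
  assumes "C-lipschitz_on UNIV f" "t \<noteq> 0"
  shows "\<bar>quot f p u t - quot f p v t\<bar> \<le> C * dist u v"
  unfolding quot_def by (rule quotient_lipschitz[OF assms])

lemma differentiable_along_closure:
  assumes f: "C-lipschitz_on UNIV f" and A: "differentiable_along f p A"
  shows "differentiable_along f p (closure A)"
  unfolding differentiable_along_def
proof (intro conjI ballI)
  have C: "0 \<le> C" using f by (rule lipschitz_on_nonneg)
  fix u assume u: "u \<in> closure A"
  have "\<exists>l. \<forall>w\<in>UNIV. (quot f p u \<longlongrightarrow> l) (at 0)"
    by (rule common_limit_closure[OF _ _ u UNIV_I C])
      (use A quot_lipschitz[OF f] in \<open>auto simp: differentiable_along_def\<close>)
  then show "\<exists>l. (quot f p u \<longlongrightarrow> l) (at 0)" by simp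
  fix v assume v: "v \<in> closure A"
  show "(defect f p u v \<longlongrightarrow> 0) (at 0)"
  proof (rule tendstoI)
    fix e :: real assume "e > 0"
    obtain x y where x: "\<And>n. x n \<in> A" "x \<longlonglongrightarrow> u" and y: "\<And>n. y n \<in> A" "y \<longlonglongrightarrow> v"
      using u v unfolding closure_sequential by blast
    have xy: "(\<lambda>n. x n + y n) \<longlonglongrightarrow> u + v"
    proof -
      have "continuous_on UNIV (\<lambda>z. fst z + snd z :: 'g)"
        by (intro continuous_on_add continuous_on_fst continuous_on_snd continuous_on_id)
      then have "isCont (\<lambda>z. fst z + snd z :: 'g) (u, v)"
        by (simp add: continuous_on_eq_continuous_at)
      from isCont_tendsto_compose[OF this tendsto_Pair[OF x(2) y(2)]] show ?thesis by simp
    qed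
    have "(\<lambda>n. C * dist (u + v) (x n + y n) + C * dist u (x n) + C * dist v (y n)) \<longlonglongrightarrow>
      C * dist (u + v) (u + v) + C * dist u u + C * dist v v"
      by (intro tendsto_intros xy x(2) y(2))
    then have "\<forall>\<^sub>F n in sequentially. C * dist (u + v) (x n + y n) + C * dist u (x n) + C * dist v (y n) < e / 2"
      using \<open>e > 0\<close> by (intro order_tendstoD) auto
    then obtain n where n: "C * dist (u + v) (x n + y n) + C * dist u (x n) + C * dist v (y n) < e / 2"
      by (auto simp: eventually_sequentially)
    have "(defect f p (x n) (y n) \<longlongrightarrow> 0) (at 0)"
      using A x(1) y(1) unfolding differentiable_along_def by blast
    then have "\<forall>\<^sub>F t in at 0. dist (defect f p (x n) (y n) t) 0 < e / 2"
      by (rule tendstoD) (use \<open>e > 0\<close> in simp)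
    moreover have "\<forall>\<^sub>F t in at 0. t \<noteq> (0::real)" by (simp add: eventually_at_filter)
    ultimately show "\<forall>\<^sub>F t in at 0. dist (defect f p u v t) 0 < e"
    proof eventually_elim
      case (elim t)
      then show ?case
        using quot_lipschitz[OF f elim(2), of p "u + v" "x n + y n"]
          quot_lipschitz[OF f elim(2), of p u "x n"] quot_lipschitz[OF f elim(2), of p v "y n"] n
        unfolding dist_real_def defect_def by linarith
    qed
  qed
qed

lemma differentiable_along_borel:
  assumes f: "C-lipschitz_on UNIV f" and A: "countable A"
  shows "{p. differentiable_along f p A} \<in> sets borel"
proof -
  have fc: "continuous_on UNIV f" using f by (rule lipschitz_on_continuous_on)
  have c1: "continuous_on UNIV (\<lambda>p. quot f p u t)" if "t \<noteq> 0" for u t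
  proof -
    have "continuous_on UNIV (\<lambda>p. p + \<delta> t u)"
      by (rule continuous_on_add[OF continuous_on_id continuous_on_const])
    from continuous_on_compose2[OF fc this] show ?thesis
      unfolding quot_def using that fc by (intro continuous_on_divide continuous_on_diff continuous_on_const) auto
  qed
  have c2: "continuous_on (- {0}) (quot f p u)" for p u
  proof -
    have "continuous_on (- {0}) (\<lambda>t. p + \<delta> t u)"
      by (rule continuous_on_add[OF continuous_on_const continuous_on_dil[OF continuous_on_id continuous_on_const]])
    from continuous_on_compose2[OF fc this] show ?thesis
      unfolding quot_def by (intro continuous_on_divide continuous_on_diff continuous_on_const continuous_on_id) auto
  qed
  have sgn: "continuous_on (- {0}) (sgn :: real \<Rightarrow> real)"
    by (rule continuous_on_sgn[OF continuous_on_id]) auto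
  have d1: "continuous_on UNIV (\<lambda>p. defect f p u v t)" if "t \<noteq> 0" for u v t
    unfolding defect_def by (intro continuous_on_diff c1 that)
  have d2: "continuous_on (- {0}) (defect f p u v)" for p u v
    unfolding defect_def by (intro continuous_on_diff c2)
  have "{p. differentiable_along f p A} = (\<Inter>u\<in>A. {p. \<exists>l. (quot f p u \<longlongrightarrow> l) (at 0)}) \<inter>
    (\<Inter>u\<in>A. \<Inter>v\<in>A. {p. \<exists>l. (defect f p u v \<longlongrightarrow> l) (at 0)} \<inter>
      {p. \<exists>l. ((\<lambda>t. defect f p u v t * sgn t) \<longlongrightarrow> l) (at 0)})"
    by (simp add: differentiable_along_def tendsto_0_iff_sgn set_eq_iff)
  also have "\<dots> \<in> sets borel"
  proof -
    have "{p. \<exists>l. (quot f p u \<longlongrightarrow> l) (at 0)} \<in> sets borel" for u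
      by (rule ex_limit_at_0_borel[OF c1 c2])
    moreover have "{p. \<exists>l. (defect f p u v \<longlongrightarrow> l) (at 0)} \<in> sets borel" for u v
      by (rule ex_limit_at_0_borel[OF d1 d2])
    moreover have "{p. \<exists>l. ((\<lambda>t. defect f p u v t * sgn t) \<longlongrightarrow> l) (at 0)} \<in> sets borel" for u v
      using continuous_on_mult[OF d1 continuous_on_const] continuous_on_mult[OF d2 sgn]
      by (rule ex_limit_at_0_borel)
    ultimately show ?thesis
      by (intro sets.Int sets.countable_INT'' A) auto
  qed
  finally show ?thesis .
qed

text \<open>Reduces the definition to a dense set, on which no limit function has to be named. The
  limit inherits the Lipschitz bound of the quotients, and this gives its continuity.\<close>

lemma gateaux_differentiable_iff:
  assumes f: "C-lipschitz_on UNIV f" and A: "closure A = UNIV"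
  shows "gateaux_differentiable_at \<delta> f p \<longleftrightarrow> differentiable_along f p A"
proof
  assume "gateaux_differentiable_at \<delta> f p"
  then obtain L where L: "\<And>u. (quot f p u \<longlongrightarrow> L u) (at 0)" "\<And>x y. L (x + y) = L x + L y"
    unfolding gateaux_differentiable_at_def quot_def by blast
  have "(defect f p u v \<longlongrightarrow> 0) (at 0)" for u v
  proof -
    have "(defect f p u v \<longlongrightarrow> L (u + v) - L u - L v) (at 0)"
      unfolding defect_def by (intro tendsto_diff L(1))
    then show ?thesis by (simp add: L(2))
  qed
  then show "differentiable_along f p A"
    using L(1) unfolding differentiable_along_def by blast
next
  assume "differentiable_along f p A"
  from differentiable_along_closure[OF f this] A have d: "differentiable_along f p UNIV" by simp
  then obtain L where L: "\<And>u. (quot f p u \<longlongrightarrow> L u) (at 0)"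
    unfolding differentiable_along_def by (metis UNIV_I)
  have add: "L (x + y) = L x + L y" for x y
  proof -
    have "(defect f p x y \<longlongrightarrow> L (x + y) - L x - L y) (at 0)"
      unfolding defect_def by (intro tendsto_diff L)
    moreover have "(defect f p x y \<longlongrightarrow> 0) (at 0)" using d by (simp add: differentiable_along_def)
    ultimately have "L (x + y) - L x - L y = 0" using tendsto_unique by (metis trivial_limit_at)
    then show ?thesis by simp
  qed
  have "C-lipschitz_on UNIV L"
  proof (rule lipschitz_onI)
    show "0 \<le> C" using f by (rule lipschitz_on_nonneg)
    fix u v
    show "dist (L u) (L v) \<le> C * dist u v"
      unfolding dist_real_def
    proof (rule tendsto_upperbound)
      show "((\<lambda>t. \<bar>quot f p u t - quot f p v t\<bar>) \<longlongrightarrow> \<bar>L u - L v\<bar>) (at 0)"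
        by (intro tendsto_intros L)
      show "\<forall>\<^sub>F t in at 0. \<bar>quot f p u t - quot f p v t\<bar> \<le> C * dist u v"
        using quot_lipschitz[OF f] by (simp add: eventually_at_filter)
    qed simp
  qed
  then have "continuous_on UNIV L" by (rule lipschitz_on_continuous_on)
  then show "gateaux_differentiable_at \<delta> f p"
    using L add unfolding gateaux_differentiable_at_def quot_def by blast
qed

end

context haar_subgroup begin

text \<open>The directions \<open>u\<close> whose derivative is insensitive to moving the base point to \<open>p + \<delta> t w\<close> form a
  closed subgroup, on which the derivative is additive.\<close>

lemma differentiable_along_AE:
  fixes F :: "'g \<Rightarrow> real"
  assumes F: "C-lipschitz_on UNIV F"
    and H: "countable H" "H \<subseteq> N" "\<And>u s t. u \<in> H \<Longrightarrow> \<delta> (s + t) u = \<delta> s u + \<delta> t u"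
    and gen: "\<And>S. closed S \<Longrightarrow> 0 \<in> S \<Longrightarrow> (\<And>x y. x \<in> S \<Longrightarrow> y \<in> S \<Longrightarrow> x + y \<in> S) \<Longrightarrow>
      (\<And>x. x \<in> S \<Longrightarrow> - x \<in> S) \<Longrightarrow> H \<subseteq> S \<Longrightarrow> N \<subseteq> S"
  shows "\<exists>Z\<in>null_sets \<mu>. \<forall>p\<in>N - Z. differentiable_along F p N"
proof -
  have C: "C \<ge> 0" using F by (rule lipschitz_on_nonneg)
  define D where "D p w u t = (F (p + \<delta> t w + \<delta> t u) - F (p + \<delta> t w)) / t" for p w u t
  have "\<forall>u\<in>H. \<exists>Z\<in>null_sets \<mu>. \<forall>p\<in>N - Z. \<exists>l. \<forall>w\<in>N. (D p w u \<longlongrightarrow> l) (at 0)"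
  proof
    fix u assume u: "u \<in> H"
    have "u \<in> N" using H(2) u by blast
    from horizontal_derivative_moved_AE[OF F this H(3)[OF u]]
    show "\<exists>Z\<in>null_sets \<mu>. \<forall>p\<in>N - Z. \<exists>l. \<forall>w\<in>N. (D p w u \<longlongrightarrow> l) (at 0)"
      unfolding D_def .
  qed
  then obtain Z where Z: "\<And>u. u \<in> H \<Longrightarrow> Z u \<in> null_sets \<mu>"
    "\<And>u p. u \<in> H \<Longrightarrow> p \<in> N - Z u \<Longrightarrow> \<exists>l. \<forall>w\<in>N. (D p w u \<longlongrightarrow> l) (at 0)"
    by metis
  have "(\<Union>u\<in>H. Z u) \<in> null_sets \<mu>" by (intro null_sets_UN' H(1) Z(1))
  moreover have "differentiable_along F p N" if p: "p \<in> N - (\<Union>u\<in>H. Z u)" for p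
  proof -
    \<comment> \<open>All base points \<open>w\<close> in \<open>N\<close> share one limit. Closure
      of \<open>S\<close> under sums and inverses rests on this: the second summand in
      \<open>Dadd\<close> starts from \<open>w + u\<close>, and \<open>Dminus\<close> starts from
      \<open>w - u\<close>.\<close>
    define S where "S = {u \<in> N. \<exists>l. \<forall>w\<in>N. (D p w u \<longlongrightarrow> l) (at 0)}"
    have Dadd: "D p w (u + v) t = D p w u t + D p (w + u) v t" for w u v t
      unfolding D_def by (simp add: dil_add add.assoc diff_divide_distrib)
    have Dminus: "D p w (- u) t = - D p (w - u) u t" for w u t
    proof -
      have "\<delta> t (w - u) + \<delta> t u = \<delta> t w" using dil_add[of t "w - u" u] by simp
      moreover have "\<delta> t w + \<delta> t (- u) = \<delta> t (w - u)" using dil_add[of t w "- u"] by simp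
      ultimately show ?thesis unfolding D_def by (simp only: add.assoc minus_divide_left minus_diff_eq)
    qed
    have SN: "S \<subseteq> N" by (auto simp: S_def)
    have "N \<subseteq> S"
    proof (rule gen)
      have "closure S \<subseteq> S"
      proof
        fix u assume u: "u \<in> closure S"
        then have "u \<in> N" using closure_minimal[OF SN closed_N] by blast
        moreover have "\<exists>l. \<forall>w\<in>N. (D p w u \<longlongrightarrow> l) (at 0)"
        proof (rule common_limit_closure[OF _ _ u zero_mem C])
          show "\<bar>D p w u t - D p w v t\<bar> \<le> C * dist u v" if "t \<noteq> 0" for w u v t
            unfolding D_def by (rule quotient_lipschitz[OF F that])
        qed (auto simp: S_def)
        ultimately show "u \<in> S" by (simp add: S_def)
      qed
      then show "closed S" using closure_subset_eq by blast
      have "D p w 0 = (\<lambda>_. 0)" for w by (simp add: fun_eq_iff D_def)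
      then show "0 \<in> S" by (auto simp: S_def)
      show "u + v \<in> S" if uv: "u \<in> S" "v \<in> S" for u v
      proof -
        obtain l k where l: "\<And>w. w \<in> N \<Longrightarrow> (D p w u \<longlongrightarrow> l) (at 0)" "\<And>w. w \<in> N \<Longrightarrow> (D p w v \<longlongrightarrow> k) (at 0)"
          using uv unfolding S_def by blast
        have N: "u \<in> N" "v \<in> N" using uv SN by auto
        have "(D p w (u + v) \<longlongrightarrow> l + k) (at 0)" if "w \<in> N" for w
          unfolding Dadd[abs_def] using that N by (intro tendsto_add l) auto
        then show ?thesis using N by (auto simp: S_def)
      qed
      show "- u \<in> S" if u: "u \<in> S" for u
      proof -
        obtain l where l: "\<And>w. w \<in> N \<Longrightarrow> (D p w u \<longlongrightarrow> l) (at 0)"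
          using u unfolding S_def by blast
        have N: "u \<in> N" using u SN by auto
        have "(D p w (- u) \<longlongrightarrow> - l) (at 0)" if "w \<in> N" for w
          unfolding Dminus[abs_def] using that N add_mem[of w "- u"] by (intro tendsto_minus l) auto
        then show ?thesis using N by (auto simp: S_def)
      qed
      show "H \<subseteq> S" using H(2) Z(2) p unfolding S_def by blast
    qed
    then have "\<forall>u\<in>N. \<exists>l. \<forall>w\<in>N. (D p w u \<longlongrightarrow> l) (at 0)" by (auto simp: S_def)
    then obtain L where L: "\<And>u w. u \<in> N \<Longrightarrow> w \<in> N \<Longrightarrow> (D p w u \<longlongrightarrow> L u) (at 0)" by metis
    have D0: "D p 0 u = quot F p u" for u by (simp add: fun_eq_iff D_def quot_def)
    show ?thesis
      unfolding differentiable_along_def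
    proof (intro conjI ballI)
      fix u assume u: "u \<in> N"
      show "\<exists>l. (quot F p u \<longlongrightarrow> l) (at 0)" using L[OF u zero_mem] by (auto simp: D0)
      fix v assume v: "v \<in> N"
      \<comment> \<open>The defect is the difference of the quotients along \<open>v\<close> from
        \<open>p + \<delta> t u\<close> and from \<open>p\<close>, which have the same
        limit.\<close>
      have "((\<lambda>t. D p u v t - D p 0 v t) \<longlongrightarrow> L v - L v) (at 0)"
        using u v by (intro tendsto_diff L) auto
      moreover have "D p u v t - D p 0 v t = defect F p u v t" for t
        using Dadd[of 0 u v t] by (simp add: defect_def D0)
      ultimately show "(defect F p u v \<longlongrightarrow> 0) (at 0)" by simp
    qed
  qed
  ultimately show ?thesis by blast
qed

end

text \<open>The part of a Carnot structure that the differentiability theorem uses: countably many horizontal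
  elements generate a subgroup whose closure contains \<open>N\<close>.\<close>

definition horizontally_generated :: "(real \<Rightarrow> 'g \<Rightarrow> 'g) \<Rightarrow> 'g::{topological_space,group_add} set \<Rightarrow> bool" where
  "horizontally_generated \<delta> N \<longleftrightarrow> (\<exists>H\<subseteq>N. countable H \<and> (\<forall>u\<in>H. \<forall>s t. \<delta> (s + t) u = \<delta> s u + \<delta> t u) \<and>
     (\<forall>S. closed S \<and> 0 \<in> S \<and> (\<forall>x\<in>S. \<forall>y\<in>S. x + y \<in> S) \<and> (\<forall>x\<in>S. - x \<in> S) \<and> H \<subseteq> S \<longrightarrow> N \<subseteq> S))"

context scalable_group begin

text \<open>The translate by \<open>g\<close> of the bad set of \<open>f\<close> is the bad set of
  \<open>x \<mapsto> f (- g + x)\<close>, which is Lipschitz with the same constant because the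
  distance is left invariant. The almost everywhere statement on \<open>N\<close> applies to that
  function.\<close>

lemma translated_null:
  assumes f: "C-lipschitz_on UNIV f"
    and N: "proper_subgroup \<delta> N" "horizontally_generated \<delta> N" and \<mu>: "haar_measure_on N \<mu>"
    and D: "D \<subseteq> N"
  shows "emeasure \<mu> (N \<inter> (\<lambda>x. g + x) ` {p. \<not> differentiable_along f p D}) = 0"
proof -
  interpret proper_subgroup \<delta> N by (rule N)
  interpret haar_subgroup \<delta> N \<mu> by unfold_locales (rule \<mu>)
  define F where "F x = f (- g + x)" for x
  have FL: "C-lipschitz_on UNIV F"
  proof (rule lipschitz_onI)
    show "0 \<le> C" using f by (rule lipschitz_on_nonneg)
    show "dist (F x) (F y) \<le> C * dist x y" for x y
      using lipschitz_onD[OF f, of "- g + x" "- g + y"] by (simp add: F_def)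
  qed
  obtain H where H: "H \<subseteq> N" "countable H" "\<And>u s t. u \<in> H \<Longrightarrow> \<delta> (s + t) u = \<delta> s u + \<delta> t u"
    "\<And>S. closed S \<Longrightarrow> 0 \<in> S \<Longrightarrow> (\<And>x y. x \<in> S \<Longrightarrow> y \<in> S \<Longrightarrow> x + y \<in> S) \<Longrightarrow>
      (\<And>x. x \<in> S \<Longrightarrow> - x \<in> S) \<Longrightarrow> H \<subseteq> S \<Longrightarrow> N \<subseteq> S"
    using N(2) unfolding horizontally_generated_def by metis
  from differentiable_along_AE[OF FL H(2,1,3,4)] obtain Z where
    Z: "Z \<in> null_sets \<mu>" "\<And>p. p \<in> N - Z \<Longrightarrow> differentiable_along F p N" by blast
  have "N \<inter> (\<lambda>x. g + x) ` {p. \<not> differentiable_along f p D} \<subseteq> Z"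
  proof
    fix x assume "x \<in> N \<inter> (\<lambda>x. g + x) ` {p. \<not> differentiable_along f p D}"
    then obtain p where p: "x \<in> N" "x = g + p" "\<not> differentiable_along f p D" by blast
    have "quot F x u = quot f p u" for u
      by (simp add: fun_eq_iff quot_def F_def p(2) add.assoc)
    then have eq: "differentiable_along F x A = differentiable_along f p A" for A
      by (simp add: differentiable_along_def defect_def[abs_def])
    have "\<not> differentiable_along f p N"
      using p(3) differentiable_along_mono[OF _ D] by blast
    then show "x \<in> Z" using Z(2)[of x] p(1) eq by blast
  qed
  then have "emeasure \<mu> (N \<inter> (\<lambda>x. g + x) ` {p. \<not> differentiable_along f p D}) \<le> emeasure \<mu> Z"
    using Z(1) by (intro emeasure_mono) auto
  then show ?thesis using Z(1) by auto
qed

end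

section \<open>The low-degree terms of the BCH product\<close>

lemma dynkin_degree_simps [simp]:
  "dynkin_degree [] = 0" "dynkin_degree ((r, s) # rs) = r + s + dynkin_degree rs"
  by (simp_all add: dynkin_degree_def)

lemma length_dynkin_word: "length (dynkin_word rs) = dynkin_degree rs"
  by (induction rs) (auto simp: dynkin_word_def dynkin_degree_def)

lemma length_le_dynkin_degree: "\<forall>(r, s)\<in>set rs. 0 < r + s \<Longrightarrow> length rs \<le> dynkin_degree rs"
  by (induction rs) auto

lemma finite_dynkin_index: "finite (dynkin_index D k)"
proof (rule finite_subset)
  have "set rs \<subseteq> {..D} \<times> {..D}" if "dynkin_degree rs \<le> D" for rs
    using that by (induction rs) auto
  then show "dynkin_index D k \<subseteq> {rs. set rs \<subseteq> {..D} \<times> {..D} \<and> length rs = k}"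
    by (auto simp: dynkin_index_def)
  show "finite {rs. set rs \<subseteq> {..D} \<times> {..D} \<and> length rs = k}"
    by (rule finite_lists_length_eq) auto
qed

definition bch_index :: "nat \<Rightarrow> (nat \<times> (nat \<times> nat) list) set" where
  "bch_index D = (SIGMA k:{1..D}. dynkin_index D k)"

definition bch_degree_index :: "nat \<Rightarrow> nat \<Rightarrow> (nat \<times> (nat \<times> nat) list) set" where
  "bch_degree_index D d = {p \<in> bch_index D. dynkin_degree (snd p) = d}"

text \<open>The component of the Dynkin series that is homogeneous of degree \<open>d\<close>:
  scaling both arguments by \<open>a\<close> multiplies it by \<open>a ^ d\<close>. The blow-up
  limits rest on this grading.\<close>

definition bch_part :: "(vec \<Rightarrow> vec \<Rightarrow> vec) \<Rightarrow> nat \<Rightarrow> nat \<Rightarrow> vec \<Rightarrow> vec \<Rightarrow> vec" where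
  "bch_part br D d X Y = (\<lambda>i. \<Sum>(k, rs)\<in>bch_degree_index D d.
     dynkin_coeff k rs * nested_bracket br X Y (dynkin_word rs) i)"

lemma finite_bch_index: "finite (bch_index D)" "finite (bch_degree_index D d)"
  by (auto simp: bch_index_def bch_degree_index_def finite_dynkin_index)

lemma bch_degree_index_iff:
  "(k, rs) \<in> bch_degree_index D d \<longleftrightarrow> 1 \<le> k \<and> d \<le> D \<and> length rs = k \<and> (\<forall>(r, s)\<in>set rs. 0 < r + s) \<and> dynkin_degree rs = d"
  using length_le_dynkin_degree[of rs]
  by (auto simp: bch_degree_index_def bch_index_def dynkin_index_def)

lemma bch_eq_sum_parts: "bch br D X Y i = (\<Sum>d=1..D. bch_part br D d X Y i)"
proof -
  let ?h = "\<lambda>(k, rs). dynkin_coeff k rs * nested_bracket br X Y (dynkin_word rs) i"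
  have "(\<lambda>p. dynkin_degree (snd p)) ` bch_index D \<subseteq> {1..D}"
  proof
    fix d assume "d \<in> (\<lambda>p. dynkin_degree (snd p)) ` bch_index D"
    then obtain k rs where "(k, rs) \<in> bch_degree_index D d" by (auto simp: bch_degree_index_def)
    then show "d \<in> {1..D}" using length_le_dynkin_degree[of rs] by (auto simp: bch_degree_index_iff)
  qed
  from sum.group[OF finite_bch_index(1) _ this, of ?h]
  have "(\<Sum>d=1..D. \<Sum>p\<in>bch_degree_index D d. ?h p) = (\<Sum>p\<in>bch_index D. ?h p)"
    by (simp add: bch_degree_index_def)
  then show ?thesis
    by (simp add: bch_def vsum_def vscale_def bch_part_def bch_index_def split_beta)
qed

lemma bch_degree_index_1: "1 \<le> D \<Longrightarrow> bch_degree_index D 1 = {(1, [(1, 0)]), (1, [(0, 1)])}"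
proof (intro equalityI subsetI)
  fix p assume "p \<in> bch_degree_index D 1"
  then obtain k rs where p: "p = (k, rs)" "(k, rs) \<in> bch_degree_index D 1" by (cases p) auto
  then have "length rs = k" "k = 1" "dynkin_degree rs = 1"
    using length_le_dynkin_degree[of rs] by (auto simp: bch_degree_index_iff)
  moreover from this obtain r s where "rs = [(r, s)]" by (auto simp: length_Suc_conv)
  ultimately have "k = 1" "rs = [(r, s)]" "r + s = 1" by auto
  moreover from this have "r = 1 \<and> s = 0 \<or> r = 0 \<and> s = 1" by arith
  ultimately show "p \<in> {(1, [(1, 0)]), (1, [(0, 1)])}" using p by auto
qed (auto simp: bch_degree_index_iff)

lemma bch_degree_index_2:
  assumes "2 \<le> D"
  shows "bch_degree_index D 2 = {(1, [(2, 0)]), (1, [(1, 1)]), (1, [(0, 2)]),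
    (2, [(1, 0), (1, 0)]), (2, [(1, 0), (0, 1)]), (2, [(0, 1), (1, 0)]), (2, [(0, 1), (0, 1)])}" (is "_ = ?R")
proof (intro equalityI subsetI)
  fix p assume "p \<in> bch_degree_index D 2"
  then obtain k rs where p: "p = (k, rs)" "(k, rs) \<in> bch_degree_index D 2" by (cases p) auto
  then have k: "length rs = k" "k = 1 \<or> k = 2" "dynkin_degree rs = 2" "\<forall>(r, s)\<in>set rs. 0 < r + s"
    using length_le_dynkin_degree[of rs] by (auto simp: bch_degree_index_iff)
  from k(2) show "p \<in> ?R"
  proof
    assume k1: "k = 1"
    then obtain r s where rs: "rs = [(r, s)]" using k(1) by (auto simp: length_Suc_conv)
    then have "r + s = 2" using k(3) by simp
    then have "r = 2 \<and> s = 0 \<or> r = 1 \<and> s = 1 \<or> r = 0 \<and> s = 2" by arith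
    then show ?thesis using p(1) k1 rs by auto
  next
    assume k2: "k = 2"
    then obtain a b c d where rs: "rs = [(a, b), (c, d)]"
      using k(1) by (auto simp: length_Suc_conv numeral_2_eq_2)
    then have "a + b + c + d = 2" "0 < a + b" "0 < c + d" using k(3,4) by auto
    then have "(a = 1 \<and> b = 0 \<or> a = 0 \<and> b = 1) \<and> (c = 1 \<and> d = 0 \<or> c = 0 \<and> d = 1)" by arith
    then show ?thesis using p(1) k2 rs by auto
  qed
qed (use assms in \<open>auto simp: bch_degree_index_iff\<close>)

locale lie_vec =
  fixes n :: nat and br :: "vec \<Rightarrow> vec \<Rightarrow> vec"
  assumes lie: "lie_algebra_on n br"
begin

lemma br_mem: "x \<in> Rn n \<Longrightarrow> y \<in> Rn n \<Longrightarrow> br x y \<in> Rn n"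
  and br_lin_left: "x \<in> Rn n \<Longrightarrow> y \<in> Rn n \<Longrightarrow> z \<in> Rn n \<Longrightarrow>
    br (vadd (vscale a x) (vscale b y)) z = vadd (vscale a (br x z)) (vscale b (br y z))"
  and br_lin_right: "x \<in> Rn n \<Longrightarrow> y \<in> Rn n \<Longrightarrow> z \<in> Rn n \<Longrightarrow>
    br z (vadd (vscale a x) (vscale b y)) = vadd (vscale a (br z x)) (vscale b (br z y))"
  and br_self: "x \<in> Rn n \<Longrightarrow> br x x = vzero"
  using lie unfolding lie_algebra_on_def by auto

lemma Rn_simps [simp]: "vzero \<in> Rn n" "x \<in> Rn n \<Longrightarrow> vscale a x \<in> Rn n"
  "x \<in> Rn n \<Longrightarrow> y \<in> Rn n \<Longrightarrow> vadd x y \<in> Rn n"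
  by (auto simp: Rn_def vzero_def vscale_def vadd_def)

lemma vadd_scale_zero: "vadd (vscale a x) (vscale 0 y) = vscale a x" "vscale 0 x = vzero" "vscale a vzero = vzero"
  "vadd vzero x = x" "vadd x vzero = x"
  by (auto simp: vadd_def vscale_def vzero_def)

lemma br_scale: "x \<in> Rn n \<Longrightarrow> y \<in> Rn n \<Longrightarrow> br (vscale a x) (vscale b y) = vscale (a * b) (br x y)"
proof -
  assume x: "x \<in> Rn n" and y: "y \<in> Rn n"
  have "br (vscale a x) (vscale b y) = vscale a (br x (vscale b y))"
    using br_lin_left[of x x "vscale b y" a 0] x y by (simp add: vadd_scale_zero)
  also have "br x (vscale b y) = vscale b (br x y)"
    using br_lin_right[of y y x b 0] x y by (simp add: vadd_scale_zero)
  finally show ?thesis by (simp add: vscale_def fun_eq_iff)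
qed

lemma br_anti:
  assumes "x \<in> Rn n" "y \<in> Rn n"
  shows "br y x = vscale (- 1) (br x y)"
proof -
  let ?s = "vadd (vscale 1 x) (vscale 1 y)"
  have s: "?s \<in> Rn n" using assms by simp
  have "br ?s ?s = vadd (vscale 1 (br x ?s)) (vscale 1 (br y ?s))"
    using assms s by (intro br_lin_left) auto
  also have "br x ?s = vadd (vscale 1 (br x x)) (vscale 1 (br x y))"
    using assms by (intro br_lin_right) auto
  also have "br y ?s = vadd (vscale 1 (br y x)) (vscale 1 (br y y))"
    using assms by (intro br_lin_right) auto
  finally have "vzero = vadd (br x y) (br y x)"
    using assms s by (simp add: br_self vscale_def vadd_def vzero_def)
  then show ?thesis by (auto simp: vscale_def vadd_def vzero_def fun_eq_iff add_eq_0_iff)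
qed

lemma nested_mem: "X \<in> Rn n \<Longrightarrow> Y \<in> Rn n \<Longrightarrow> nested_bracket br X Y w \<in> Rn n"
proof (induction w)
  case (Cons b w)
  then show ?case by (cases w) (auto intro: br_mem)
qed simp

lemma nested_scale:
  assumes "X \<in> Rn n" "Y \<in> Rn n"
  shows "nested_bracket br (vscale a X) (vscale a Y) w = vscale (a ^ length w) (nested_bracket br X Y w)"
proof (induction w)
  case (Cons b w)
  show ?case
  proof (cases w)
    case (Cons c v)
    let ?Z = "if b then X else Y"
    have "nested_bracket br (vscale a X) (vscale a Y) (b # w) = br (vscale a ?Z) (vscale (a ^ length w) (nested_bracket br X Y w))"
      using Cons.IH Cons by simp
    also have "\<dots> = vscale (a * a ^ length w) (br ?Z (nested_bracket br X Y w))"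
      using assms by (intro br_scale nested_mem) auto
    finally show ?thesis using Cons by simp
  qed simp
qed (auto simp: vscale_def vzero_def)

text \<open>The innermost bracket pairs two multiples of \<open>x\<close> and vanishes; zero then
  propagates outwards.\<close>

lemma nested_parallel:
  assumes x: "x \<in> Rn n" and w: "2 \<le> length w"
  shows "nested_bracket br (vscale a x) (vscale b x) w = vzero"
  using w
proof (induction w)
  case (Cons c w)
  let ?Z = "if c then vscale a x else vscale b x"
  show ?case
  proof (cases "2 \<le> length w")
    case True
    then obtain d v where "w = d # v" by (cases w) auto
    then have "nested_bracket br (vscale a x) (vscale b x) (c # w) = br ?Z (vscale 0 vzero)"
      using Cons.IH True by (simp add: vadd_scale_zero)
    also have "\<dots> = br (vscale 1 ?Z) (vscale 0 vzero)" by (simp add: vscale_def)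
    also have "\<dots> = vscale (1 * 0) (br ?Z vzero)" using x by (intro br_scale) auto
    finally show ?thesis by (simp add: vadd_scale_zero)
  next
    case False
    then obtain d where d: "w = [d]" using Cons.prems by (cases w) (auto simp: Suc_le_eq)
    have "br (vscale r x) (vscale s x) = vzero" for r s
      using x by (simp add: br_scale br_self vadd_scale_zero)
    then show ?thesis using d by simp
  qed
qed simp

lemma bch_part_mem: "X \<in> Rn n \<Longrightarrow> Y \<in> Rn n \<Longrightarrow> bch_part br D d X Y \<in> Rn n"
  using nested_mem unfolding Rn_def bch_part_def by (auto intro!: sum.neutral)

lemma bch_part_scale:
  assumes "X \<in> Rn n" "Y \<in> Rn n"
  shows "bch_part br D d (vscale a X) (vscale a Y) i = a ^ d * bch_part br D d X Y i"
  unfolding bch_part_def sum_distrib_left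
proof (rule sum.cong)
  have v: "vscale c Z i = c * Z i" for c Z by (simp add: vscale_def)
  fix p assume "p \<in> bch_degree_index D d"
  then have "length (dynkin_word (snd p)) = d" by (simp add: length_dynkin_word bch_degree_index_def)
  then show "(case p of (k, rs) \<Rightarrow> dynkin_coeff k rs * nested_bracket br (vscale a X) (vscale a Y) (dynkin_word rs) i) =
    a ^ d * (case p of (k, rs) \<Rightarrow> dynkin_coeff k rs * nested_bracket br X Y (dynkin_word rs) i)"
    by (simp add: split_beta nested_scale[OF assms] v)
qed simp

lemma bch_part_parallel:
  assumes "x \<in> Rn n" "2 \<le> d"
  shows "bch_part br D d (vscale a x) (vscale b x) i = 0"
  unfolding bch_part_def using assms
  by (intro sum.neutral) (auto simp: nested_parallel length_dynkin_word bch_degree_index_iff vzero_def)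

lemma bch_part_1: "1 \<le> D \<Longrightarrow> bch_part br D 1 X Y i = X i + Y i"
  unfolding bch_part_def bch_degree_index_1 by (simp add: dynkin_coeff_def dynkin_word_def)

text \<open>The words \<open>XX\<close> and \<open>YY\<close> vanish. \<open>[X, Y]\<close> gets
  \<open>1 / 2\<close> from \<open>(1, [(1, 1)])\<close> and \<open>- 1 / 4\<close> from
  \<open>(2, [(1, 0), (0, 1)])\<close>; \<open>[Y, X]\<close> gets \<open>- 1 / 4\<close>, and
  antisymmetry adds this up to \<open>1 / 2\<close>.\<close>

lemma bch_part_2:
  assumes "2 \<le> D" "X \<in> Rn n" "Y \<in> Rn n"
  shows "bch_part br D 2 X Y i = 1 / 2 * br X Y i"
  unfolding bch_part_def bch_degree_index_2[OF assms(1)] using assms(2,3) br_anti[OF assms(2,3)]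
  by (simp add: dynkin_coeff_def dynkin_word_def br_self vzero_def numeral_2_eq_2 vscale_def)

lemma bch_mem: "X \<in> Rn n \<Longrightarrow> Y \<in> Rn n \<Longrightarrow> bch br D X Y \<in> Rn n"
  using bch_part_mem[of X Y] unfolding Rn_def by (auto simp: bch_eq_sum_parts)

lemma bch_parallel:
  assumes "x \<in> Rn n" "1 \<le> D"
  shows "bch br D (vscale a x) (vscale b x) = vscale (a + b) x"
proof
  fix i
  have "bch br D (vscale a x) (vscale b x) i = (\<Sum>d=1..D. if d = 1 then a * x i + b * x i else 0)"
    unfolding bch_eq_sum_parts
  proof (rule sum.cong)
    fix d assume "d \<in> {1..D}"
    then show "bch_part br D d (vscale a x) (vscale b x) i = (if d = 1 then a * x i + b * x i else 0)"
      using bch_part_1[OF assms(2), of "vscale a x" "vscale b x" i] bch_part_parallel[OF assms(1), of d D a b i]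
      by (auto simp: vscale_def)
  qed simp
  also have "\<dots> = vscale (a + b) x i" using assms(2) by (simp add: vscale_def distrib_right)
  finally show "bch br D (vscale a x) (vscale b x) i = vscale (a + b) x i" .
qed

section \<open>Continuity of the bracket and blow-up limits of the product\<close>

definition unit_vec :: "nat \<Rightarrow> vec" where "unit_vec j = (\<lambda>i. if i = j then 1 else 0)"

lemma linear_expand:
  assumes lin: "\<And>a b x y. x \<in> Rn n \<Longrightarrow> y \<in> Rn n \<Longrightarrow> L (vadd (vscale a x) (vscale b y)) = vadd (vscale a (L x)) (vscale b (L y))"
    and x: "x \<in> Rn n"
  shows "L x i = (\<Sum>j<n. x j * L (unit_vec j) i)"
proof -
  define tr where "tr m = (\<lambda>i. if i < m then x i else 0)" for m
  have tr: "tr m \<in> Rn n" for m using x by (auto simp: tr_def Rn_def)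
  have u: "unit_vec j \<in> Rn n" if "j < n" for j using that by (auto simp: unit_vec_def Rn_def)
  have "m \<le> n \<Longrightarrow> L (tr m) i = (\<Sum>j<m. x j * L (unit_vec j) i)" for m
  proof (induction m)
    case 0
    have "L (vadd (vscale 0 vzero) (vscale 0 vzero)) = vadd (vscale 0 (L vzero)) (vscale 0 (L vzero))"
      by (rule lin) auto
    moreover have "tr 0 = vadd (vscale 0 vzero) (vscale 0 vzero)" by (auto simp: tr_def vadd_def vscale_def)
    ultimately show ?case by (simp add: vadd_def vscale_def)
  next
    case (Suc m)
    have "tr (Suc m) = vadd (vscale 1 (tr m)) (vscale (x m) (unit_vec m))"
      by (auto simp: tr_def vadd_def vscale_def unit_vec_def fun_eq_iff less_Suc_eq)
    then have "L (tr (Suc m)) = vadd (vscale 1 (L (tr m))) (vscale (x m) (L (unit_vec m)))"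
      using lin[OF tr[of m] u[of m], of 1 "x m"] Suc.prems by simp
    then show ?case using Suc by (simp add: vadd_def vscale_def)
  qed
  from this[of n] have "L (tr n) i = (\<Sum>j<n. x j * L (unit_vec j) i)" by simp
  moreover have "tr n = x" using x by (auto simp: tr_def Rn_def)
  ultimately show ?thesis by simp
qed

text \<open>Structure constants: on \<open>Rn n\<close> the bracket is a polynomial in the
  coordinates, and its continuity in \<open>br_tendsto\<close> comes from this.\<close>

lemma br_expand:
  assumes "x \<in> Rn n" "y \<in> Rn n"
  shows "br x y i = (\<Sum>j<n. x j * (\<Sum>k<n. y k * br (unit_vec j) (unit_vec k) i))"
proof -
  have u: "unit_vec j \<in> Rn n" if "j < n" for j using that by (auto simp: unit_vec_def Rn_def)
  have "br x y i = (\<Sum>j<n. x j * br (unit_vec j) y i)"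
    using assms by (intro linear_expand[of "\<lambda>x. br x y"]) (auto intro: br_lin_left)
  also have "\<dots> = (\<Sum>j<n. x j * (\<Sum>k<n. y k * br (unit_vec j) (unit_vec k) i))"
  proof (rule sum.cong)
    fix j assume "j \<in> {..<n}"
    then have "br (unit_vec j) y i = (\<Sum>k<n. y k * br (unit_vec j) (unit_vec k) i)"
      using assms u by (intro linear_expand[of "br (unit_vec j)"]) (auto intro: br_lin_right)
    then show "x j * br (unit_vec j) y i = x j * (\<Sum>k<n. y k * br (unit_vec j) (unit_vec k) i)" by simp
  qed simp
  finally show ?thesis .
qed

lemma br_tendsto:
  assumes X: "\<And>m. X m \<in> Rn n" "x \<in> Rn n" "\<And>i. (\<lambda>m. X m i) \<longlonglongrightarrow> x i"
    and Y: "\<And>m. Y m \<in> Rn n" "y \<in> Rn n" "\<And>i. (\<lambda>m. Y m i) \<longlonglongrightarrow> y i"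
  shows "(\<lambda>m. br (X m) (Y m) i) \<longlonglongrightarrow> br x y i"
  unfolding br_expand[OF X(1) Y(1)] br_expand[OF X(2) Y(2)]
  by (intro tendsto_sum tendsto_mult tendsto_const X(3) Y(3))

lemma nested_tendsto:
  assumes X: "\<And>m. X m \<in> Rn n" "x \<in> Rn n" "\<And>i. (\<lambda>m. X m i) \<longlonglongrightarrow> x i"
    and Y: "\<And>m. Y m \<in> Rn n" "y \<in> Rn n" "\<And>i. (\<lambda>m. Y m i) \<longlonglongrightarrow> y i"
  shows "(\<lambda>m. nested_bracket br (X m) (Y m) w i) \<longlonglongrightarrow> nested_bracket br x y w i"
proof (induction w arbitrary: i)
  case (Cons b w)
  show ?case
  proof (cases w)
    case Nil
    then show ?thesis using X(3) Y(3) by simp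
  next
    case (Cons c v)
    have "(\<lambda>m. br (if b then X m else Y m) (nested_bracket br (X m) (Y m) w) i)
      \<longlonglongrightarrow> br (if b then x else y) (nested_bracket br x y w) i"
      using X Y by (intro br_tendsto nested_mem Cons.IH) auto
    then show ?thesis using Cons by simp
  qed
qed simp

lemma bch_part_tendsto:
  assumes X: "\<And>m. X m \<in> Rn n" "x \<in> Rn n" "\<And>i. (\<lambda>m. X m i) \<longlonglongrightarrow> x i"
    and Y: "\<And>m. Y m \<in> Rn n" "y \<in> Rn n" "\<And>i. (\<lambda>m. Y m i) \<longlonglongrightarrow> y i"
  shows "(\<lambda>m. bch_part br D d (X m) (Y m) i) \<longlonglongrightarrow> bch_part br D d x y i"
  unfolding bch_part_def split_beta
  by (intro tendsto_sum tendsto_mult tendsto_const nested_tendsto[OF X Y])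

text \<open>Division by \<open>a\<close> leaves the term of degree \<open>d\<close> with the factor
  \<open>a ^ (d - 1)\<close>, so only the linear one survives. Vector addition is thus a limit of
  rescaled group products.\<close>

lemma bch_blow_up:
  assumes a: "a \<longlonglongrightarrow> 0" "\<And>m. a m \<noteq> 0" and D: "1 \<le> D"
    and X: "\<And>m. X m \<in> Rn n" "x \<in> Rn n" "\<And>i. (\<lambda>m. X m i) \<longlonglongrightarrow> x i"
    and Y: "\<And>m. Y m \<in> Rn n" "y \<in> Rn n" "\<And>i. (\<lambda>m. Y m i) \<longlonglongrightarrow> y i"
  shows "(\<lambda>m. bch br D (vscale (a m) (X m)) (vscale (a m) (Y m)) i / a m) \<longlonglongrightarrow> x i + y i"
proof -
  have eq: "bch br D (vscale (a m) (X m)) (vscale (a m) (Y m)) i / a m =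
    (\<Sum>d=1..D. a m ^ (d - 1) * bch_part br D d (X m) (Y m) i)" for m
    unfolding bch_eq_sum_parts sum_divide_distrib
  proof (rule sum.cong)
    fix d assume "d \<in> {1..D}"
    then have "a m ^ d = a m * a m ^ (d - 1)" by (cases d) auto
    then show "bch_part br D d (vscale (a m) (X m)) (vscale (a m) (Y m)) i / a m = a m ^ (d - 1) * bch_part br D d (X m) (Y m) i"
      using a(2)[of m] by (simp add: bch_part_scale[OF X(1) Y(1)])
  qed simp
  have "(\<lambda>m. \<Sum>d=1..D. a m ^ (d - 1) * bch_part br D d (X m) (Y m) i) \<longlonglongrightarrow>
    (\<Sum>d=1..D. 0 ^ (d - 1) * bch_part br D d x y i)"
    by (intro tendsto_sum tendsto_mult tendsto_power a(1) bch_part_tendsto[OF X Y])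
  also have "(\<Sum>d=1..D. 0 ^ (d - 1) * bch_part br D d x y i) = (\<Sum>d=1..D. if d = 1 then x i + y i else 0)"
    by (rule sum.cong) (use bch_part_1[OF D, of x y i] in auto)
  also have "\<dots> = x i + y i" using D by simp
  finally show ?thesis unfolding eq .
qed

text \<open>With \<open>A = bch (a x) (a y) / a\<close> and \<open>B = - (x + y)\<close>, the terms of degree one in
  \<open>bch (a A) (a B)\<close> leave \<open>a\<^sup>2 [x, y] / 2\<close>, and the term of degree two vanishes in the limit because
  \<open>A\<close> tends to \<open>- B\<close>.\<close>

lemma bch_blow_up_bracket:
  assumes a: "a \<longlonglongrightarrow> 0" "\<And>m. a m \<noteq> 0" and D: "2 \<le> D" and x: "x \<in> Rn n" and y: "y \<in> Rn n"
  shows "(\<lambda>m. bch br D (bch br D (vscale (a m) x) (vscale (a m) y)) (vscale (- a m) (vadd x y)) i / (a m)\<^sup>2)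
    \<longlonglongrightarrow> 1 / 2 * br x y i"
proof -
  have D1: "1 \<le> D" using D by simp
  define A where "A m = vscale (1 / a m) (bch br D (vscale (a m) x) (vscale (a m) y))" for m
  define B where "B = vscale (- 1) (vadd x y)"
  have AB: "A m \<in> Rn n" "B \<in> Rn n" for m using x y by (simp_all add: A_def B_def bch_mem)
  have xy: "vadd x y \<in> Rn n" using x y by simp
  have Alim: "(\<lambda>m. A m i) \<longlonglongrightarrow> vadd x y i" for i
    using bch_blow_up[OF a D1 x x tendsto_const y y tendsto_const, of i]
    by (simp add: A_def vscale_def vadd_def)
  have Alim2: "(\<lambda>m. (A m i + B i) / a m) \<longlonglongrightarrow> 1 / 2 * br x y i"
  proof -
    have eq: "(A m i + B i) / a m = (\<Sum>d=2..D. a m ^ (d - 2) * bch_part br D d x y i)" for m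
    proof -
      have "A m i = (\<Sum>d=1..D. a m ^ (d - 1) * bch_part br D d x y i)"
        unfolding A_def vscale_def[of "1 / a m"] bch_eq_sum_parts sum_distrib_left
      proof (rule sum.cong)
        fix d assume "d \<in> {1..D}"
        then have "a m ^ d = a m * a m ^ (d - 1)" by (cases d) auto
        then show "1 / a m * bch_part br D d (vscale (a m) x) (vscale (a m) y) i = a m ^ (d - 1) * bch_part br D d x y i"
          using a(2)[of m] by (simp add: bch_part_scale[OF x y])
      qed simp
      also have "\<dots> = x i + y i + (\<Sum>d=2..D. a m ^ (d - 1) * bch_part br D d x y i)"
        using D1 bch_part_1[OF D1, of x y i] by (simp add: sum.atLeast_Suc_atMost numeral_2_eq_2)
      finally have "A m i + B i = (\<Sum>d=2..D. a m ^ (d - 1) * bch_part br D d x y i)"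
        by (simp add: B_def vscale_def vadd_def)
      then show ?thesis
        unfolding sum_divide_distrib
      proof (simp only: sum_divide_distrib, intro sum.cong)
        fix d assume "d \<in> {2..D}"
        then have "d - 1 = Suc (d - 2)" by auto
        then have "a m ^ (d - 1) = a m * a m ^ (d - 2)" by simp
        then show "a m ^ (d - 1) * bch_part br D d x y i / a m = a m ^ (d - 2) * bch_part br D d x y i"
          using a(2)[of m] by simp
      qed simp
    qed
    have "(\<lambda>m. \<Sum>d=2..D. a m ^ (d - 2) * bch_part br D d x y i) \<longlonglongrightarrow>
      (\<Sum>d=2..D. 0 ^ (d - 2) * bch_part br D d x y i)"
      by (intro tendsto_sum tendsto_mult tendsto_power a(1) tendsto_const)
    \<comment> \<open>As \<open>0 ^ 0 = 1\<close>, exactly the term \<open>d = 2\<close>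
      survives.\<close>
    also have "(\<Sum>d=2..D. 0 ^ (d - 2) * bch_part br D d x y i) = (\<Sum>d=2..D. if d = 2 then 1 / 2 * br x y i else 0)"
      by (rule sum.cong) (use bch_part_2[OF D x y, of i] in auto)
    also have "\<dots> = 1 / 2 * br x y i" using D by simp
    finally show ?thesis unfolding eq .
  qed
  have eq: "bch br D (bch br D (vscale (a m) x) (vscale (a m) y)) (vscale (- a m) (vadd x y)) i / (a m)\<^sup>2 =
    (A m i + B i) / a m + (\<Sum>d=2..D. a m ^ (d - 2) * bch_part br D d (A m) B i)" for m
  proof -
    have "bch br D (vscale (a m) x) (vscale (a m) y) = vscale (a m) (A m)"
      using a(2)[of m] by (simp add: A_def vscale_def)
    moreover have "vscale (- a m) (vadd x y) = vscale (a m) B" by (simp add: B_def vscale_def)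
    ultimately have "bch br D (bch br D (vscale (a m) x) (vscale (a m) y)) (vscale (- a m) (vadd x y)) i =
      (\<Sum>d=1..D. a m ^ d * bch_part br D d (A m) B i)"
      by (simp add: bch_eq_sum_parts bch_part_scale[OF AB])
    also have "\<dots> = a m * (A m i + B i) + (\<Sum>d=2..D. a m ^ d * bch_part br D d (A m) B i)"
      using D1 bch_part_1[OF D1, of "A m" B i] by (simp add: sum.atLeast_Suc_atMost numeral_2_eq_2)
    also have "(\<Sum>d=2..D. a m ^ d * bch_part br D d (A m) B i) = (a m)\<^sup>2 * (\<Sum>d=2..D. a m ^ (d - 2) * bch_part br D d (A m) B i)"
      unfolding sum_distrib_left
    proof (rule sum.cong)
      fix d assume "d \<in> {2..D}"
      then have "2 + (d - 2) = d" by auto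
      then have "a m ^ d = (a m)\<^sup>2 * a m ^ (d - 2)" by (metis power_add)
      then show "a m ^ d * bch_part br D d (A m) B i = (a m)\<^sup>2 * (a m ^ (d - 2) * bch_part br D d (A m) B i)" by simp
    qed simp
    finally show ?thesis using a(2)[of m] by (simp add: add_divide_distrib power2_eq_square)
  qed
  have "(\<lambda>m. (A m i + B i) / a m + (\<Sum>d=2..D. a m ^ (d - 2) * bch_part br D d (A m) B i)) \<longlonglongrightarrow>
    1 / 2 * br x y i + (\<Sum>d=2..D. 0 ^ (d - 2) * bch_part br D d (vadd x y) B i)"
    by (intro tendsto_add Alim2 tendsto_sum tendsto_mult tendsto_power a(1)
        bch_part_tendsto[OF AB(1) xy Alim AB(2) AB(2) tendsto_const])
  also have "(\<Sum>d=2..D. 0 ^ (d - 2) * bch_part br D d (vadd x y) B i) = 0"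
  proof (rule sum.neutral, rule ballI)
    fix d assume "d \<in> {2..D}"
    then have "bch_part br D d (vscale 1 (vadd x y)) B i = 0"
      unfolding B_def by (intro bch_part_parallel xy) auto
    then show "0 ^ (d - 2) * bch_part br D d (vadd x y) B i = 0" by (simp add: vscale_def)
  qed
  finally show ?thesis unfolding eq by simp
qed

end

section \<open>Carnot subgroups\<close>

lemma countable_dense_subset:
  fixes S :: "'a::second_countable_topology set"
  obtains T where "countable T" "T \<subseteq> S" "S \<subseteq> closure T"
proof -
  obtain B :: "'a set set" where B: "countable B" "topological_basis B"
    using ex_countable_basis by blast
  define T where "T = (\<lambda>b. SOME x. x \<in> b \<inter> S) ` {b \<in> B. b \<inter> S \<noteq> {}}"
  have pick: "(SOME x. x \<in> b \<inter> S) \<in> b \<inter> S" if "b \<inter> S \<noteq> {}" for b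
    using that by (simp only: some_in_eq not_False_eq_True)
  have "S \<subseteq> closure T"
  proof
    fix x assume x: "x \<in> S"
    show "x \<in> closure T"
      unfolding closure_iff_nhds_not_empty
    proof (intro allI impI)
      fix A U assume "U \<subseteq> A" "open U" "x \<in> U"
      then obtain b where b: "b \<in> B" "x \<in> b" "b \<subseteq> U"
        using B(2) by (metis topological_basisE)
      then have "b \<inter> S \<noteq> {}" using x by blast
      then have "(SOME x. x \<in> b \<inter> S) \<in> T \<inter> A"
        using pick[of b] b \<open>U \<subseteq> A\<close> by (auto simp: T_def)
      then show "T \<inter> A \<noteq> {}" by blast
    qed
  qed
  moreover have "countable T" "T \<subseteq> S" using B(1) pick by (auto simp: T_def)
  ultimately show ?thesis using that by blast
qed

lemma tendsto_coordinatewise: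
  fixes X :: "'b \<Rightarrow> vec"
  assumes "\<And>i. ((\<lambda>m. X m i) \<longlongrightarrow> x i) F"
  shows "(X \<longlongrightarrow> x) F"
proof -
  have "limitin (product_topology (\<lambda>i. euclidean) UNIV) X x F"
    using assms by (simp add: limitin_componentwise)
  then show ?thesis by (simp add: euclidean_product_topology)
qed

text \<open>Tychonoff, with the factors from index \<open>n\<close> on reduced to
  \<open>{0}\<close>.\<close>

lemma compact_unit_box: "compact {x \<in> Rn n. \<forall>i. \<bar>x i\<bar> \<le> 1}"
proof -
  let ?S = "\<lambda>i. if i < n then {-1..1::real} else {0}"
  have "compactin (product_topology (\<lambda>i. euclidean) UNIV) (PiE UNIV ?S)"
    by (simp add: compactin_PiE)
  then have "compact (PiE UNIV ?S)" by (simp add: euclidean_product_topology)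
  moreover have "PiE UNIV ?S = {x \<in> Rn n. \<forall>i. \<bar>x i\<bar> \<le> 1}"
  proof (intro equalityI subsetI)
    fix x assume "x \<in> PiE UNIV ?S"
    then have x: "x i \<in> ?S i" for i by (rule PiE_mem) simp
    have "x i = 0" if "n \<le> i" for i using x[of i] that by simp
    moreover have "\<bar>x i\<bar> \<le> 1" for i using x[of i] by (cases "i < n") (auto simp: abs_le_iff)
    ultimately show "x \<in> {x \<in> Rn n. \<forall>i. \<bar>x i\<bar> \<le> 1}" by (simp add: Rn_def)
  next
    fix x assume "x \<in> {x \<in> Rn n. \<forall>i. \<bar>x i\<bar> \<le> 1}"
    then have "n \<le> i \<Longrightarrow> x i = 0" "\<bar>x i\<bar> \<le> 1" for i by (auto simp: Rn_def)
    then have "x i \<in> ?S i" for i by (cases "i < n") (auto simp: abs_le_iff minus_le_iff)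
    then show "x \<in> PiE UNIV ?S" by (auto simp: PiE_UNIV_domain)
  qed
  ultimately show ?thesis by simp
qed

lemma open_unit_box: "open {x :: vec. \<forall>i<n. \<bar>x i\<bar> < 1}"
proof -
  have "open (\<Inter>i\<in>{..<n}. {x :: vec. \<bar>x i\<bar> < 1})"
    by (intro open_INT ballI open_Collect_less continuous_on_rabs continuous_on_product_coordinates continuous_on_const) auto
  moreover have "(\<Inter>i\<in>{..<n}. {x :: vec. \<bar>x i\<bar> < 1}) = {x. \<forall>i<n. \<bar>x i\<bar> < 1}" by auto
  ultimately show ?thesis by simp
qed

locale carnot_coordinates = scalable_group \<delta> + lie_vec n br
  for \<delta> :: "real \<Rightarrow> 'g::{metric_space,group_add} \<Rightarrow> 'g" and n br +
  fixes N :: "'g set" and s :: nat and V :: "nat \<Rightarrow> vec set" and \<phi> :: "vec \<Rightarrow> 'g"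
  assumes sub: "scalable_subgroup \<delta> N"
    and strat: "stratification n br s V"
    and bij: "bij_betw \<phi> (Rn n) N" and cont: "continuous_on (Rn n) \<phi>"
    and cont_inv: "continuous_on N (inv_into (Rn n) \<phi>)"
    and hom: "\<And>x y. x \<in> Rn n \<Longrightarrow> y \<in> Rn n \<Longrightarrow> \<phi> (bch br s x y) = \<phi> x + \<phi> y"
    and dil: "\<And>t v. (\<forall>j\<in>{1..s}. v j \<in> V j) \<Longrightarrow> \<phi> (vsum (\<lambda>j. vscale (t ^ j) (v j)) {1..s}) = \<delta> t (\<phi> (vsum v {1..s}))"
begin

lemma s1: "1 \<le> s" using strat by (simp add: stratification_def)

lemma V_subspace: "j \<in> {1..s} \<Longrightarrow> lin_subspace n (V j)"
  using strat by (simp add: stratification_def)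

lemma phi_mem: "x \<in> Rn n \<Longrightarrow> \<phi> x \<in> N"
  using bij by (auto simp: bij_betw_def)

text \<open>The dilation identity at \<open>t = 0\<close> gives this, because
  \<open>\<delta> 0\<close> is constantly 0.\<close>

lemma phi_zero: "\<phi> vzero = 0"
proof -
  have "\<phi> (vsum (\<lambda>j. vscale (0 ^ j) vzero) {1..s}) = \<delta> 0 (\<phi> (vsum (\<lambda>j. vzero) {1..s}))"
    using V_subspace by (intro dil) (auto simp: lin_subspace_def)
  moreover have "vsum (\<lambda>j. vscale (0 ^ j) vzero) {1..s} = vzero"
    by (auto simp: vsum_def vscale_def vzero_def)
  ultimately show ?thesis by simp
qed

lemma V1: "V 1 \<subseteq> Rn n"
  using V_subspace[of 1] s1 by (simp add: lin_subspace_def)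

lemma phi_horizontal:
  assumes "x \<in> V 1"
  shows "\<phi> (vscale t x) = \<delta> t (\<phi> x)"
proof -
  let ?v = "\<lambda>j. if j = 1 then x else vzero"
  have "\<phi> (vsum (\<lambda>j. vscale (t ^ j) (?v j)) {1..s}) = \<delta> t (\<phi> (vsum ?v {1..s}))"
    using V_subspace assms by (intro dil) (auto simp: lin_subspace_def)
  moreover have "vsum (\<lambda>j. vscale (c ^ j) (?v j)) {1..s} = vscale c x" for c
  proof
    fix i
    have "vsum (\<lambda>j. vscale (c ^ j) (?v j)) {1..s} i = (\<Sum>j=1..s. if j = 1 then c * x i else 0)"
      unfolding vsum_def by (rule sum.cong) (auto simp: vscale_def vzero_def)
    then show "vsum (\<lambda>j. vscale (c ^ j) (?v j)) {1..s} i = vscale c x i"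
      using s1 by (simp add: vscale_def)
  qed
  note this[of t] this[of 1]
  moreover have "vsum ?v {1..s} = vsum (\<lambda>j. vscale (1 ^ j) (?v j)) {1..s}" "vscale 1 x = x"
    by (simp_all add: vscale_def)
  ultimately show ?thesis by metis
qed

lemma horizontal_one_parameter:
  assumes "x \<in> V 1"
  shows "\<delta> (a + b) (\<phi> x) = \<delta> a (\<phi> x) + \<delta> b (\<phi> x)"
proof -
  have x: "x \<in> Rn n" using assms V1 by blast
  have "\<phi> (vscale (a + b) x) = \<phi> (vscale a x) + \<phi> (vscale b x)"
    using hom[of "vscale a x" "vscale b x"] x by (simp add: bch_parallel[OF x s1])
  then show ?thesis by (simp add: phi_horizontal[OF assms])
qed

text \<open>The coordinate map is a homeomorphism, so some ball of \<open>N\<close> around 0 lies in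
  the compact image of the unit box. A dilation shrinks any given ball into it, and the inverse
  dilation exhibits that ball as a closed part of a compact set.\<close>

lemma proper: "proper_subgroup \<delta> N"
proof unfold_locales
  show "scalable_subgroup \<delta> N" by (rule sub)
  fix r :: real
  let ?K = "{x \<in> Rn n. \<forall>i. \<bar>x i\<bar> \<le> 1}"
  let ?\<psi> = "inv_into (Rn n) \<phi>"
  have zero: "0 \<in> N" and dil_N: "x \<in> N \<Longrightarrow> t \<noteq> 0 \<Longrightarrow> \<delta> t x \<in> N" for x t
    using sub unfolding scalable_subgroup_def by blast+
  have "?\<psi> 0 = vzero"
    using inv_into_f_f[of \<phi> "Rn n" vzero] bij by (simp add: phi_zero bij_betw_def)
  \<comment> \<open>Only the first \<open>n\<close> coordinates are bounded, since an open set of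
    the product topology restricts finitely many; the others vanish on \<open>Rn n\<close>.\<close>
  define W where "W = {x :: vec. \<forall>i<n. \<bar>x i\<bar> < 1}"
  have "open W" unfolding W_def by (rule open_unit_box)
  then obtain T where T: "open T" "T \<inter> N = ?\<psi> -` W \<inter> N"
    using cont_inv unfolding continuous_on_open_invariant by blast
  have "vzero \<in> W" by (simp add: W_def vzero_def)
  then have "0 \<in> ?\<psi> -` W \<inter> N"
    using zero \<open>?\<psi> 0 = vzero\<close> by simp
  then have "0 \<in> T" using T(2) by blast
  then obtain r0 where r0: "0 < r0" "ball 0 r0 \<subseteq> T" using T(1) by (meson openE)
  have small: "x \<in> \<phi> ` ?K" if "x \<in> N" "dist 0 x < r0" for x
  proof -
    have "x \<in> T \<inter> N" using that r0 by auto
    then have "?\<psi> x \<in> W" using T(2) by blast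
    then have lt: "\<bar>?\<psi> x i\<bar> < 1" if "i < n" for i using that by (simp add: W_def)
    have \<psi>x: "?\<psi> x \<in> Rn n" "\<phi> (?\<psi> x) = x"
      using bij that(1) inv_into_into[of x \<phi> "Rn n"] f_inv_into_f[of x \<phi> "Rn n"] by (simp_all add: bij_betw_def)
    have "\<bar>?\<psi> x i\<bar> \<le> 1" for i
    proof (cases "i < n")
      case True
      then show ?thesis using lt by (simp add: less_imp_le)
    next
      case False
      then show ?thesis using \<psi>x(1) by (simp add: Rn_def)
    qed
    then have "?\<psi> x \<in> ?K" using \<psi>x(1) by simp
    then have "\<phi> (?\<psi> x) \<in> \<phi> ` ?K" by (rule imageI)
    then show ?thesis by (simp only: \<psi>x(2))
  qed
  \<comment> \<open>Chosen so that \<open>t * \<bar>r\<bar> < r0\<close>; the \<open>1\<close>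
    covers \<open>r = 0\<close>.\<close>
  define t where "t = r0 / (2 * (\<bar>r\<bar> + 1))"
  have pos: "0 < 2 * (\<bar>r\<bar> + 1)" by simp
  then have t0: "t > 0" unfolding t_def by (rule divide_pos_pos[OF r0(1)])
  have "t * \<bar>r\<bar> < t * (2 * (\<bar>r\<bar> + 1))" by (rule mult_strict_left_mono[OF _ t0]) simp
  also have "\<dots> = r0" unfolding t_def using pos by simp
  finally have t: "t > 0" "t * \<bar>r\<bar> < r0" using t0 by simp_all
  have "compact (\<phi> ` ?K)"
    by (rule compact_continuous_image[OF continuous_on_subset[OF cont] compact_unit_box]) auto
  then have "compact (\<delta> (1 / t) ` \<phi> ` ?K)"
    by (rule compact_continuous_image[rotated]) (intro continuous_on_dil continuous_on_const continuous_on_id)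
  moreover have "cball 0 r \<inter> N = cball 0 r \<inter> \<delta> (1 / t) ` \<phi> ` ?K"
  proof (intro equalityI subsetI)
    fix x assume x: "x \<in> cball 0 r \<inter> N"
    have "dist 0 (\<delta> t x) = t * dist 0 x" using t by (simp add: dist_dil_0)
    also have "\<dots> \<le> t * \<bar>r\<bar>" using x t by (intro mult_left_mono) auto
    finally have "\<delta> t x \<in> \<phi> ` ?K" using t x by (intro small dil_N) auto
    then have "\<delta> (1 / t) (\<delta> t x) \<in> \<delta> (1 / t) ` \<phi> ` ?K" by (rule imageI)
    then show "x \<in> cball 0 r \<inter> \<delta> (1 / t) ` \<phi> ` ?K" using x t by simp
  next
    fix x assume x: "x \<in> cball 0 r \<inter> \<delta> (1 / t) ` \<phi> ` ?K"
    then obtain z where "z \<in> Rn n" "x = \<delta> (1 / t) (\<phi> z)" by blast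
    then show "x \<in> cball 0 r \<inter> N" using x t by (simp add: dil_N phi_mem)
  qed
  ultimately show "compact (cball 0 r \<inter> N)" by (simp add: closed_Int_compact)
qed

lemma phi_limit_mem:
  assumes "closed S" "\<And>m. X m \<in> Rn n" "\<And>m. \<phi> (X m) \<in> S" "x \<in> Rn n" "\<And>i. (\<lambda>m. X m i) \<longlonglongrightarrow> x i"
  shows "\<phi> x \<in> S"
proof -
  have "X \<longlonglongrightarrow> x" using assms(5) by (rule tendsto_coordinatewise)
  then have "(\<lambda>m. \<phi> (X m)) \<longlonglongrightarrow> \<phi> x"
    using assms(2,4) by (intro continuous_on_tendsto_compose[OF cont]) auto
  with assms(1,3) show ?thesis by (rule closed_sequentially)
qed

text \<open>Parallel vectors multiply by addition, so natural multiples are powers in the group and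
  remain in \<open>S\<close>. They perform the division by \<open>a\<close> in the blow-up
  limits.\<close>

lemma phi_nat_multiple:
  assumes S: "0 \<in> S" "\<And>x y. x \<in> S \<Longrightarrow> y \<in> S \<Longrightarrow> x + y \<in> S" and z: "z \<in> Rn n" "\<phi> z \<in> S"
  shows "\<phi> (vscale (real m) z) \<in> S"
proof (induction m)
  case 0
  then show ?case using S(1) by (simp add: vadd_scale_zero phi_zero)
next
  case (Suc m)
  have "\<phi> (vscale (real m + 1) z) = \<phi> (vscale (real m) z) + \<phi> (vscale 1 z)"
    using hom[of "vscale (real m) z" "vscale 1 z"] z by (simp add: bch_parallel[OF z(1) s1])
  moreover have "vscale 1 z = z" by (simp add: vscale_def)
  ultimately show ?case using Suc S(2) z(2) by (simp add: add.commute)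
qed

text \<open>The Lie algebra of a closed subgroup is a Lie subalgebra; here it contains \<open>V 1\<close>, which generates.\<close>

lemma closed_subgroup_generated:
  assumes S: "closed S" "0 \<in> S" "\<And>x y. x \<in> S \<Longrightarrow> y \<in> S \<Longrightarrow> x + y \<in> S"
    and V1S: "\<And>x. x \<in> V 1 \<Longrightarrow> \<phi> x \<in> S"
  shows "N \<subseteq> S"
proof -
  \<comment> \<open>The vectors whose whole one-parameter subgroup lies in \<open>S\<close>.\<close>
  define L where "L = {v \<in> Rn n. \<forall>t. \<phi> (vscale t v) \<in> S}"
  have LR: "L \<subseteq> Rn n" by (auto simp: L_def)
  have L_scale: "vscale c v \<in> L" if "v \<in> L" for c v
  proof -
    have "vscale t (vscale c v) = vscale (t * c) v" for t by (simp add: vscale_def mult.assoc)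
    then show ?thesis using that by (auto simp: L_def)
  qed
  have phi_L: "\<phi> v \<in> S" if "v \<in> L" for v
  proof -
    have "vscale 1 v = v" by (simp add: vscale_def)
    then show ?thesis using that by (auto simp: L_def) metis
  qed
  \<comment> \<open>Reciprocals of integers: dividing a product by \<open>a m\<close> or its square
    means taking the power with exponent \<open>Suc m\<close> or its square, which stays in
    \<open>S\<close>.\<close>
  define a where "a m = 1 / real (Suc m)" for m
  have a: "a \<longlonglongrightarrow> 0" "a m \<noteq> 0" for m
    unfolding a_def using LIMSEQ_inverse_real_of_nat by (auto simp: inverse_eq_divide)
  have L_add: "vadd v w \<in> L" if v: "v \<in> L" and w: "w \<in> L" for v w
  proof -
    have "\<phi> (vscale t (vadd v w)) \<in> S" for t
    proof -
      define x y where "x = vscale t v" and "y = vscale t w"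
      have xy: "x \<in> L" "y \<in> L" using v w L_scale by (auto simp: x_def y_def)
      then have R: "x \<in> Rn n" "y \<in> Rn n" using LR by auto
      define Z where "Z m = bch br s (vscale (a m) x) (vscale (a m) y)" for m
      have Z: "Z m \<in> Rn n" for m using R by (simp add: Z_def bch_mem)
      have "\<phi> (Z m) \<in> S" for m
        using hom[of "vscale (a m) x" "vscale (a m) y"] R xy by (simp add: Z_def S(3) phi_L L_scale)
      then have ZS: "\<phi> (vscale (real (Suc m)) (Z m)) \<in> S" for m
        using Z S by (intro phi_nat_multiple) auto
      have "\<phi> (vadd x y) \<in> S"
      proof (rule phi_limit_mem[OF S(1) _ ZS])
        show "(\<lambda>m. vscale (real (Suc m)) (Z m) i) \<longlonglongrightarrow> vadd x y i" for i
          using bch_blow_up[OF a s1 R(1) R(1) tendsto_const R(2) R(2) tendsto_const, of i]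
          by (simp add: Z_def a_def vscale_def vadd_def mult.commute)
      qed (use Z R in auto)
      moreover have "vadd x y = vscale t (vadd v w)" by (simp add: x_def y_def vscale_def vadd_def distrib_left)
      ultimately show ?thesis by simp
    qed
    then show ?thesis using v w LR by (auto simp: L_def)
  qed
  \<comment> \<open>A product truncated at degree 1 contains no bracket; the induction over the
    layers reaches this step only for \<open>2 \<le> s\<close>.\<close>
  have L_br: "br v w \<in> L" if v: "v \<in> L" and w: "w \<in> L" and s2: "2 \<le> s" for v w
  proof -
    have "\<phi> (vscale t (br v w)) \<in> S" for t
    proof -
      \<comment> \<open>The factor 2 cancels the \<open>1 / 2\<close> of the degree-two
        term.\<close>
      define x where "x = vscale (2 * t) v"
      have xy: "x \<in> L" "w \<in> L" using v w L_scale by (auto simp: x_def)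
      then have R: "x \<in> Rn n" "w \<in> Rn n" "v \<in> Rn n" using LR v by auto
      define Z where "Z m = bch br s (bch br s (vscale (a m) x) (vscale (a m) w)) (vscale (- a m) (vadd x w))" for m
      have Z: "Z m \<in> Rn n" for m using R by (simp add: Z_def bch_mem)
      have "\<phi> (Z m) \<in> S" for m
        using R xy by (simp add: Z_def hom bch_mem S(3) phi_L L_scale L_add)
      then have ZS: "\<phi> (vscale (real ((Suc m)\<^sup>2)) (Z m)) \<in> S" for m
        using Z S by (intro phi_nat_multiple) auto
      have "\<phi> (vscale (1 / 2) (br x w)) \<in> S"
      proof (rule phi_limit_mem[OF S(1) _ ZS])
        show "(\<lambda>m. vscale (real ((Suc m)\<^sup>2)) (Z m) i) \<longlonglongrightarrow> vscale (1 / 2) (br x w) i" for i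
          using bch_blow_up_bracket[OF a s2 R(1,2), of i]
          by (simp add: Z_def a_def vscale_def power_divide mult.commute del: of_nat_Suc)
      qed (use Z R br_mem in auto)
      moreover have "vscale (1 / 2) (br x w) = vscale t (br v w)"
        using br_scale[OF R(3,2), of "2 * t" 1] by (simp add: x_def vscale_def)
      ultimately show ?thesis by simp
    qed
    then show ?thesis using v w LR by (auto simp: L_def intro: br_mem)
  qed
  have L_zero: "vzero \<in> L" using S(2) by (simp add: L_def vadd_scale_zero phi_zero)
  have L_sum: "vsum v A \<in> L" if "finite A" "\<And>i. i \<in> A \<Longrightarrow> v i \<in> L" for v and A :: "nat set"
    using that
  proof (induction A)
    case empty
    have "vsum v {} = vzero" by (simp add: vsum_def vzero_def)
    then show ?case using L_zero by simp
  next
    case (insert i A)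
    then have "vsum v (insert i A) = vadd (v i) (vsum v A)" by (simp add: vsum_def vadd_def)
    then show ?case using insert by (simp add: L_add)
  qed
  have V1_L: "V 1 \<subseteq> L"
  proof
    fix x assume x: "x \<in> V 1"
    have "vscale t x \<in> V 1" for t
      using V_subspace[of 1] s1 x by (simp add: lin_subspace_def)
    then show "x \<in> L" using x V1 V1S by (auto simp: L_def)
  qed
  have V_L: "j \<in> {1..s} \<Longrightarrow> V j \<subseteq> L" for j
  proof (induction j)
    case (Suc j)
    show ?case
    proof (cases "j = 0")
      case True
      then show ?thesis using V1_L by simp
    next
      case False
      then have j: "j \<in> {1..<s}" "2 \<le> s" using Suc.prems by auto
      note V1_L
      moreover have "V j \<subseteq> L" using Suc.IH j by auto
      moreover have "V (Suc j) = bracket_span br (V 1) (V j)"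
        using strat j(1) by (simp add: stratification_def)
      ultimately show ?thesis
      proof -
        assume VL: "V 1 \<subseteq> L" "V j \<subseteq> L" and eq: "V (Suc j) = bracket_span br (V 1) (V j)"
        show "V (Suc j) \<subseteq> L"
          unfolding eq bracket_span_def
        proof (rule subsetI, unfold mem_Collect_eq, elim exE conjE)
          fix x and k :: nat and a b assume x: "x = vsum (\<lambda>i. br (a i) (b i)) {..<k}"
            and ab: "\<forall>i<k. a i \<in> V 1 \<and> b i \<in> V j"
          have "br (a i) (b i) \<in> L" if "i < k" for i
            using ab that VL by (intro L_br[OF _ _ j(2)]) auto
          note br_L = this
          show "x \<in> L" unfolding x by (rule L_sum) (simp_all add: br_L)
        qed
      qed
    qed
  qed simp
  show "N \<subseteq> S"
  proof
    fix y assume "y \<in> N"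
    then obtain x where x: "x \<in> Rn n" "y = \<phi> x" using bij by (auto simp: bij_betw_def)
    from strat x(1) obtain v where "\<forall>j\<in>{1..s}. v j \<in> V j" "x = vsum v {1..s}"
      unfolding stratification_def by meson
    have "v j \<in> L" if "j \<in> {1..s}" for j
      using V_L[OF that] \<open>\<forall>j\<in>{1..s}. v j \<in> V j\<close> that by blast
    then have "vsum v {1..s} \<in> L" by (intro L_sum finite_atLeastAtMost)
    then have "x \<in> L" using \<open>x = vsum v {1..s}\<close> by simp
    then show "y \<in> S" using x phi_L by simp
  qed
qed

text \<open>Each direction costs a null set, so only countably many are affordable. A countable
  dense part of \<open>V 1\<close> suffices, since a closed \<open>S\<close> that contains its image
  contains the image of \<open>V 1\<close>.\<close>

lemma generated: "horizontally_generated \<delta> N"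
proof -
  obtain T where T: "countable T" "T \<subseteq> V 1" "V 1 \<subseteq> closure T" by (rule countable_dense_subset)
  have TR: "T \<subseteq> Rn n" using T(2) V1 by blast
  show ?thesis
    unfolding horizontally_generated_def
  proof (intro exI[of _ "\<phi> ` T"] conjI allI ballI impI)
    show "\<phi> ` T \<subseteq> N" using TR phi_mem by blast
    show "countable (\<phi> ` T)" using T(1) by simp
    show "\<delta> (a + b) u = \<delta> a u + \<delta> b u" if "u \<in> \<phi> ` T" for u a b
      using that T(2) horizontal_one_parameter by auto
    fix S assume S: "closed S \<and> 0 \<in> S \<and> (\<forall>x\<in>S. \<forall>y\<in>S. x + y \<in> S) \<and> (\<forall>x\<in>S. - x \<in> S) \<and> \<phi> ` T \<subseteq> S"
    have "\<phi> x \<in> S" if "x \<in> V 1" for x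
    proof -
      have "x \<in> closure T" using T(3) that by blast
      then obtain X where X: "\<And>m. X m \<in> T" "X \<longlonglongrightarrow> x"
        unfolding closure_sequential by blast
      have "(\<lambda>m. \<phi> (X m)) \<longlonglongrightarrow> \<phi> x"
      proof (rule continuous_on_tendsto_compose[OF cont X(2)])
        show "x \<in> Rn n" using that V1 by blast
        have "X m \<in> Rn n" for m using X(1) TR by blast
        then show "\<forall>\<^sub>F m in sequentially. X m \<in> Rn n" by simp
      qed
      moreover have "\<phi> (X m) \<in> S" for m using S X(1) by blast
      moreover have "closed S" using S by blast
      ultimately show ?thesis using closed_sequentially[of S "\<lambda>m. \<phi> (X m)"] by blast
    qed
    then show "N \<subseteq> S" by (rule closed_subgroup_generated[rotated 3]) (use S in blast)+
  qed
qed

end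

lemma (in scalable_group) carnot_structure_imp:
  assumes "scalable_subgroup \<delta> N" "carnot_structure N \<delta>"
  shows "proper_subgroup \<delta> N" "horizontally_generated \<delta> N"
proof -
  obtain n br s V \<phi> where c: "lie_algebra_on n br" "stratification n br s V"
    "bij_betw \<phi> (Rn n) N" "continuous_on (Rn n) \<phi>" "continuous_on N (inv_into (Rn n) \<phi>)"
    "\<forall>x\<in>Rn n. \<forall>y\<in>Rn n. \<phi> (bch br s x y) = \<phi> x + \<phi> y"
    "\<forall>t v. (\<forall>j\<in>{1..s}. v j \<in> V j) \<longrightarrow> \<phi> (vsum (\<lambda>j. vscale (t ^ j) (v j)) {1..s}) = \<delta> t (\<phi> (vsum v {1..s}))"
    using assms(2) unfolding carnot_structure_def by (elim exE conjE) (rule that)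
  interpret carnot_coordinates \<delta> n br N s V \<phi>
    by unfold_locales (use c assms(1) in auto)
  show "proper_subgroup \<delta> N" "horizontally_generated \<delta> N" by (rule proper, rule generated)
qed

section \<open>The exceptional set of a Lipschitz function\<close>

theorem mainTheorem1:
  fixes \<delta> :: "real \<Rightarrow> 'g::{complete_space,group_add} \<Rightarrow> 'g"
    and f :: "'g \<Rightarrow> real"
  assumes "metric_scalable_group \<delta>"
    and "\<exists>C. C-lipschitz_on UNIV f"
  shows "\<exists>\<Omega>. \<Omega> \<in> sets borel \<and>
           (\<forall>N. carnot_filtration \<delta> N \<longrightarrow> negligible_wrt N \<Omega>) \<and>
           (\<forall>p. p \<notin> \<Omega> \<longrightarrow> gateaux_differentiable_at \<delta> f p)"
proof (cases "\<exists>N. carnot_filtration \<delta> N")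
  case False
  \<comment> \<open>Without any filtration negligibility is vacuous, and \<open>UNIV\<close> is
    Borel; the set chosen in the other case is shown to be Borel by means of a filtration.\<close>
  then show ?thesis by (intro exI[of _ UNIV]) simp
next
  case True
  interpret scalable_group \<delta> by unfold_locales (rule assms(1))
  obtain C where f: "C-lipschitz_on UNIV f" using assms(2) by blast
  \<comment> \<open>No filtration enters here, so one set serves all of them.\<close>
  define \<Omega> where "\<Omega> = {p. \<not> gateaux_differentiable_at \<delta> f p}"
  have negl: "negligible_wrt N \<Omega>" if N: "carnot_filtration \<delta> N" for N
  proof -
    have dense: "closure (\<Union>m. N m) = UNIV"
      and N1: "scalable_subgroup \<delta> (N m)" "carnot_structure (N m) \<delta>" "N m \<subseteq> N (Suc m)" for m
      using N unfolding carnot_filtration_def by auto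
    note PN = carnot_structure_imp[OF N1(1,2)]
    \<comment> \<open>Countable, so that each piece \<open>\<Omega>s m\<close> is Borel; dense in
      \<open>N m\<close>, so that differentiability along \<open>N m\<close> is recovered by
      closure.\<close>
    have "\<exists>D. countable D \<and> D \<subseteq> N m \<and> N m \<subseteq> closure D" for m
      using proper_subgroup.separable[OF PN(1)] by metis
    then obtain D where D: "\<And>m. countable (D m)" "\<And>m. D m \<subseteq> N m" "\<And>m. N m \<subseteq> closure (D m)" by metis
    have mono: "N i \<subseteq> N j" if "i \<le> j" for i j using that N1(3) by (rule lift_Suc_mono_le[rotated])
    define \<Omega>s where "\<Omega>s m = {p. \<not> differentiable_along f p (D m)}" for m
    have "gateaux_differentiable_at \<delta> f p \<longleftrightarrow> (\<forall>m. differentiable_along f p (D m))" for p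
    proof
      assume "gateaux_differentiable_at \<delta> f p"
      then have "differentiable_along f p (\<Union>m. N m)" using gateaux_differentiable_iff[OF f dense] by blast
      then show "\<forall>m. differentiable_along f p (D m)"
        using D(2) differentiable_along_mono by blast
    next
      assume "\<forall>m. differentiable_along f p (D m)"
      then have d: "differentiable_along f p (N m)" for m
        using differentiable_along_mono[OF differentiable_along_closure[OF f] D(3)] by blast
      have "differentiable_along f p (\<Union>m. N m)"
        unfolding differentiable_along_def
      proof (intro conjI ballI)
        fix u assume "u \<in> (\<Union>m. N m)"
        then obtain i where i: "u \<in> N i" by blast
        then show "\<exists>l. (quot f p u \<longlongrightarrow> l) (at 0)" using d unfolding differentiable_along_def by blast
        fix v assume "v \<in> (\<Union>m. N m)"
        then obtain j where "v \<in> N j" by blast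
        \<comment> \<open>Additivity is known level by level; nestedness puts two directions of
          different levels into a common one.\<close>
        then have "u \<in> N (max i j)" "v \<in> N (max i j)"
          using i mono[of i "max i j"] mono[of j "max i j"] by auto
        then show "(defect f p u v \<longlongrightarrow> 0) (at 0)" using d unfolding differentiable_along_def by blast
      qed
      then show "gateaux_differentiable_at \<delta> f p" using gateaux_differentiable_iff[OF f dense] by blast
    qed
    then have \<Omega>: "\<Omega> = (\<Union>m. \<Omega>s m)" by (auto simp: \<Omega>_def \<Omega>s_def)
    have "\<Omega>s m \<in> sets borel" for m
    proof -
      have "\<Omega>s m = - {p. differentiable_along f p (D m)}" by (auto simp: \<Omega>s_def)
      then show ?thesis using differentiable_along_borel[OF f D(1)] by (simp add: borel_comp)
    qed
    moreover have "emeasure \<mu> (N m \<inter> (\<lambda>x. g + x) ` \<Omega>s m) = 0" if "haar_measure_on (N m) \<mu>" for m g \<mu>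
      unfolding \<Omega>s_def by (rule translated_null[OF f PN that D(2)])
    ultimately show ?thesis
      unfolding negligible_wrt_def \<Omega> by blast
  qed
  \<comment> \<open>Any single filtration already exhibits \<open>\<Omega>\<close> as a countable
    union of Borel sets.\<close>
  have "\<Omega> \<in> sets borel" using True negl by (auto simp: negligible_wrt_def)
  then show ?thesis using negl by (intro exI[of _ \<Omega>]) (auto simp: \<Omega>_def)
qed

end
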